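(* Let $\epsilon>0$ and suppose that $K$ is the uniform kernel $K(\eta)=\mathbf{1}_{\{\|\eta\|<\epsilon\}}$. Let $M\ge 1$ be an integer and suppose that the ABC-MCMC transition kernel $Q_M$ (using $M$ pseudo-samples per iteration) is nonnegative definite. Then for every $f\in L^2(\pi_K)$, $$v(f,Q_1)\le (2M-1)\,v(f,Q_M),$$ where $Q_1$ is the ABC-MCMC kernel with the same proposal kernel, prior, model, summary statistic, observed data and $K$, but using a single pseudo-sample per iteration.
   Context: Setting. $\Theta$ is the parameter space with a reference measure $d\theta$, $\pi(\theta)$ is a prior density on $\Theta$, $p(y|\theta)$ is a model (for each $\theta$, a probability density in $y$ on the data space $\mathcal{Y}$ with reference measure $dy$), $y_{\mathrm{obs}}\in\mathcal{Y}$ is the observed data, $\eta$ is a summary statistic on $\mathcal{Y}$ with values in a finite-dimensional real vector space with norm $\|\cdot\|$, and $K\ge 0$ is a kernel function on that vector space. The target is the probability density $$\pi_K(\theta)\propto \pi(\theta)\int K(\eta(y_{\mathrm{obs}})-\eta(y))\,p(y|\theta)\,dy,$$ whose normalizing constant is assumed positive and finite. The proposal $q(\theta'|\theta)$ is a transition kernel on $\Theta$ with a density with respect to $d\theta$, and is reversible (with respect to some measure on $\Theta$). ABC-MCMC kernel $Q_M$. For an integer $M\ge1$ and $\theta\in\Theta$, let $T_{M,\theta}$ be the random variable $\pi(\theta)\frac1M\sum_{i=1}^M K(\eta(y_{\mathrm{obs}})-\eta(y_i))$, where $y_1,\dots,y_M$ are i.i.d. from $p(\cdot|\theta)$. $Q_M$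 is the following Markov kernel on $\Theta\times[0,\infty)$: from state $(\theta,T)$, draw $\theta'\sim q(\cdot|\theta)$, draw $T'$ from the law of $T_{M,\theta'}$ with fresh randomness, and move to $(\theta',T')$ with probability $\min\left\{1,\frac{T'q(\theta|\theta')}{T q(\theta'|\theta)}\right\}$ (interpreted as $1$ when the denominator is $0$); otherwise stay at $(\theta,T)$. $Q_M$ is reversible with respect to the probability measure $\tilde\pi_M(d\theta,dt)\propto t\,\mathbb{P}(T_{M,\theta}\in dt)\,d\theta$, whose $\theta$-marginal is $\pi_K$. Nonnegative definite means $\int g\,(Q_Mg)\,d\tilde\pi_M\ge0$ for all $g\in L^2(\tilde\pi_M)$. Asymptotic variance. For a probability measure $\mu$, $L^2(\mu)$ is the set of real measurable $f$ with $\int f^2d\mu<\infty$. A function $f$ of $\theta$ is identified with the function $(\theta,t)\mapsto f(\theta)$. For a reversible kernel $H$ with its stationary distribution, $v(f,H)=\lim_{n\to\infty} n\,\mathrm{Var}\left(\frac1n\sum_{t=1}^n f(X^{(t)})\right)\in[0,\infty]$, where $(X^{(t)})$ is the Markov chain with kernel $H$ started from its stationary distribution. The value $+\infty$ is allowed. *)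

theory Defs
  imports "HOL-Probability.Probability"
begin

section \<open>Markov kernels and asymptotic variance\<close>

definition L2 :: "'s measure \<Rightarrow> ('s \<Rightarrow> real) set" where
  "L2 \<mu> = {f \<in> borel_measurable \<mu>. integrable \<mu> (\<lambda>x. (f x)\<^sup>2)}"

definition reversible_wrt :: "('s \<Rightarrow> 's measure) \<Rightarrow> 's measure \<Rightarrow> bool" where
  "reversible_wrt H \<mu> \<longleftrightarrow> (\<forall>A\<in>sets \<mu>. \<forall>B\<in>sets \<mu>.
     (\<integral>\<^sup>+x\<in>A. emeasure (H x) B \<partial>\<mu>) = (\<integral>\<^sup>+x\<in>B. emeasure (H x) A \<partial>\<mu>))"

definition nonneg_definite :: "('s \<Rightarrow> 's measure) \<Rightarrow> 's measure \<Rightarrow> bool" where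
  "nonneg_definite H \<mu> \<longleftrightarrow> (\<forall>g\<in>L2 \<mu>. 0 \<le> (\<integral>x. g x * (\<integral>y. g y \<partial>H x) \<partial>\<mu>))"

text \<open>
  The law on the path space of the Markov chain with kernel \<open>H\<close> and initial distribution \<open>\<mu>\<close>,
  given by the Ionescu-Tulcea theorem: \<open>\<omega> 0\<close> has law \<open>\<mu>\<close>, and \<open>\<omega> (Suc j)\<close> has conditional law
  \<open>H (\<omega> j)\<close> given \<open>\<omega> 0, \<dots>, \<omega> j\<close>.
\<close>
definition path_law :: "('s \<Rightarrow> 's measure) \<Rightarrow> 's measure \<Rightarrow> (nat \<Rightarrow> 's) measure" where
  "path_law H \<mu> =
     projective_family.lim UNIV
       (Ionescu_Tulcea.CI (\<lambda>i \<omega>. case i of 0 \<Rightarrow> \<mu> | Suc j \<Rightarrow> H (\<omega> j)) (\<lambda>_. \<mu>))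
       (\<lambda>_. \<mu>)"

text \<open>
  The time indices are \<open>0, \<dots>, n - 1\<close> rather than \<open>1, \<dots>, n\<close>. The limit is taken in the extended
  reals, so the value \<open>\<infinity>\<close> is allowed; it exists whenever \<open>H\<close> is reversible with respect to the
  probability measure \<open>\<mu>\<close> and \<open>f \<in> L2 \<mu>\<close>.
\<close>
definition asymptotic_variance :: "('s \<Rightarrow> real) \<Rightarrow> ('s \<Rightarrow> 's measure) \<Rightarrow> 's measure \<Rightarrow> ereal" where
  "asymptotic_variance f H \<mu> =
     lim (\<lambda>n. ereal (real n *
       prob_space.variance (path_law H \<mu>) (\<lambda>\<omega>. (1 / real n) * (\<Sum>t<n. f (\<omega> t)))))"

definition normalize_measure :: "'s measure \<Rightarrow> 's measure" where
  "normalize_measure \<mu> = scale_measure (1 / emeasure \<mu> (space \<mu>)) \<mu>"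

section \<open>Approximate Bayesian computation\<close>

text \<open>
  \<open>p y \<theta>\<close> and \<open>q \<theta>' \<theta>\<close> stand for \<open>p(y|\<theta>)\<close> and \<open>q(\<theta>'|\<theta>)\<close>. The prior density is not required to
  integrate to one (improper priors are covered); what is required is that the normalizing constant
  of the target is positive and finite. The measure making the proposal reversible is required to be
  nonzero and \<open>\<sigma>\<close>-finite, since the zero measure would make the condition void, and so would
  \<open>\<infinity> \<cdot> \<Theta>\<close> whenever \<open>q\<close> is positive.
\<close>
locale abc_model =
  fixes \<Theta> :: "'a measure" and prior :: "'a \<Rightarrow> real"
    and Y :: "'b measure" and p :: "'b \<Rightarrow> 'a \<Rightarrow> real" and y_obs :: 'b
    and \<eta> :: "'b \<Rightarrow> 'v::real_normed_vector" and K :: "'v \<Rightarrow> real"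
    and q :: "'a \<Rightarrow> 'a \<Rightarrow> real"
  assumes sigma_finite_\<Theta>: "sigma_finite_measure \<Theta>"
    and prior_measurable: "prior \<in> borel_measurable \<Theta>"
    and prior_nonneg: "\<And>\<theta>. \<theta> \<in> space \<Theta> \<Longrightarrow> 0 \<le> prior \<theta>"
    and sigma_finite_Y: "sigma_finite_measure Y"
    and p_measurable: "(\<lambda>(\<theta>, y). p y \<theta>) \<in> borel_measurable (\<Theta> \<Otimes>\<^sub>M Y)"
    and p_nonneg: "\<And>\<theta> y. \<theta> \<in> space \<Theta> \<Longrightarrow> y \<in> space Y \<Longrightarrow> 0 \<le> p y \<theta>"
    and p_density: "\<And>\<theta>. \<theta> \<in> space \<Theta> \<Longrightarrow> (\<integral>\<^sup>+y. ennreal (p y \<theta>) \<partial>Y) = 1"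
    and y_obs: "y_obs \<in> space Y"
    and finite_dim: "\<exists>B::'v set. finite B \<and> span B = UNIV"
    and \<eta>_measurable: "\<eta> \<in> borel_measurable Y"
    and K_measurable: "K \<in> borel_measurable borel"
    and K_nonneg: "\<And>z. 0 \<le> K z"
    and target_normalizable:
      "0 < (\<integral>\<^sup>+\<theta>. ennreal (prior \<theta>) *
              (\<integral>\<^sup>+y. ennreal (K (\<eta> y_obs - \<eta> y)) * ennreal (p y \<theta>) \<partial>Y) \<partial>\<Theta>)"
      "(\<integral>\<^sup>+\<theta>. ennreal (prior \<theta>) *
              (\<integral>\<^sup>+y. ennreal (K (\<eta> y_obs - \<eta> y)) * ennreal (p y \<theta>) \<partial>Y) \<partial>\<Theta>) < \<infinity>"
    and q_measurable: "(\<lambda>(\<theta>, \<theta>'). q \<theta>' \<theta>) \<in> borel_measurable (\<Theta> \<Otimes>\<^sub>M \<Theta>)"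
    and q_nonneg: "\<And>\<theta> \<theta>'. \<theta> \<in> space \<Theta> \<Longrightarrow> \<theta>' \<in> space \<Theta> \<Longrightarrow> 0 \<le> q \<theta>' \<theta>"
    and q_density: "\<And>\<theta>. \<theta> \<in> space \<Theta> \<Longrightarrow> (\<integral>\<^sup>+\<theta>'. ennreal (q \<theta>' \<theta>) \<partial>\<Theta>) = 1"
    and q_reversible: "\<exists>\<rho>. sets \<rho> = sets \<Theta> \<and> sigma_finite_measure \<rho> \<and> emeasure \<rho> (space \<rho>) \<noteq> 0 \<and>
          reversible_wrt (\<lambda>\<theta>. density \<Theta> (\<lambda>\<theta>'. ennreal (q \<theta>' \<theta>))) \<rho>"
begin

definition target :: "'a measure" where
  "target = normalize_measure (density \<Theta> (\<lambda>\<theta>. ennreal (prior \<theta>) *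
     (\<integral>\<^sup>+y. ennreal (K (\<eta> y_obs - \<eta> y)) * ennreal (p y \<theta>) \<partial>Y)))"

definition state_space :: "('a \<times> real) measure" where
  "state_space = \<Theta> \<Otimes>\<^sub>M restrict_space borel {0..}"

definition T_law :: "nat \<Rightarrow> 'a \<Rightarrow> real measure" where
  "T_law M \<theta> = distr (\<Pi>\<^sub>M i\<in>{..<M}. density Y (\<lambda>y. ennreal (p y \<theta>))) (restrict_space borel {0..})
     (\<lambda>y. prior \<theta> * ((1 / real M) * (\<Sum>i<M. K (\<eta> y_obs - \<eta> (y i)))))"

definition propose :: "nat \<Rightarrow> 'a \<Rightarrow> ('a \<times> real) measure" where
  "propose M \<theta> = density \<Theta> (\<lambda>\<theta>'. ennreal (q \<theta>' \<theta>)) \<bind>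
     (\<lambda>\<theta>'. distr (T_law M \<theta>') state_space (\<lambda>T'. (\<theta>', T')))"

definition accept_prob :: "'a \<times> real \<Rightarrow> 'a \<times> real \<Rightarrow> real" where
  "accept_prob = (\<lambda>(\<theta>, T) (\<theta>', T').
     if T * q \<theta>' \<theta> = 0 then 1 else min 1 ((T' * q \<theta> \<theta>') / (T * q \<theta>' \<theta>)))"

definition Q :: "nat \<Rightarrow> 'a \<times> real \<Rightarrow> ('a \<times> real) measure" where
  "Q M x = propose M (fst x) \<bind>
     (\<lambda>x'. distr (measure_pmf (bernoulli_pmf (accept_prob x x'))) state_space
              (\<lambda>accept. if accept then x' else x))"

definition extended_target :: "nat \<Rightarrow> ('a \<times> real) measure" where
  "extended_target M = normalize_measure
     (density (\<Theta> \<bind> (\<lambda>\<theta>. distr (T_law M \<theta>) state_space (\<lambda>t. (\<theta>, t)))) (\<lambda>(\<theta>, t). ennreal t))"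

end

end

(*
  Let W be the fraction of the M pseudo-samples that hit the acceptance region, so T = prior(theta) W with
  E W = h(theta). The Dirichlet form of Q_M on a function u(theta) is proportional to
    int int (u(theta) - u(theta'))^2 E min (prior(theta) q(theta'|theta) W, prior(theta') q(theta|theta') W').
  Since a positive W is at least 1/M, the minimum is at most M W W' min (prior(theta) q(theta'|theta),
  prior(theta') q(theta|theta')), with equality for M = 1. Hence the Dirichlet form of Q_M is at most M times
  that of Q_1; functions of (theta, T) need not be considered for Q_1, because T = prior(theta) almost surely there.
  The variational formula for the resolvent turns this into <f, (1 - Q_1)^-1 f> <= M <f, (1 - Q_M)^-1 f>
  for centred f, i.e. v(f, Q_1) + |f|^2 <= M (v(f, Q_M) + |f|^2). If Q_M is nonnegative definite then
  |f|^2 <= v(f, Q_M), and the claim follows.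
*)

theory Submission
  imports Defs
begin

section \<open>Abel and Cesaro means of autocovariances\<close>

text \<open>The inverse of \<open>1 - H\<close> is only formal: it may fail to exist even on centred
  functions, and the variance may be infinite. The comparison is therefore made for the bounded
  resolvents at \<open>0 < r < 1\<close>, whose quadratic form at \<open>f\<close> is the Abel sum
  of the autocovariances, and \<open>r\<close> is sent to 1 afterwards. That passage is delicate for
  \<open>Q 1\<close>, which in general is not known to be nonnegative definite: its autocovariances
  may change sign and need not tend to 0. Since \<open>H\<close> acts as a self-adjoint contraction,
  the even-lag terms are decreasing squared norms that dominate the odd-lag terms following them.
  Summing in consecutive pairs thus makes everything monotone and takes the place of a spectral
  measure. The two chains also have different stationary measures, sharing the marginal on the
  parameter. The comparison is therefore stated for a transfer of test functions from one chain to
  the other that preserves norm, mean and pairing with \<open>f\<close>, and enlarges the Dirichlet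
  form by a factor of at most \<open>C\<close>.\<close>

lemma cesaro_null:
  fixes a :: "nat \<Rightarrow> real"
  assumes "a \<longlonglongrightarrow> 0"
  shows "(\<lambda>n. (\<Sum>m<n. a m) / real n) \<longlonglongrightarrow> 0"
proof (rule LIMSEQ_I)
  fix e :: real assume "0 < e"
  then obtain N where N: "\<And>m. N \<le> m \<Longrightarrow> \<bar>a m\<bar> < e / 2"
    using LIMSEQ_D[OF assms, of "e / 2"] by auto
  define B where "B = (\<Sum>m<N. \<bar>a m\<bar>)"
  obtain N' where N': "2 * B / e < real N'"
    using reals_Archimedean2 by blast
  have "norm ((\<Sum>m<n. a m) / real n - 0) < e" if n: "max N (Suc N') \<le> n" for n
  proof -
    have "\<bar>\<Sum>m<n. a m\<bar> \<le> (\<Sum>m<n. \<bar>a m\<bar>)" by (rule sum_abs)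
    also have "{..<n} = {..<N} \<union> {N..<n}" using n by auto
    also have "(\<Sum>m\<in>{..<N} \<union> {N..<n}. \<bar>a m\<bar>) = B + (\<Sum>m\<in>{N..<n}. \<bar>a m\<bar>)"
      unfolding B_def by (subst sum.union_disjoint) auto
    also have "(\<Sum>m\<in>{N..<n}. \<bar>a m\<bar>) \<le> (\<Sum>m\<in>{N..<n}. e / 2)"
      by (intro sum_mono) (use N in force)
    also have "\<dots> \<le> real n * (e / 2)" using \<open>0 < e\<close> by (simp add: mult_right_mono)
    finally have *: "\<bar>\<Sum>m<n. a m\<bar> \<le> B + real n * (e / 2)" using \<open>{..<n} = _\<close> by simp
    have "2 * B < e * real N'" using N' \<open>0 < e\<close> by (simp add: field_simps)
    also have "\<dots> \<le> e * real n" using n \<open>0 < e\<close> by simp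
    finally have "\<bar>\<Sum>m<n. a m\<bar> < e * real n" using * by (simp add: mult.commute)
    moreover have "0 < real n" using n by simp
    ultimately show ?thesis by (simp add: field_simps)
  qed
  then show "\<exists>n0. \<forall>n\<ge>n0. norm ((\<Sum>m<n. a m) / real n - 0) < e" by blast
qed

lemma cesaro:
  fixes a :: "nat \<Rightarrow> real"
  assumes "a \<longlonglongrightarrow> l"
  shows "(\<lambda>n. (\<Sum>m<n. a m) / real n) \<longlonglongrightarrow> l"
proof -
  have "(\<lambda>n. (\<Sum>m<n. a m - l) / real n) \<longlonglongrightarrow> 0"
    using assms by (intro cesaro_null) (simp add: LIM_zero_iff)
  moreover have "eventually (\<lambda>n. (\<Sum>m<n. a m - l) / real n = (\<Sum>m<n. a m) / real n - l) sequentially"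
    using eventually_gt_at_top[of 0] by eventually_elim (simp add: sum_subtractf field_simps)
  ultimately have "(\<lambda>n. (\<Sum>m<n. a m) / real n - l) \<longlonglongrightarrow> 0"
    by (rule Lim_transform_eventually)
  then show ?thesis by (simp add: LIM_zero_iff)
qed

text \<open>Truncation at \<open>Z + 1\<close> turns divergence into convergence to
  \<open>Z + 1\<close>, so the means of the truncated sequence eventually exceed
  \<open>Z\<close>.\<close>

lemma cesaro_at_top:
  fixes a :: "nat \<Rightarrow> real"
  assumes nonneg: "\<And>m. 0 \<le> a m" and "filterlim a at_top sequentially"
  shows "filterlim (\<lambda>n. (\<Sum>m<n. a m) / real n) at_top sequentially"
  unfolding filterlim_at_top
proof
  fix Z :: real
  define b where "b m = min (a m) (Z + 1)" for m
  have "eventually (\<lambda>m. b m = Z + 1) sequentially"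
    using assms(2)[unfolded filterlim_at_top, rule_format, of "Z + 1"]
    by eventually_elim (simp add: b_def)
  then have "b \<longlonglongrightarrow> Z + 1" by (rule tendsto_eventually)
  from order_tendstoD(1)[OF cesaro[OF this], of Z]
  have "\<forall>\<^sub>F n in sequentially. Z < (\<Sum>m<n. b m) / real n" by simp
  then show "\<forall>\<^sub>F n in sequentially. Z \<le> (\<Sum>m<n. a m) / real n"
  proof eventually_elim
    case (elim n)
    have "(\<Sum>m<n. b m) / real n \<le> (\<Sum>m<n. a m) / real n"
      by (intro divide_right_mono sum_mono) (auto simp: b_def)
    with elim show ?case by simp
  qed
qed

text \<open>\<open>autocov_avg c n\<close> is \<open>n\<close> times the variance of the mean of \<open>n\<close> consecutive terms of a stationary
  sequence with autocovariances \<open>c\<close>; the truncated differences add up to \<open>\<bar>s - t\<bar>\<close>.\<close>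

definition autocov_avg :: "(nat \<Rightarrow> real) \<Rightarrow> nat \<Rightarrow> real" where
  "autocov_avg c n = (\<Sum>s<n. \<Sum>t<n. c ((s - t) + (t - s))) / real n"

text \<open>Passing from \<open>n\<close> to \<open>Suc n\<close> adds a row and a column with equal
  entries and one diagonal term. The scaled variance of a mean is thus governed by Cesaro means of
  the partial sums of \<open>c\<close>; the right side counts the diagonal twice, whence the extra
  \<open>real n * c 0\<close>.\<close>

lemma autocov_sum_eq:
  fixes c :: "nat \<Rightarrow> real"
  shows "(\<Sum>s<n. \<Sum>t<n. c ((s - t) + (t - s))) + real n * c 0 = 2 * (\<Sum>m<n. \<Sum>k<Suc m. c k)"
proof (induction n)
  case (Suc n)
  have r: "(\<Sum>t<n. c (n - t)) = (\<Sum>k<n. c (Suc k))"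
    by (subst sum.nat_diff_reindex[symmetric]) (auto intro!: sum.cong simp: Suc_diff_Suc)
  have l: "(\<Sum>k<Suc n. c k) = c 0 + (\<Sum>k<n. c (Suc k))" by (rule sum.lessThan_Suc_shift)
  have a: "(\<Sum>t<n. c ((n - t) + (t - n))) = (\<Sum>t<n. c (n - t))"
          "(\<Sum>t<n. c ((t - n) + (n - t))) = (\<Sum>t<n. c (n - t))"
    by (auto intro!: sum.cong)
  have "(\<Sum>s<Suc n. \<Sum>t<Suc n. c ((s - t) + (t - s))) =
      (\<Sum>s<n. \<Sum>t<n. c ((s - t) + (t - s))) + 2 * (\<Sum>k<n. c (Suc k)) + c 0"
    by (simp add: sum.distrib a r)
  then show ?case using Suc l by (simp add: algebra_simps)
qed simp

lemma autocov_avg_eq: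
  assumes "0 < n"
  shows "autocov_avg c n = 2 * ((\<Sum>m<n. \<Sum>k<Suc m. c k) / real n) - c 0"
  using autocov_sum_eq[of c n] assms unfolding autocov_avg_def by (simp add: field_simps)

text \<open>These properties of \<open>c k = <f, P^k f>\<close>, for a self-adjoint contraction
  \<open>P\<close>, stand in for a spectral measure on [-1, 1]: with \<open>g = P^k f\<close>, the
  term at lag \<open>2 * k\<close> is \<open><g, g>\<close> and the next one is
  \<open><g, P g>\<close>.\<close>

locale autocov =
  fixes c :: "nat \<Rightarrow> real"
  assumes even_nonneg: "\<And>k. 0 \<le> c (2 * k)"
    and even_decreasing: "\<And>k. c (2 * Suc k) \<le> c (2 * k)"
    and odd_le_even: "\<And>k. \<bar>c (2 * k + 1)\<bar> \<le> c (2 * k)"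
begin

text \<open>In spectral terms, the mass at 1 and -1 together. A periodic component such as
  \<open>c k = (-1)^k\<close> keeps it positive although \<open>autocov_avg c\<close> tends to 0, so
  it cannot be dropped from the limit formulas.\<close>

definition even_limit :: real where "even_limit = (SOME l. (\<lambda>k. c (2 * k)) \<longlonglongrightarrow> l)"

lemma even_decseq: "decseq (\<lambda>k. c (2 * k))"
  using even_decreasing by (intro decseq_SucI)

lemma even_tendsto: "(\<lambda>k. c (2 * k)) \<longlonglongrightarrow> even_limit"
proof -
  obtain l where "(\<lambda>k. c (2 * k)) \<longlonglongrightarrow> l"
    using decseq_convergent[OF even_decseq, of 0] even_nonneg by metis
  then show ?thesis unfolding even_limit_def by (rule someI)
qed

lemma even_limit_le: "even_limit \<le> c (2 * k)"
  by (rule decseq_ge[OF even_decseq even_tendsto])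

lemma even_limit_nonneg: "0 \<le> even_limit"
  by (rule LIMSEQ_le_const[OF even_tendsto]) (use even_nonneg in auto)

lemma abs_le_0: "\<bar>c k\<bar> \<le> c 0"
proof (cases "even k")
  case True
  then show ?thesis using even_nonneg[of "k div 2"] decseqD[OF even_decseq, of 0 "k div 2"] by simp
next
  case False
  then have "k = 2 * (k div 2) + 1" by simp
  then have "\<bar>c k\<bar> \<le> c (2 * (k div 2))" using odd_le_even[of "k div 2"] by metis
  also have "\<dots> \<le> c 0" using decseqD[OF even_decseq, of 0 "k div 2"] by simp
  finally show ?thesis .
qed

lemma even_partial_sum: "(\<Sum>k<2 * j. c k) = (\<Sum>i<j. c (2 * i) + c (2 * i + 1))"
  by (induction j) simp_all

text \<open>Each added pair is nonnegative. Hence these sums either converge or are unbounded, even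
  where the sequence of all partial sums oscillates.\<close>

lemma even_partial_sum_incseq: "incseq (\<lambda>j. \<Sum>k<2 * j. c k)"
  unfolding even_partial_sum 
proof (rule incseq_SucI)
  fix j show "(\<Sum>i<j. c (2 * i) + c (2 * i + 1)) \<le> (\<Sum>i<Suc j. c (2 * i) + c (2 * i + 1))"
    using odd_le_even[of j] by simp
qed

lemma partial_sum_eq:
  "(\<Sum>k<Suc m. c k) = (\<Sum>k<2 * (Suc m div 2). c k) + (if even m then c m else 0)"
proof (cases "even m")
  case True
  then have "2 * (Suc m div 2) = m" by auto
  with True show ?thesis by simp
next
  case False
  then have "2 * (Suc m div 2) = Suc m" by auto
  with False show ?thesis by simp
qed

lemma filterlim_half: "filterlim (\<lambda>m::nat. Suc m div 2) sequentially sequentially"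
  unfolding filterlim_at_top
proof
  fix Z :: nat
  show "\<forall>\<^sub>F m in sequentially. Z \<le> Suc m div 2"
    using eventually_ge_at_top[of "2 * Z"] by eventually_elim simp
qed

text \<open>Of two neighbouring indices exactly one is even, so summing
  \<open>e m + e (Suc m)\<close> counts every even-index term twice, up to boundary terms that are
  bounded and vanish after division by \<open>n\<close>.\<close>

lemma cesaro_even_terms: "(\<lambda>n. (\<Sum>m<n. if even m then c m else 0) / real n) \<longlonglongrightarrow> even_limit / 2"
proof -
  define e where "e m = (if even m then c m else 0)" for m
  have e2: "e m + e (Suc m) = c (2 * (Suc m div 2))" for m
    by (cases "even m") (auto simp: e_def)
  have sum2: "2 * (\<Sum>m<n. e m) = (\<Sum>m<n. c (2 * (Suc m div 2))) + (e 0 - e n)" for n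
    unfolding e2[symmetric] by (induction n) simp_all
  have "(\<lambda>m. c (2 * (Suc m div 2))) \<longlonglongrightarrow> even_limit"
    by (rule filterlim_compose[OF even_tendsto filterlim_half])
  then have 1: "(\<lambda>n. (\<Sum>m<n. c (2 * (Suc m div 2))) / real n) \<longlonglongrightarrow> even_limit" by (rule cesaro)
  have "\<bar>e 0 - e n\<bar> \<le> 2 * c 0" for n
    using abs_le_0[of n] abs_le_0[of 0] by (auto simp: e_def)
  then have "\<bar>(e 0 - e n) / real n\<bar> \<le> 2 * c 0 / real n" for n
    by (simp add: divide_right_mono)
  moreover have "(\<lambda>n. 2 * c 0 / real n) \<longlonglongrightarrow> 0"
    by (rule lim_const_over_n)
  ultimately have 2: "(\<lambda>n. (e 0 - e n) / real n) \<longlonglongrightarrow> 0"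
    by - (rule Lim_null_comparison[of _ "\<lambda>n. 2 * c 0 / real n", rotated], simp_all)
  have "(\<lambda>n. ((\<Sum>m<n. c (2 * (Suc m div 2))) / real n + (e 0 - e n) / real n) / 2) \<longlonglongrightarrow> (even_limit + 0) / 2"
    by (intro tendsto_intros 1 2) simp
  moreover have "((\<Sum>m<n. c (2 * (Suc m div 2))) / real n + (e 0 - e n) / real n) / 2 = (\<Sum>m<n. e m) / real n" for n
    using arg_cong[OF sum2[of n], of "\<lambda>t. t / real n / 2"] by (simp add: add_divide_distrib)
  ultimately show ?thesis unfolding e_def by simp
qed

lemma autocov_avg_eq':
  assumes "0 < n"
  shows "autocov_avg c n = 2 * ((\<Sum>m<n. \<Sum>k<2 * (Suc m div 2). c k) / real n
    + (\<Sum>m<n. if even m then c m else 0) / real n) - c 0"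
  unfolding autocov_avg_eq[OF assms] partial_sum_eq sum.distrib add_divide_distrib ..

text \<open>A partial sum that ends at an even index carries one unpaired term. These leftovers
  average to \<open>even_limit / 2\<close>, which the factor 2 in the variance formula turns into
  \<open>even_limit\<close>.\<close>

lemma autocov_avg_tendsto:
  assumes "(\<lambda>j. \<Sum>k<2 * j. c k) \<longlonglongrightarrow> s"
  shows "autocov_avg c \<longlonglongrightarrow> 2 * s + even_limit - c 0"
proof -
  have "(\<lambda>m. \<Sum>k<2 * (Suc m div 2). c k) \<longlonglongrightarrow> s"
    by (rule filterlim_compose[OF assms filterlim_half])
  from cesaro[OF this]
  have "(\<lambda>n. 2 * ((\<Sum>m<n. \<Sum>k<2 * (Suc m div 2). c k) / real n
    + (\<Sum>m<n. if even m then c m else 0) / real n) - c 0) \<longlonglongrightarrow> 2 * (s + even_limit / 2) - c 0"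
    by (intro tendsto_intros cesaro_even_terms)
  then have "autocov_avg c \<longlonglongrightarrow> 2 * (s + even_limit / 2) - c 0"
    by (rule Lim_transform_eventually)
       (use eventually_gt_at_top[of 0] in \<open>eventually_elim, simp only: autocov_avg_eq'\<close>)
  then show ?thesis by (simp add: algebra_simps)
qed

lemma autocov_avg_at_top:
  assumes "filterlim (\<lambda>j. \<Sum>k<2 * j. c k) at_top sequentially"
  shows "filterlim (autocov_avg c) at_top sequentially"
proof -
  have lim: "filterlim (\<lambda>m. \<Sum>k<2 * (Suc m div 2). c k) at_top sequentially"
    by (rule filterlim_compose[OF assms filterlim_half])
  have nonneg: "0 \<le> (\<Sum>k<2 * (Suc m div 2). c k)" for m
    using incseqD[OF even_partial_sum_incseq, of 0 "Suc m div 2"] by simp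
  have "filterlim (\<lambda>n. (- c 0) + 2 * ((\<Sum>m<n. if even m then c m else 0) / real n + (\<Sum>m<n. \<Sum>k<2 * (Suc m div 2). c k) / real n)) at_top sequentially"
    by (intro filterlim_tendsto_add_at_top[OF tendsto_const]
          filterlim_tendsto_pos_mult_at_top[OF tendsto_const] zero_less_numeral
          filterlim_tendsto_add_at_top[OF cesaro_even_terms] cesaro_at_top lim nonneg)
  then show ?thesis
    by (rule filterlim_mono_eventually[OF _ order_refl order_refl])
       (use eventually_gt_at_top[of 0] in \<open>eventually_elim, simp add: autocov_avg_eq'\<close>)
qed

lemma autocov_avg_cases:
  obtains (finite) s where "(\<lambda>j. \<Sum>k<2 * j. c k) \<longlonglongrightarrow> s" "autocov_avg c \<longlonglongrightarrow> 2 * s + even_limit - c 0"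
  | (infinite) "filterlim (autocov_avg c) at_top sequentially" "\<And>B. \<exists>j. B < (\<Sum>k<2 * j. c k)"
proof (cases "\<exists>B. \<forall>j. (\<Sum>k<2 * j. c k) \<le> B")
  case True
  then obtain B where "\<And>j. (\<Sum>k<2 * j. c k) \<le> B" by auto
  then obtain s where "(\<lambda>j. \<Sum>k<2 * j. c k) \<longlonglongrightarrow> s"
    using incseq_convergent[OF even_partial_sum_incseq, of B] by blast
  then show ?thesis using finite autocov_avg_tendsto by blast
next
  case False
  then have ex: "\<exists>j. B < (\<Sum>k<2 * j. c k)" for B by (meson not_le)
  have "filterlim (\<lambda>j. \<Sum>k<2 * j. c k) at_top sequentially"
    unfolding filterlim_at_top
  proof
    fix Z
    obtain j where "Z < (\<Sum>k<2 * j. c k)" using ex by auto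
    then show "\<forall>\<^sub>F j in sequentially. Z \<le> (\<Sum>k<2 * j. c k)"
      using incseqD[OF even_partial_sum_incseq, of j]
      by (intro eventually_sequentiallyI[of j]) (meson less_le_trans less_imp_le)
  qed
  then show ?thesis using infinite autocov_avg_at_top ex by blast
qed

section \<open>Abel sums of an autocovariance sequence\<close>

lemma abel_summable:
  assumes "0 \<le> r" "r < 1"
  shows "summable (\<lambda>k. r ^ k * c k)"
proof (rule summable_comparison_test'[of "\<lambda>k. r ^ k * c 0" 0])
  show "summable (\<lambda>k. r ^ k * c 0)" using assms by (intro summable_mult2 summable_geometric) simp
  show "norm (r ^ k * c k) \<le> r ^ k * c 0" for k
    using assms abs_le_0[of k] by (simp add: abs_mult mult_left_mono)
qed

text \<open>With \<open>a = c (2 * i)\<close> and \<open>b = c (2 * i + 1)\<close>, the pair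
  \<open>a + r * b\<close> equals \<open>r * (a + b) + (1 - r) * a\<close>, and \<open>a\<close> is
  at least \<open>even_limit\<close>. The geometric series in \<open>r^2\<close> then gives
  \<open>(1 - r) / (1 - r^2) = 1 / (1 + r)\<close>.\<close>

lemma abel_sum_lower_bound:
  assumes r: "0 < r" "r < 1"
  shows "(\<Sum>i<j. r ^ (2 * i + 1) * (c (2 * i) + c (2 * i + 1))) + even_limit / (1 + r) \<le> (\<Sum>k. r ^ k * c k)"
proof -
  let ?R = "\<Sum>k. r ^ k * c k"
  have lim: "(\<lambda>n. \<Sum>k<2 * n. r ^ k * c k) \<longlonglongrightarrow> ?R"
    using LIMSEQ_subseq_LIMSEQ[OF summable_LIMSEQ[OF abel_summable, of r], of "\<lambda>n. 2 * n"] r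
    by (simp add: strict_mono_def comp_def)
  have pair: "r * (c (2 * i) + c (2 * i + 1)) + (1 - r) * even_limit \<le> c (2 * i) + r * c (2 * i + 1)" for i
  proof -
    have "(1 - r) * even_limit \<le> (1 - r) * c (2 * i)" using r even_limit_le[of i] by (intro mult_left_mono) auto
    then show ?thesis by (simp add: algebra_simps)
  qed
  have even: "(\<Sum>k<2 * n. r ^ k * c k) = (\<Sum>i<n. (r\<^sup>2) ^ i * (c (2 * i) + r * c (2 * i + 1)))" for n
    by (induction n) (simp_all add: power_mult[symmetric] algebra_simps)
  have nn: "0 \<le> c (2 * i) + c (2 * i + 1)" for i using odd_le_even[of i] by linarith
  have lower: "(\<Sum>i<j. r ^ (2 * i + 1) * (c (2 * i) + c (2 * i + 1))) + (1 - r) * even_limit * (\<Sum>i<n. (r\<^sup>2) ^ i)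
      \<le> (\<Sum>k<2 * n. r ^ k * c k)" if "j \<le> n" for n
  proof -
    have "(\<Sum>i<j. r ^ (2 * i + 1) * (c (2 * i) + c (2 * i + 1))) \<le>
        (\<Sum>i<n. r ^ (2 * i + 1) * (c (2 * i) + c (2 * i + 1)))"
      using that r nn by (intro sum_mono2) auto
    moreover have "(\<Sum>i<n. r ^ (2 * i + 1) * (c (2 * i) + c (2 * i + 1))) + (1 - r) * even_limit * (\<Sum>i<n. (r\<^sup>2) ^ i)
        = (\<Sum>i<n. (r\<^sup>2) ^ i * (r * (c (2 * i) + c (2 * i + 1)) + (1 - r) * even_limit))"
      unfolding sum_distrib_left sum.distrib[symmetric]
      by (intro sum.cong refl) (simp add: power_mult[symmetric] algebra_simps)
    moreover have "\<dots> \<le> (\<Sum>i<n. (r\<^sup>2) ^ i * (c (2 * i) + r * c (2 * i + 1)))"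
      by (intro sum_mono mult_left_mono pair) simp
    ultimately show ?thesis unfolding even by linarith
  qed
  have r2: "norm (r\<^sup>2) < 1" using r by (simp add: power_less_one_iff)
  have "(\<lambda>n. (\<Sum>i<j. r ^ (2 * i + 1) * (c (2 * i) + c (2 * i + 1))) + (1 - r) * even_limit * (\<Sum>i<n. (r\<^sup>2) ^ i))
      \<longlonglongrightarrow> (\<Sum>i<j. r ^ (2 * i + 1) * (c (2 * i) + c (2 * i + 1))) + (1 - r) * even_limit * (1 / (1 - r\<^sup>2))"
    using geometric_sums[OF r2] unfolding sums_def by (intro tendsto_intros)
  then have "(\<Sum>i<j. r ^ (2 * i + 1) * (c (2 * i) + c (2 * i + 1))) + (1 - r) * even_limit * (1 / (1 - r\<^sup>2)) \<le> ?R"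
    by (rule tendsto_le[OF sequentially_bot lim])
       (rule eventually_mono[OF eventually_ge_at_top[of j] lower])
  moreover have "(1 - r) * even_limit * (1 / (1 - r\<^sup>2)) = even_limit / (1 + r)"
  proof -
    have "1 - r\<^sup>2 = (1 - r) * (1 + r)" by (simp add: power2_eq_square algebra_simps)
    then show ?thesis using r by simp
  qed
  ultimately show ?thesis by simp
qed

text \<open>As \<open>r\<close> tends to 1, the factor \<open>1 / (1 + r)\<close> tends to
  \<open>1 / 2\<close>. The left side is then exactly the combination whose double appears in the
  limit of \<open>autocov_avg\<close>, so a bound on the Abel sums bounds the variance without loss.
  Monotonicity replaces a Tauberian argument.\<close>

lemma even_partial_sum_le:
  assumes B: "\<And>r. 0 < r \<Longrightarrow> r < 1 \<Longrightarrow> (\<Sum>k. r ^ k * c k) \<le> B"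
  shows "(\<Sum>k<2 * j. c k) + even_limit / 2 \<le> B"
proof -
  have "((\<lambda>r. (\<Sum>i<j. r ^ (2 * i + 1) * (c (2 * i) + c (2 * i + 1))) + even_limit / (1 + r)) \<longlongrightarrow>
     (\<Sum>i<j. 1 ^ (2 * i + 1) * (c (2 * i) + c (2 * i + 1))) + even_limit / (1 + 1)) (at_left (1::real))"
    by (intro tendsto_intros) simp
  then have "(\<Sum>i<j. 1 ^ (2 * i + 1) * (c (2 * i) + c (2 * i + 1))) + even_limit / (1 + 1) \<le> B"
  proof (rule tendsto_upperbound)
    have "\<forall>\<^sub>F r::real in at_left 1. r \<in> {0<..<1}" by (rule eventually_at_left_real) simp
    then show "\<forall>\<^sub>F r in at_left 1. (\<Sum>i<j. r ^ (2 * i + 1) * (c (2 * i) + c (2 * i + 1))) + even_limit / (1 + r) \<le> B"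
      by eventually_elim (use abel_sum_lower_bound B in \<open>fastforce intro: order_trans\<close>)
  qed simp
  then show ?thesis by (simp add: even_partial_sum)
qed

lemma lim_autocov_avg_eqI:
  assumes "autocov_avg c \<longlonglongrightarrow> l"
  shows "lim (\<lambda>n. ereal (autocov_avg c n)) = ereal l"
  using assms by (intro limI) simp

end

text \<open>Nonnegativity of \<open>d\<close> makes its Abel sums at most its full sum
  \<open>s\<close>, gives \<open>d 0 \<le> s\<close>, and forces the even-index limit of
  \<open>d\<close> to be 0 when its even partial sums converge. The signs of \<open>c\<close> are
  not controlled, so \<open>c\<close> is handled through its pairwise bound.\<close>

lemma lim_autocov_avg_le:
  assumes "autocov c" "autocov d" and nonneg: "\<And>k. 0 \<le> d k" and eq: "c 0 = d 0" and C: "1 \<le> C"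
    and abel: "\<And>r. 0 < r \<Longrightarrow> r < 1 \<Longrightarrow> (\<Sum>k. r ^ k * c k) \<le> C * (\<Sum>k. r ^ k * d k)"
  shows "lim (\<lambda>n. ereal (autocov_avg c n)) \<le> ereal (2 * C - 1) * lim (\<lambda>n. ereal (autocov_avg d n))"
proof -
  interpret c: autocov c by fact
  interpret d: autocov d by fact
  show ?thesis
  proof (cases rule: d.autocov_avg_cases)
    case infinite
    have "lim (\<lambda>n. ereal (autocov_avg d n)) = \<infinity>"
      by (intro limI) (use infinite(1) in \<open>simp add: tendsto_PInfty_eq_at_top\<close>)
    \<comment> \<open>The factor must be strictly positive, as \<open>0 * \<infinity> = 0\<close> in
      the extended reals.\<close>
    moreover have "0 < ereal (2 * C - 1)" using C by simp
    ultimately show ?thesis by (simp add: ereal_mult_eq_PInfty)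
  next
    case (finite s)
    have even_le: "(\<Sum>k<2 * j. d k) \<le> s" for j
      using incseq_le[OF d.even_partial_sum_incseq finite(1)] .
    have part_le: "(\<Sum>k<n. d k) \<le> s" for n
      using sum_mono2[of "{..<2 * n}" "{..<n}" d] nonneg even_le[of n] by force
    have summ: "summable d"
      by (rule summableI_nonneg_bounded[OF nonneg part_le])
    have s: "suminf d = s"
      using LIMSEQ_subseq_LIMSEQ[OF summable_LIMSEQ[OF summ], of "\<lambda>j. 2 * j"]
      by (intro LIMSEQ_unique[OF _ finite(1)]) (simp add: strict_mono_def comp_def)
    have "(\<lambda>k. d (2 * k)) \<longlonglongrightarrow> 0"
      using LIMSEQ_subseq_LIMSEQ[OF summable_LIMSEQ_zero[OF summ], of "\<lambda>j. 2 * j"]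
      by (simp add: strict_mono_def comp_def)
    then have d0: "d.even_limit = 0" using d.even_tendsto LIMSEQ_unique by blast
    have "d 0 \<le> s" using part_le[of 1] by simp
    have abel_d: "(\<Sum>k. r ^ k * d k) \<le> s" if "0 < r" "r < 1" for r
      unfolding s[symmetric]
      by (rule suminf_le[OF _ d.abel_summable summ])
         (use that nonneg in \<open>auto intro!: mult_left_le_one_le power_le_one\<close>)
    have "(\<Sum>k. r ^ k * c k) \<le> C * s" if "0 < r" "r < 1" for r
      using abel[OF that] mult_left_mono[OF abel_d[OF that], of C] C by linarith
    then have cle: "(\<Sum>k<2 * j. c k) + c.even_limit / 2 \<le> C * s" for j
      by (rule c.even_partial_sum_le)
    show ?thesis
    proof (cases rule: c.autocov_avg_cases)
      case infinite
      obtain j where "C * s < (\<Sum>k<2 * j. c k)" using infinite(2) by blast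
      then show ?thesis using cle[of j] c.even_limit_nonneg by linarith
    next
      case (finite t)
      have "t + c.even_limit / 2 \<le> C * s"
        by (rule LIMSEQ_le_const2[of "\<lambda>j. (\<Sum>k<2 * j. c k) + c.even_limit / 2"])
           (use finite(1) cle in \<open>auto intro!: tendsto_intros\<close>)
      then have "2 * t + c.even_limit - c 0 \<le> 2 * C * s - d 0" using eq by simp
      \<comment> \<open>The right side exceeds the left by \<open>2 * (C - 1) * (s - d 0)\<close>.
        This is where \<open>d 0\<close>, the squared norm of the function, is absorbed into the
        variance.\<close>
      also have "\<dots> \<le> (2 * C - 1) * (2 * s - d 0)"
      proof -
        have "0 \<le> (C - 1) * (s - d 0)" using C \<open>d 0 \<le> s\<close> by simp
        then show ?thesis by (simp add: algebra_simps)
      qed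
      finally show ?thesis
        using c.lim_autocov_avg_eqI[OF finite(2)] d.lim_autocov_avg_eqI[OF \<open>autocov_avg d \<longlonglongrightarrow> _\<close>] d0
        by simp
    qed
  qed
qed

section \<open>Reversible Markov chains\<close>

lemma L2_measurable[measurable_dest]: "f \<in> L2 \<mu> \<Longrightarrow> f \<in> borel_measurable \<mu>"
  by (simp add: L2_def)

lemma L2_integrable_square: "f \<in> L2 \<mu> \<Longrightarrow> integrable \<mu> (\<lambda>x. (f x)\<^sup>2)"
  by (simp add: L2_def)

lemma integrable_mult_of_squares:
  fixes f g :: "'x \<Rightarrow> real"
  assumes [measurable]: "f \<in> borel_measurable N" "g \<in> borel_measurable N"
    and "integrable N (\<lambda>x. (f x)\<^sup>2)" "integrable N (\<lambda>x. (g x)\<^sup>2)"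
  shows "integrable N (\<lambda>x. f x * g x)"
proof (rule Bochner_Integration.integrable_bound)
  show "integrable N (\<lambda>x. (f x)\<^sup>2 + (g x)\<^sup>2)" using assms by simp
  have "\<bar>a * b\<bar> \<le> a\<^sup>2 + b\<^sup>2" for a b :: real
  proof -
    have "0 \<le> (\<bar>a\<bar> - \<bar>b\<bar>)\<^sup>2" "0 \<le> \<bar>a\<bar> * \<bar>b\<bar>" by simp_all
    then have "2 * (\<bar>a\<bar> * \<bar>b\<bar>) \<le> a\<^sup>2 + b\<^sup>2" by (simp add: power2_diff)
    then show ?thesis using \<open>0 \<le> \<bar>a\<bar> * \<bar>b\<bar>\<close> unfolding abs_mult by linarith
  qed
  then show "AE x in N. norm (f x * g x) \<le> norm ((f x)\<^sup>2 + (g x)\<^sup>2)" by simp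
qed simp

lemma L2_integrable_mult: "f \<in> L2 \<mu> \<Longrightarrow> g \<in> L2 \<mu> \<Longrightarrow> integrable \<mu> (\<lambda>x. f x * g x)"
  by (rule integrable_mult_of_squares) (simp_all add: L2_def)

lemma L2_cmult: "f \<in> L2 \<mu> \<Longrightarrow> (\<lambda>x. a * f x) \<in> L2 \<mu>"
  by (auto simp: L2_def power_mult_distrib)

lemma L2_add: "f \<in> L2 \<mu> \<Longrightarrow> g \<in> L2 \<mu> \<Longrightarrow> (\<lambda>x. f x + g x) \<in> L2 \<mu>"
  using L2_integrable_mult[of f \<mu> g] by (auto simp: L2_def power2_sum mult.assoc)

lemma L2_diff: "f \<in> L2 \<mu> \<Longrightarrow> g \<in> L2 \<mu> \<Longrightarrow> (\<lambda>x. f x - g x) \<in> L2 \<mu>"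
  using L2_add[of f \<mu> "\<lambda>x. (- 1) * g x"] L2_cmult[of g \<mu> "- 1"] by simp

lemma L2_sum: "(\<And>i. i \<in> I \<Longrightarrow> f i \<in> L2 \<mu>) \<Longrightarrow> (\<lambda>x. \<Sum>i\<in>I. f i x) \<in> L2 \<mu>"
proof (induction I rule: infinite_finite_induct)
  case (insert i I)
  then show ?case by (simp add: L2_add)
qed (simp_all add: L2_def)

lemma (in prob_space) L2_const: "(\<lambda>x. a) \<in> L2 M"
  by (simp add: L2_def)

lemma (in prob_space) L2_integrable: "f \<in> L2 M \<Longrightarrow> integrable M f"
  using L2_integrable_mult[OF _ L2_const, of f 1] by simp

text \<open>The measure \<open>N(dx) K(x, dy)\<close>, over a base \<open>N\<close> that may be
  infinite. It serves both as the law of two successive states and, over \<open>\<Theta>\<close>, as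
  the measure that \<open>extended_target\<close> weights; the body repeats the expression found
  there.\<close>

definition kernel_pair :: "'x measure \<Rightarrow> ('x \<Rightarrow> 's measure) \<Rightarrow> 's measure \<Rightarrow> ('x \<times> 's) measure" where
  "kernel_pair N K S = N \<bind> (\<lambda>x. distr (K x) (N \<Otimes>\<^sub>M S) (\<lambda>y. (x, y)))"

locale markov_kernel =
  fixes N :: "'x measure" and K :: "'x \<Rightarrow> 's measure" and S :: "'s measure"
  assumes K[measurable]: "K \<in> N \<rightarrow>\<^sub>M prob_algebra S"
    and space_N: "space N \<noteq> {}"
begin

lemma K_subprob[measurable]: "K \<in> N \<rightarrow>\<^sub>M subprob_algebra S"
  by (rule measurable_prob_algebraD[OF K])

lemma prob_space_K: "x \<in> space N \<Longrightarrow> prob_space (K x)"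
  and sets_K: "x \<in> space N \<Longrightarrow> sets (K x) = sets S"
  using measurable_space[OF K, of x] by (auto simp: space_prob_algebra)

lemma measurable_pair_kernel: "(\<lambda>x. distr (K x) (N \<Otimes>\<^sub>M S) (\<lambda>y. (x, y))) \<in> N \<rightarrow>\<^sub>M prob_algebra (N \<Otimes>\<^sub>M S)"
  by (rule measurable_distr_prob_space2[OF K]) (simp add: case_prod_beta')

lemma sets_kernel_pair[simp, measurable_cong]: "sets (kernel_pair N K S) = sets (N \<Otimes>\<^sub>M S)"
  unfolding kernel_pair_def by (rule sets_bind) (simp_all add: space_N)

lemma space_kernel_pair: "space (kernel_pair N K S) = space (N \<Otimes>\<^sub>M S)"
  by (rule sets_eq_imp_space_eq) simp

lemma measurable_Pair_K: "x \<in> space N \<Longrightarrow> Pair x \<in> K x \<rightarrow>\<^sub>M N \<Otimes>\<^sub>M S"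
  using measurable_cong_sets[OF sets_K refl, of x] by simp

lemma nn_integral_kernel_pair:
  assumes [measurable]: "F \<in> borel_measurable (N \<Otimes>\<^sub>M S)"
  shows "(\<integral>\<^sup>+z. F z \<partial>kernel_pair N K S) = (\<integral>\<^sup>+x. \<integral>\<^sup>+y. F (x, y) \<partial>K x \<partial>N)"
  unfolding kernel_pair_def
  by (subst nn_integral_bind[OF assms measurable_prob_algebraD[OF measurable_pair_kernel]],
      intro nn_integral_cong nn_integral_distr measurable_Pair_K) simp_all

lemma measurable_integral_kernel:
  fixes h :: "'x \<times> 's \<Rightarrow> real"
  assumes [measurable]: "h \<in> borel_measurable (N \<Otimes>\<^sub>M S)"
  shows "(\<lambda>x. \<integral>y. h (x, y) \<partial>K x) \<in> borel_measurable N"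
proof -
  have "(\<lambda>x. \<integral>z. h z \<partial>distr (K x) (N \<Otimes>\<^sub>M S) (Pair x)) \<in> borel_measurable N"
    by (rule measurable_compose[OF measurable_prob_algebraD[OF measurable_pair_kernel] integral_measurable_subprob_algebra]) simp
  then show ?thesis
    by (rule measurable_cong[THEN iffD1, rotated]) (simp add: integral_distr measurable_Pair_K)
qed

lemma integral_kernel_pair:
  fixes h :: "'x \<times> 's \<Rightarrow> real"
  assumes h: "integrable (kernel_pair N K S) h"
  shows "(\<integral>z. h z \<partial>kernel_pair N K S) = (\<integral>x. \<integral>y. h (x, y) \<partial>K x \<partial>N)"
proof -
  have [measurable]: "h \<in> borel_measurable (N \<Otimes>\<^sub>M S)"
    using borel_measurable_integrable[OF h] by simp
  define p where "p x = (\<integral>\<^sup>+y. ennreal (h (x, y)) \<partial>K x)" for x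
  define m where "m x = (\<integral>\<^sup>+y. ennreal (- h (x, y)) \<partial>K x)" for x
  have [measurable]: "p \<in> borel_measurable N" "m \<in> borel_measurable N"
    unfolding p_def m_def
    by (rule nn_integral_measurable_subprob_algebra2[OF _ K_subprob]; simp add: case_prod_beta')+
  have P: "(\<integral>\<^sup>+z. ennreal (h z) \<partial>kernel_pair N K S) = (\<integral>\<^sup>+x. p x \<partial>N)"
    and M: "(\<integral>\<^sup>+z. ennreal (- h z) \<partial>kernel_pair N K S) = (\<integral>\<^sup>+x. m x \<partial>N)"
    by (simp_all add: nn_integral_kernel_pair p_def m_def)
  have Pfin: "(\<integral>\<^sup>+x. p x \<partial>N) \<noteq> \<infinity>" and Mfin: "(\<integral>\<^sup>+x. m x \<partial>N) \<noteq> \<infinity>"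
    using h unfolding real_integrable_def P M by auto
  have Pae: "AE x in N. p x \<noteq> \<infinity>" and Mae: "AE x in N. m x \<noteq> \<infinity>"
    using nn_integral_PInf_AE[OF _ Pfin] nn_integral_PInf_AE[OF _ Mfin] by simp_all
  \<comment> \<open>Where \<open>p x\<close> or \<open>m x\<close> is infinite, the inner integral
    is 0 by default and \<open>enn2real\<close> sends infinity to 0. The identity may fail there,
    but integrability of \<open>h\<close> makes this set null.\<close>
  have ae: "AE x in N. (\<integral>y. h (x, y) \<partial>K x) = enn2real (p x) - enn2real (m x)"
    using Pae Mae AE_space
  proof eventually_elim
    case (elim x)
    have "(\<lambda>y. h (x, y)) \<in> borel_measurable (K x)"
      using measurable_compose[OF measurable_Pair_K] elim(3) by simp
    then have "integrable (K x) (\<lambda>y. h (x, y))"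
      using elim unfolding real_integrable_def p_def m_def by simp
    then show ?case unfolding p_def m_def by (rule real_lebesgue_integral_def)
  qed
  have [measurable]: "(\<lambda>x. \<integral>y. h (x, y) \<partial>K x) \<in> borel_measurable N"
    by (rule measurable_integral_kernel) simp
  have pn: "(\<integral>\<^sup>+x. ennreal (enn2real (p x)) \<partial>N) = (\<integral>\<^sup>+x. p x \<partial>N)"
    by (rule nn_integral_cong_AE) (use Pae in \<open>auto elim!: eventually_mono simp: less_top\<close>)
  have mn: "(\<integral>\<^sup>+x. ennreal (enn2real (m x)) \<partial>N) = (\<integral>\<^sup>+x. m x \<partial>N)"
    by (rule nn_integral_cong_AE) (use Mae in \<open>auto elim!: eventually_mono simp: less_top\<close>)
  have ip: "integrable N (\<lambda>x. enn2real (p x))" and im: "integrable N (\<lambda>x. enn2real (m x))"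
    using Pfin Mfin pn mn by (auto intro!: integrableI_nonneg simp: less_top)
  have "(\<integral>z. h z \<partial>kernel_pair N K S) = enn2real (\<integral>\<^sup>+x. p x \<partial>N) - enn2real (\<integral>\<^sup>+x. m x \<partial>N)"
    using real_lebesgue_integral_def[OF h] by (simp add: P M)
  also have "\<dots> = (\<integral>x. enn2real (p x) \<partial>N) - (\<integral>x. enn2real (m x) \<partial>N)"
    by (simp add: integral_eq_nn_integral pn mn)
  also have "\<dots> = (\<integral>x. enn2real (p x) - enn2real (m x) \<partial>N)"
    using ip im by simp
  also have "\<dots> = (\<integral>x. \<integral>y. h (x, y) \<partial>K x \<partial>N)"
    by (rule integral_cong_AE[symmetric]) (use ae in simp_all)
  finally show ?thesis .
qed

end

section \<open>The operator of a reversible chain on square-integrable functions\<close>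

locale reversible_chain = prob_space \<mu> for \<mu> :: "'s measure" +
  fixes H :: "'s \<Rightarrow> 's measure"
  assumes H[measurable]: "H \<in> \<mu> \<rightarrow>\<^sub>M prob_algebra \<mu>"
    and detailed_balance: "\<And>F. F \<in> borel_measurable (\<mu> \<Otimes>\<^sub>M \<mu>) \<Longrightarrow>
      (\<integral>\<^sup>+x. \<integral>\<^sup>+y. F (x, y) \<partial>H x \<partial>\<mu>) = (\<integral>\<^sup>+x. \<integral>\<^sup>+y. F (y, x) \<partial>H x \<partial>\<mu>)"

sublocale reversible_chain \<subseteq> markov_kernel \<mu> H \<mu>
  by unfold_locales (simp_all add: not_empty)

context reversible_chain
begin

abbreviation joint :: "('s \<times> 's) measure" where "joint \<equiv> kernel_pair \<mu> H \<mu>"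

definition inner_prod :: "('s \<Rightarrow> real) \<Rightarrow> ('s \<Rightarrow> real) \<Rightarrow> real" where
  "inner_prod g h = (\<integral>x. g x * h x \<partial>\<mu>)"

definition step :: "('s \<Rightarrow> real) \<Rightarrow> 's \<Rightarrow> real" where
  "step g x = (\<integral>y. g y \<partial>H x)"

text \<open>Detailed balance read as symmetry of the law of two successive stationary states;
  integrated against a product of two functions it gives the self-adjointness of
  \<open>step\<close>.\<close>

lemma joint_swap: "distr joint (\<mu> \<Otimes>\<^sub>M \<mu>) (\<lambda>(x, y). (y, x)) = joint"
proof (rule measure_eqI)
  fix A assume "A \<in> sets (distr joint (\<mu> \<Otimes>\<^sub>M \<mu>) (\<lambda>(x, y). (y, x)))"
  then have [measurable]: "A \<in> sets (\<mu> \<Otimes>\<^sub>M \<mu>)" by simp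
  have "emeasure (distr joint (\<mu> \<Otimes>\<^sub>M \<mu>) (\<lambda>(x, y). (y, x))) A = (\<integral>\<^sup>+z. indicator A z \<partial>distr joint (\<mu> \<Otimes>\<^sub>M \<mu>) (\<lambda>(x, y). (y, x)))"
    by simp
  also have "\<dots> = (\<integral>\<^sup>+z. indicator A (snd z, fst z) \<partial>joint)"
    by (subst nn_integral_distr) (simp_all add: case_prod_beta')
  also have "\<dots> = (\<integral>\<^sup>+z. indicator A z \<partial>joint)"
    using detailed_balance[of "indicator A"] by (simp add: nn_integral_kernel_pair del: nn_integral_indicator)
  finally show "emeasure (distr joint (\<mu> \<Otimes>\<^sub>M \<mu>) (\<lambda>(x, y). (y, x))) A = emeasure joint A" by simp
qed simp

lemma integral_joint_swap:
  fixes F :: "'s \<times> 's \<Rightarrow> real"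
  assumes [measurable]: "F \<in> borel_measurable (\<mu> \<Otimes>\<^sub>M \<mu>)"
  shows "(\<integral>z. F (snd z, fst z) \<partial>joint) = (\<integral>z. F z \<partial>joint)"
  by (subst joint_swap[symmetric], subst integral_distr) (simp_all add: case_prod_beta')

lemma nn_integral_joint_fst:
  assumes [measurable]: "g \<in> borel_measurable \<mu>"
  shows "(\<integral>\<^sup>+z. g (fst z) \<partial>joint) = (\<integral>\<^sup>+x. g x \<partial>\<mu>)"
  by (simp add: nn_integral_kernel_pair prob_space.emeasure_space_1[OF prob_space_K] cong: nn_integral_cong)

lemma nn_integral_stationary:
  assumes [measurable]: "g \<in> borel_measurable \<mu>"
  shows "(\<integral>\<^sup>+x. \<integral>\<^sup>+y. g y \<partial>H x \<partial>\<mu>) = (\<integral>\<^sup>+x. g x \<partial>\<mu>)"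
  using detailed_balance[of "\<lambda>z. g (snd z)"]
  by (simp add: prob_space.emeasure_space_1[OF prob_space_K] cong: nn_integral_cong)

lemma nn_integral_joint_snd:
  assumes [measurable]: "g \<in> borel_measurable \<mu>"
  shows "(\<integral>\<^sup>+z. g (snd z) \<partial>joint) = (\<integral>\<^sup>+x. g x \<partial>\<mu>)"
  by (simp add: nn_integral_kernel_pair nn_integral_stationary)

lemma distr_joint: "distr joint \<mu> fst = \<mu>" "distr joint \<mu> snd = \<mu>"
  by (auto intro!: measure_eqI simp: nn_integral_distr nn_integral_joint_fst nn_integral_joint_snd
        simp del: nn_integral_indicator simp flip: nn_integral_indicator)

lemma L2_joint:
  assumes "g \<in> L2 \<mu>"
  shows "(\<lambda>z. g (fst z)) \<in> L2 joint" "(\<lambda>z. g (snd z)) \<in> L2 joint"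
proof -
  have [measurable]: "g \<in> borel_measurable \<mu>" using assms by (rule L2_measurable)
  have "integrable (distr joint \<mu> fst) (\<lambda>x. (g x)\<^sup>2)" "integrable (distr joint \<mu> snd) (\<lambda>x. (g x)\<^sup>2)"
    unfolding distr_joint using assms by (auto simp: L2_def)
  then show "(\<lambda>z. g (fst z)) \<in> L2 joint" "(\<lambda>z. g (snd z)) \<in> L2 joint"
    by (auto simp: L2_def integrable_distr_eq)
qed

lemma integral_joint_fst: "g \<in> borel_measurable \<mu> \<Longrightarrow> (\<integral>z. g (fst z) \<partial>joint) = (\<integral>x. g x \<partial>\<mu>)" for g :: "'s \<Rightarrow> real"
  by (subst (2) distr_joint(1)[symmetric], subst integral_distr) simp_all

lemma integral_joint_snd: "g \<in> borel_measurable \<mu> \<Longrightarrow> (\<integral>z. g (snd z) \<partial>joint) = (\<integral>x. g x \<partial>\<mu>)" for g :: "'s \<Rightarrow> real"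
  by (subst (2) distr_joint(2)[symmetric], subst integral_distr) simp_all

lemma inner_step: "g \<in> L2 \<mu> \<Longrightarrow> h \<in> L2 \<mu> \<Longrightarrow> inner_prod g (step h) = (\<integral>z. g (fst z) * h (snd z) \<partial>joint)"
  using integral_kernel_pair[OF L2_integrable_mult[OF L2_joint(1) L2_joint(2)]]
  by (simp add: inner_prod_def step_def)

lemma inner_commute: "inner_prod g h = inner_prod h g"
  by (simp add: inner_prod_def mult.commute)

lemma step_self_adjoint:
  assumes "g \<in> L2 \<mu>" "h \<in> L2 \<mu>"
  shows "inner_prod g (step h) = inner_prod (step g) h"
proof -
  have [measurable]: "g \<in> borel_measurable \<mu>" "h \<in> borel_measurable \<mu>" using assms by (auto simp: L2_def)
  show ?thesis
    using integral_joint_swap[of "\<lambda>z. g (fst z) * h (snd z)"] assms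
    by (simp add: inner_step inner_commute[of "step g"] mult.commute)
qed

lemma step_measurable[measurable]: "g \<in> borel_measurable \<mu> \<Longrightarrow> step g \<in> borel_measurable \<mu>"
  unfolding step_def[abs_def]
  by (rule measurable_integral_kernel[of "\<lambda>z. g (snd z)", simplified]) simp

text \<open>Jensen for the square, from nonnegativity of the variance under \<open>H x\<close>. If
  the square of \<open>g\<close> is not integrable there, the right side is infinite, so a default
  value of \<open>step g x\<close> does no harm.\<close>

lemma step_square_le:
  assumes "g \<in> borel_measurable \<mu>" "x \<in> space \<mu>"
  shows "ennreal ((step g x)\<^sup>2) \<le> (\<integral>\<^sup>+y. ennreal ((g y)\<^sup>2) \<partial>H x)"
proof (cases "integrable (H x) (\<lambda>y. (g y)\<^sup>2)")
  interpret Hx: prob_space "H x" using assms(2) by (rule prob_space_K)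
  have [measurable]: "g \<in> borel_measurable (H x)"
    using assms measurable_cong_sets[OF sets_K refl] by blast
  case True
  then have gi: "integrable (H x) g" by (intro Hx.L2_integrable) (simp add: L2_def)
  have "(step g x)\<^sup>2 \<le> (\<integral>y. (g y)\<^sup>2 \<partial>H x)"
    using Hx.variance_eq[OF gi True] Hx.variance_positive[of g] unfolding step_def by simp
  then show ?thesis using True by (simp add: nn_integral_eq_integral)
next
  have [measurable]: "g \<in> borel_measurable (H x)"
    using assms measurable_cong_sets[OF sets_K refl] by blast
  case False
  then have "(\<integral>\<^sup>+y. ennreal ((g y)\<^sup>2) \<partial>H x) = \<infinity>"
    by (auto intro!: integrableI_nonneg simp: less_top[symmetric] top_unique intro: ccontr)
  then show ?thesis by simp
qed

lemma
  assumes "g \<in> L2 \<mu>"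
  shows step_L2: "step g \<in> L2 \<mu>" and inner_step_step_le: "inner_prod (step g) (step g) \<le> inner_prod g g"
proof -
  have [measurable]: "g \<in> borel_measurable \<mu>" using assms by (rule L2_measurable)
  have "(\<integral>\<^sup>+x. ennreal ((step g x)\<^sup>2) \<partial>\<mu>) \<le> (\<integral>\<^sup>+x. \<integral>\<^sup>+y. ennreal ((g y)\<^sup>2) \<partial>H x \<partial>\<mu>)"
    by (intro nn_integral_mono step_square_le) auto
  also have "\<dots> = (\<integral>\<^sup>+x. ennreal ((g x)\<^sup>2) \<partial>\<mu>)"
    by (rule nn_integral_stationary) simp
  also have "\<dots> = ennreal (inner_prod g g)"
    using L2_integrable_square[OF assms]
    by (subst nn_integral_eq_integral) (auto simp: inner_prod_def power2_eq_square)
  finally have *: "(\<integral>\<^sup>+x. ennreal ((step g x)\<^sup>2) \<partial>\<mu>) \<le> ennreal (inner_prod g g)" .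
  then show L2: "step g \<in> L2 \<mu>"
    by (auto simp: L2_def intro!: integrableI_nonneg intro: le_less_trans)
  have "ennreal (inner_prod (step g) (step g)) \<le> ennreal (inner_prod g g)"
    using * L2_integrable_square[OF L2]
    by (subst (asm) nn_integral_eq_integral) (auto simp: inner_prod_def power2_eq_square)
  moreover have "0 \<le> inner_prod g g" by (simp add: inner_prod_def integral_nonneg)
  ultimately show "inner_prod (step g) (step g) \<le> inner_prod g g" by (simp add: ennreal_le_iff)
qed

lemma iterate_L2: "g \<in> L2 \<mu> \<Longrightarrow> (step ^^ k) g \<in> L2 \<mu>"
  by (induction k) (simp_all add: step_L2)

lemma inner_self_nonneg: "0 \<le> inner_prod g g"
  by (simp add: inner_prod_def integral_nonneg)

text \<open>Both marginals of \<open>joint\<close> are \<open>\<mu>\<close>, so each square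
  contributes \<open>inner_prod g g\<close>. The left side is the form suited to comparing chains:
  its integrand vanishes on the diagonal, so rejected moves do not count.\<close>

lemma dirichlet_minus:
  assumes "g \<in> L2 \<mu>"
  shows "(\<integral>z. (g (fst z) - g (snd z))\<^sup>2 \<partial>joint) = 2 * (inner_prod g g - inner_prod g (step g))"
proof -
  note L = L2_joint[OF assms]
  have "(\<integral>z. (g (fst z) - g (snd z))\<^sup>2 \<partial>joint) = (\<integral>z. (g (fst z))\<^sup>2 + (g (snd z))\<^sup>2 - 2 * (g (fst z) * g (snd z)) \<partial>joint)"
    by (simp add: power2_diff mult.assoc)
  also have "\<dots> = (\<integral>z. (g (fst z))\<^sup>2 \<partial>joint) + (\<integral>z. (g (snd z))\<^sup>2 \<partial>joint) - 2 * (\<integral>z. g (fst z) * g (snd z) \<partial>joint)"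
    using L[THEN L2_integrable_square] L2_integrable_mult[OF L] by simp
  also have "(\<integral>z. (g (fst z))\<^sup>2 \<partial>joint) = inner_prod g g"
    using assms integral_joint_fst[of "\<lambda>x. (g x)\<^sup>2"]
    by (auto simp: L2_def inner_prod_def power2_eq_square)
  also have "(\<integral>z. (g (snd z))\<^sup>2 \<partial>joint) = inner_prod g g"
    using assms integral_joint_snd[of "\<lambda>x. (g x)\<^sup>2"]
    by (auto simp: L2_def inner_prod_def power2_eq_square)
  finally show ?thesis using assms by (simp add: inner_step)
qed

lemma dirichlet_plus:
  assumes "g \<in> L2 \<mu>"
  shows "(\<integral>z. (g (fst z) + g (snd z))\<^sup>2 \<partial>joint) = 2 * (inner_prod g g + inner_prod g (step g))"
proof -
  note L = L2_joint[OF assms]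
  have "(\<integral>z. (g (fst z) + g (snd z))\<^sup>2 \<partial>joint) = (\<integral>z. (g (fst z))\<^sup>2 + (g (snd z))\<^sup>2 + 2 * (g (fst z) * g (snd z)) \<partial>joint)"
    by (simp add: power2_sum mult.assoc)
  also have "\<dots> = (\<integral>z. (g (fst z))\<^sup>2 \<partial>joint) + (\<integral>z. (g (snd z))\<^sup>2 \<partial>joint) + 2 * (\<integral>z. g (fst z) * g (snd z) \<partial>joint)"
    using L[THEN L2_integrable_square] L2_integrable_mult[OF L] by simp
  also have "(\<integral>z. (g (fst z))\<^sup>2 \<partial>joint) = inner_prod g g"
    using assms integral_joint_fst[of "\<lambda>x. (g x)\<^sup>2"]
    by (auto simp: L2_def inner_prod_def power2_eq_square)
  also have "(\<integral>z. (g (snd z))\<^sup>2 \<partial>joint) = inner_prod g g"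
    using assms integral_joint_snd[of "\<lambda>x. (g x)\<^sup>2"]
    by (auto simp: L2_def inner_prod_def power2_eq_square)
  finally show ?thesis using assms by (simp add: inner_step)
qed

text \<open>The forms of \<open>1 - P\<close> and \<open>1 + P\<close>, with \<open>P\<close> for
  \<open>step\<close>, are integrals of squares over \<open>joint\<close>; together they place the
  spectrum of \<open>P\<close> in [-1, 1].\<close>

lemma abs_inner_step_le:
  assumes "g \<in> L2 \<mu>"
  shows "\<bar>inner_prod g (step g)\<bar> \<le> inner_prod g g"
proof -
  have "0 \<le> (\<integral>z. (g (fst z) - g (snd z))\<^sup>2 \<partial>joint)" "0 \<le> (\<integral>z. (g (fst z) + g (snd z))\<^sup>2 \<partial>joint)"
    by (simp_all add: integral_nonneg)
  then show ?thesis unfolding dirichlet_minus[OF assms] dirichlet_plus[OF assms] by (simp add: abs_le_iff)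
qed

definition autocovariance :: "('s \<Rightarrow> real) \<Rightarrow> nat \<Rightarrow> real" where
  "autocovariance f k = inner_prod f ((step ^^ k) f)"

lemma inner_iterates:
  assumes "f \<in> L2 \<mu>" "g \<in> L2 \<mu>"
  shows "inner_prod ((step ^^ i) f) ((step ^^ j) g) = inner_prod f ((step ^^ (i + j)) g)"
proof (induction i arbitrary: j)
  case (Suc i)
  have "inner_prod ((step ^^ Suc i) f) ((step ^^ j) g) = inner_prod ((step ^^ i) f) ((step ^^ Suc j) g)"
    using assms by (simp add: step_self_adjoint[symmetric] iterate_L2)
  then show ?case using Suc[of "Suc j"] by simp
qed simp

lemma autocov_autocovariance:
  assumes f: "f \<in> L2 \<mu>"
  shows "autocov (autocovariance f)"
proof
  have even: "autocovariance f (2 * k) = inner_prod ((step ^^ k) f) ((step ^^ k) f)" for k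
    using inner_iterates[OF f f, of k k] by (simp add: autocovariance_def mult_2)
  have odd: "autocovariance f (2 * k + 1) = inner_prod ((step ^^ k) f) (step ((step ^^ k) f))" for k
    using inner_iterates[OF f f, of k "Suc k"] by (simp add: autocovariance_def mult_2)
  fix k
  show "0 \<le> autocovariance f (2 * k)" unfolding even by (rule inner_self_nonneg)
  show "autocovariance f (2 * Suc k) \<le> autocovariance f (2 * k)"
    unfolding even using inner_step_step_le[OF iterate_L2[OF f]] by simp
  show "\<bar>autocovariance f (2 * k + 1)\<bar> \<le> autocovariance f (2 * k)"
    unfolding even odd by (rule abs_inner_step_le[OF iterate_L2[OF f]])
qed

subsection \<open>The stationary path\<close>

sublocale IT: Ionescu_Tulcea "\<lambda>i \<omega>. case i of 0 \<Rightarrow> \<mu> | Suc j \<Rightarrow> H (\<omega> j)" "\<lambda>_. \<mu>"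
proof (rule Ionescu_Tulcea.intro)
  fix i
  show "(\<lambda>\<omega>. case i of 0 \<Rightarrow> \<mu> | Suc j \<Rightarrow> H (\<omega> j)) \<in> PiM {0..<i} (\<lambda>_. \<mu>) \<rightarrow>\<^sub>M subprob_algebra \<mu>"
  proof (cases i)
    case (Suc j)
    have "(\<lambda>\<omega>. \<omega> j) \<in> PiM {0..<i} (\<lambda>_. \<mu>) \<rightarrow>\<^sub>M \<mu>"
      by (rule measurable_component_singleton) (simp add: Suc)
    from measurable_compose[OF this K_subprob] show ?thesis by (simp add: Suc)
  qed (simp add: M_in_subprob)
  show "prob_space (case i of 0 \<Rightarrow> \<mu> | Suc j \<Rightarrow> H (x j))" if "x \<in> space (PiM {0..<i} (\<lambda>_. \<mu>))" for x
    using that by (cases i) (auto simp: prob_space_axioms prob_space_K space_PiM PiE_iff)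
qed

abbreviation path :: "(nat \<Rightarrow> 's) measure" where "path \<equiv> path_law H \<mu>"

abbreviation past :: "nat \<Rightarrow> (nat \<Rightarrow> 's) measure" where "past n \<equiv> PiM {0..<n} (\<lambda>_. \<mu>)"

lemma sets_path[simp, measurable_cong]: "sets path = sets (PiM UNIV (\<lambda>_. \<mu>))"
  by (simp add: path_law_def)

lemma path_component_measurable[measurable]: "(\<lambda>\<omega>. \<omega> t) \<in> path \<rightarrow>\<^sub>M \<mu>"
  by simp

lemma path_restrict_measurable[measurable]: "(\<lambda>\<omega>. restrict \<omega> {0..<n}) \<in> path \<rightarrow>\<^sub>M past n"
  by (rule measurable_restrict) simp

text \<open>On the initial segment \<open>{0..<n}\<close> the projective family projects the
  \<open>n\<close>-th stage of the construction onto itself. The argument \<open>undefined\<close>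
  is the unique point of the empty product, the past before time 0.\<close>

lemma distr_path_restrict: "distr path (past n) (\<lambda>\<omega>. restrict \<omega> {0..<n}) = IT.C 0 n (\<lambda>_. undefined)"
proof -
  have "distr path (past n) (\<lambda>\<omega>. restrict \<omega> {0..<n}) = IT.CI {0..<n}"
    unfolding path_law_def by (rule IT.distr_lim) simp
  also have "\<dots> = IT.C 0 n (\<lambda>_. undefined)"
  proof (rule measure_eqI)
    show sets: "sets (IT.CI {0..<n}) = sets (IT.C 0 n (\<lambda>_. undefined))"
      by (simp add: IT.CI_def IT.sets_C)
    fix A assume "A \<in> sets (IT.CI {0..<n})"
    then have A: "A \<in> sets (past n)" by (simp add: IT.CI_def)
    then have "prod_emb {0..<n} (\<lambda>_. \<mu>) {0..<n} A = A"
      using sets.sets_into_space[OF A] by (intro prod_emb_id) (simp add: space_PiM)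
    then show "emeasure (IT.CI {0..<n}) A = emeasure (IT.C 0 n (\<lambda>_. undefined)) A"
      using IT.emeasure_CI[OF order_refl A] by simp
  qed
  finally show ?thesis .
qed

lemma prob_space_path: "prob_space path"
proof (rule prob_space_distrD[OF path_restrict_measurable])
  show "prob_space (distr path (past 0) (\<lambda>\<omega>. restrict \<omega> {0..<0}))"
    unfolding distr_path_restrict by (rule IT.prob_space_C) simp
qed

text \<open>The Markov property. The last stage of the construction appends one coordinate drawn
  from \<open>H (\<omega> t)\<close> and leaves the earlier coordinates alone, so only
  \<open>F\<close> in its last argument is averaged.\<close>

lemma nn_integral_path_step:
  assumes F[measurable]: "F \<in> borel_measurable (past (Suc t) \<Otimes>\<^sub>M \<mu>)"
  shows "(\<integral>\<^sup>+\<omega>. F (restrict \<omega> {0..<Suc t}, \<omega> (Suc t)) \<partial>path) =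
    (\<integral>\<^sup>+\<omega>. \<integral>\<^sup>+y. F (restrict \<omega> {0..<Suc t}, y) \<partial>H (\<omega> t) \<partial>path)"
proof -
  define G where "G \<omega> = F (restrict \<omega> {0..<Suc t}, \<omega> (Suc t))" for \<omega>
  have r[measurable]: "(\<lambda>\<omega>. restrict \<omega> {0..<Suc t}) \<in> past (Suc (Suc t)) \<rightarrow>\<^sub>M past (Suc t)"
    by (rule measurable_restrict_subset) auto
  have [measurable]: "(\<lambda>\<omega>. \<omega> (Suc t)) \<in> past (Suc (Suc t)) \<rightarrow>\<^sub>M \<mu>" "(\<lambda>\<omega>. \<omega> t) \<in> past (Suc t) \<rightarrow>\<^sub>M \<mu>"
    by (rule measurable_component_singleton; simp)+
  have G[measurable]: "G \<in> borel_measurable (past (Suc (Suc t)))"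
    unfolding G_def[abs_def] by measurable
  have [measurable]: "(\<lambda>\<omega>. restrict \<omega> {0..<Suc t}) \<in> past (Suc t) \<rightarrow>\<^sub>M past (Suc t)"
    by (rule measurable_restrict_subset) auto
  have "(\<lambda>(\<omega>, y). F (restrict \<omega> {0..<Suc t}, y)) \<in> borel_measurable (past (Suc t) \<Otimes>\<^sub>M \<mu>)"
    unfolding case_prod_beta' by measurable
  then have meas: "(\<lambda>\<omega>. \<integral>\<^sup>+y. F (restrict \<omega> {0..<Suc t}, y) \<partial>H (\<omega> t)) \<in> borel_measurable (past (Suc t))"
    by (rule nn_integral_measurable_subprob_algebra2) measurable
  have "(\<integral>\<^sup>+\<omega>. F (restrict \<omega> {0..<Suc t}, \<omega> (Suc t)) \<partial>path) =
      (\<integral>\<^sup>+\<omega>. G \<omega> \<partial>distr path (past (Suc (Suc t))) (\<lambda>\<omega>. restrict \<omega> {0..<Suc (Suc t)}))"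
    by (subst nn_integral_distr) (simp_all add: G_def Int_absorb1 restrict_restrict)
  also have "\<dots> = (\<integral>\<^sup>+\<omega>. G \<omega> \<partial>IT.C 0 (Suc (Suc t)) (\<lambda>_. undefined))"
    unfolding distr_path_restrict ..
  also have "\<dots> = (\<integral>\<^sup>+\<omega>. \<integral>\<^sup>+\<omega>'. G \<omega>' \<partial>IT.eP (Suc t) \<omega> \<partial>IT.C 0 (Suc t) (\<lambda>_. undefined))"
    unfolding IT.C.simps(2)[of 0 "Suc t"] add_0
    by (rule nn_integral_bind[OF G], subst measurable_cong_sets[OF IT.sets_C refl])
       (use IT.measurable_eP[of "Suc t"] in simp_all)
  also have "\<dots> = (\<integral>\<^sup>+\<omega>. \<integral>\<^sup>+y. F (restrict \<omega> {0..<Suc t}, y) \<partial>H (\<omega> t) \<partial>IT.C 0 (Suc t) (\<lambda>_. undefined))"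
  proof (intro nn_integral_cong)
    fix \<omega> assume "\<omega> \<in> space (IT.C 0 (Suc t) (\<lambda>_. undefined))"
    then have \<omega>: "\<omega> \<in> space (past (Suc t))" using IT.space_C[of "\<lambda>_. undefined" 0 "Suc t"] by simp
    have "restrict (fun_upd \<omega> (Suc t) y) {0..<Suc t} = restrict \<omega> {0..<Suc t}" for y
      by (auto simp: restrict_def)
    then show "(\<integral>\<^sup>+\<omega>'. G \<omega>' \<partial>IT.eP (Suc t) \<omega>) = (\<integral>\<^sup>+y. F (restrict \<omega> {0..<Suc t}, y) \<partial>H (\<omega> t))"
      by (subst IT.nn_integral_eP[OF \<omega> G]) (simp add: G_def)
  qed
  also have "\<dots> = (\<integral>\<^sup>+\<omega>. \<integral>\<^sup>+y. F (restrict \<omega> {0..<Suc t}, y) \<partial>H (\<omega> t)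
      \<partial>distr path (past (Suc t)) (\<lambda>\<omega>. restrict \<omega> {0..<Suc t}))"
    unfolding distr_path_restrict ..
  also have "\<dots> = (\<integral>\<^sup>+\<omega>. \<integral>\<^sup>+y. F (restrict \<omega> {0..<Suc t}, y) \<partial>H (\<omega> t) \<partial>path)"
    by (subst nn_integral_distr[OF path_restrict_measurable]) (simp_all add: meas restrict_restrict)
  finally show ?thesis .
qed

lemma distr_path_component: "distr path \<mu> (\<lambda>\<omega>. \<omega> t) = \<mu>"
proof (induction t)
  case 0
  have "distr path \<mu> (\<lambda>\<omega>. \<omega> 0) = distr (distr path (past (Suc 0)) (\<lambda>\<omega>. restrict \<omega> {0..<Suc 0})) \<mu> (\<lambda>\<omega>. \<omega> 0)"
    by (subst distr_distr) (auto simp: comp_def)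
  also have "\<dots> = distr (IT.eP 0 (\<lambda>_. undefined)) \<mu> (\<lambda>\<omega>. \<omega> 0)"
    unfolding distr_path_restrict IT.C.simps(2) IT.C.simps(1) add_0
    by (subst bind_return[OF IT.measurable_eP]) simp_all
  also have "\<dots> = distr \<mu> \<mu> (\<lambda>x. x)"
    unfolding IT.eP_def by (subst distr_distr) (auto simp: comp_def intro!: measurable_fun_upd[where J="{}"])
  finally show ?case by (simp add: distr_id2)
next
  case (Suc t)
  show ?case
  proof (rule measure_eqI)
    fix A assume "A \<in> sets (distr path \<mu> (\<lambda>\<omega>. \<omega> (Suc t)))"
    then have [measurable]: "A \<in> sets \<mu>" by simp
    have "emeasure (distr path \<mu> (\<lambda>\<omega>. \<omega> (Suc t))) A = (\<integral>\<^sup>+\<omega>. indicator A (\<omega> (Suc t)) \<partial>path)"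
      by (subst nn_integral_distr[symmetric, where T = "\<lambda>\<omega>. \<omega> (Suc t)" and M' = \<mu> and f = "indicator A"]) auto
    also have "\<dots> = (\<integral>\<^sup>+\<omega>. (\<integral>\<^sup>+y. indicator A y \<partial>H (\<omega> t)) \<partial>path)"
      using nn_integral_path_step[of "\<lambda>z. indicator A (snd z)" t] by simp
    also have "\<dots> = (\<integral>\<^sup>+x. (\<integral>\<^sup>+y. indicator A y \<partial>H x) \<partial>distr path \<mu> (\<lambda>\<omega>. \<omega> t))"
      by (subst nn_integral_distr) (simp_all add: nn_integral_measurable_subprob_algebra2[OF _ K_subprob] del: nn_integral_indicator)
    also have "\<dots> = emeasure \<mu> A"
      unfolding Suc by (subst nn_integral_stationary) simp_all
    finally show "emeasure (distr path \<mu> (\<lambda>\<omega>. \<omega> (Suc t))) A = emeasure \<mu> A" .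
  qed simp
qed

lemma L2_path:
  assumes "g \<in> L2 \<mu>"
  shows "(\<lambda>\<omega>. g (\<omega> t)) \<in> L2 path"
proof -
  have [measurable]: "g \<in> borel_measurable \<mu>" using assms by (rule L2_measurable)
  have "integrable (distr path \<mu> (\<lambda>\<omega>. \<omega> t)) (\<lambda>x. (g x)\<^sup>2)"
    unfolding distr_path_component using assms by (rule L2_integrable_square)
  then show ?thesis by (auto simp: L2_def integrable_distr_eq)
qed

lemma integral_path_component:
  fixes g :: "'s \<Rightarrow> real"
  shows "g \<in> borel_measurable \<mu> \<Longrightarrow> (\<integral>\<omega>. g (\<omega> t) \<partial>path) = (\<integral>x. g x \<partial>\<mu>)"
  by (subst (2) distr_path_component[of t, symmetric], subst integral_distr) simp_all

text \<open>The Markov property is available for nonnegative integrands, while \<open>g\<close> and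
  \<open>f\<close> are signed. It is therefore used to identify the law of
  \<open>((\<omega> s, \<omega> t), \<omega> (Suc t))\<close> as a kernel pair over the law of its
  first component, where the signed Fubini theorem applies.\<close>

lemma integral_path_step:
  assumes "g \<in> L2 \<mu>" "f \<in> L2 \<mu>" "s \<le> t"
  shows "(\<integral>\<omega>. g (\<omega> s) * f (\<omega> (Suc t)) \<partial>path) = (\<integral>\<omega>. g (\<omega> s) * step f (\<omega> t) \<partial>path)"
proof -
  have [measurable]: "g \<in> borel_measurable \<mu>" "f \<in> borel_measurable \<mu>" using assms by (auto simp: L2_def)
  define N where "N = distr path (\<mu> \<Otimes>\<^sub>M \<mu>) (\<lambda>\<omega>. (\<omega> s, \<omega> t))"
  interpret N: markov_kernel N "\<lambda>z. H (snd z)" \<mu>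
  proof
    show "(\<lambda>z. H (snd z)) \<in> N \<rightarrow>\<^sub>M prob_algebra \<mu>" unfolding N_def by measurable
    show "space N \<noteq> {}" by (simp add: N_def space_pair_measure not_empty)
  qed
  have sets_N[measurable_cong, simp]: "sets N = sets (\<mu> \<Otimes>\<^sub>M \<mu>)" by (simp add: N_def)
  have eq: "distr path (N \<Otimes>\<^sub>M \<mu>) (\<lambda>\<omega>. ((\<omega> s, \<omega> t), \<omega> (Suc t))) = kernel_pair N (\<lambda>z. H (snd z)) \<mu>"
  proof (rule measure_eqI)
    fix A assume "A \<in> sets (distr path (N \<Otimes>\<^sub>M \<mu>) (\<lambda>\<omega>. ((\<omega> s, \<omega> t), \<omega> (Suc t))))"
    then have A[measurable]: "A \<in> sets (N \<Otimes>\<^sub>M \<mu>)" by simp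
    have st: "s < Suc t" using assms(3) by simp
    have c[measurable]: "(\<lambda>\<omega>. \<omega> s) \<in> past (Suc t) \<rightarrow>\<^sub>M \<mu>" "(\<lambda>\<omega>. \<omega> t) \<in> past (Suc t) \<rightarrow>\<^sub>M \<mu>"
      by (rule measurable_component_singleton; use st in simp)+
    have F: "(\<lambda>z. indicator A ((fst z s, fst z t), snd z) :: ennreal) \<in> borel_measurable (past (Suc t) \<Otimes>\<^sub>M \<mu>)"
      by measurable
    have "emeasure (distr path (N \<Otimes>\<^sub>M \<mu>) (\<lambda>\<omega>. ((\<omega> s, \<omega> t), \<omega> (Suc t)))) A
       = (\<integral>\<^sup>+\<omega>. indicator A ((\<omega> s, \<omega> t), \<omega> (Suc t)) \<partial>path)"
      unfolding nn_integral_indicator[symmetric, OF \<open>A \<in> sets (distr path _ _)\<close>]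
      by (rule nn_integral_distr) measurable
    also have "\<dots> = (\<integral>\<^sup>+\<omega>. (\<integral>\<^sup>+y. indicator A ((\<omega> s, \<omega> t), y) \<partial>H (\<omega> t)) \<partial>path)"
      using nn_integral_path_step[OF F] st by simp
    also have "\<dots> = (\<integral>\<^sup>+z. (\<integral>\<^sup>+y. indicator A (z, y) \<partial>H (snd z)) \<partial>N)"
      unfolding N_def
      by (subst nn_integral_distr) (use nn_integral_measurable_subprob_algebra2[OF _ N.K_subprob, of "\<lambda>z y. indicator A (z, y)"] in \<open>simp_all add: N_def\<close>)
    also have "\<dots> = (\<integral>\<^sup>+z. indicator A z \<partial>kernel_pair N (\<lambda>z. H (snd z)) \<mu>)"
      by (rule N.nn_integral_kernel_pair[symmetric]) measurable
    also have "\<dots> = emeasure (kernel_pair N (\<lambda>z. H (snd z)) \<mu>) A"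
      by (rule nn_integral_indicator) measurable
    finally show "emeasure (distr path (N \<Otimes>\<^sub>M \<mu>) (\<lambda>\<omega>. ((\<omega> s, \<omega> t), \<omega> (Suc t)))) A =
      emeasure (kernel_pair N (\<lambda>z. H (snd z)) \<mu>) A" .
  qed simp
  have "integrable path (\<lambda>\<omega>. g (\<omega> s) * f (\<omega> (Suc t)))"
    by (intro L2_integrable_mult L2_path assms)
  then have "integrable (kernel_pair N (\<lambda>z. H (snd z)) \<mu>) (\<lambda>z. g (fst (fst z)) * f (snd z))"
    unfolding eq[symmetric] by (subst integrable_distr_eq) auto
  note int = this
  have "(\<integral>\<omega>. g (\<omega> s) * f (\<omega> (Suc t)) \<partial>path) =
      (\<integral>z. g (fst (fst z)) * f (snd z) \<partial>distr path (N \<Otimes>\<^sub>M \<mu>) (\<lambda>\<omega>. ((\<omega> s, \<omega> t), \<omega> (Suc t))))"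
    by (subst integral_distr; (measurable | simp))
  also have "\<dots> = (\<integral>x. g (fst x) * step f (snd x) \<partial>N)"
    unfolding eq N.integral_kernel_pair[OF int] by (simp add: step_def)
  also have "\<dots> = (\<integral>\<omega>. g (\<omega> s) * step f (\<omega> t) \<partial>path)"
    unfolding N_def by (subst integral_distr; (measurable | simp))
  finally show ?thesis .
qed

lemma integral_path_autocovariance:
  assumes "g \<in> L2 \<mu>" "f \<in> L2 \<mu>"
  shows "(\<integral>\<omega>. g (\<omega> s) * f (\<omega> (s + k)) \<partial>path) = inner_prod g ((step ^^ k) f)"
  using assms(2)
proof (induction k arbitrary: f)
  case 0
  have [measurable]: "g \<in> borel_measurable \<mu>" "f \<in> borel_measurable \<mu>" using assms 0 by (auto simp: L2_def)
  show ?case using integral_path_component[of "\<lambda>x. g x * f x" s] by (simp add: inner_prod_def)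
next
  case (Suc k)
  have "(\<integral>\<omega>. g (\<omega> s) * f (\<omega> (s + Suc k)) \<partial>path) = (\<integral>\<omega>. g (\<omega> s) * step f (\<omega> (s + k)) \<partial>path)"
    using integral_path_step[OF assms(1) Suc.prems, of s "s + k"] by simp
  also have "\<dots> = inner_prod g ((step ^^ k) (step f))" by (rule Suc.IH[OF step_L2[OF Suc.prems]])
  finally show ?case by (simp add: funpow_swap1)
qed

lemma asymptotic_variance_eq:
  assumes "f \<in> L2 \<mu>"
  shows "asymptotic_variance f H \<mu> =
    lim (\<lambda>n. ereal (autocov_avg (autocovariance (\<lambda>x. f x - expectation f)) n))"
proof -
  interpret path: prob_space path by (rule prob_space_path)
  define f0 where "f0 x = f x - expectation f" for x
  have f0: "f0 \<in> L2 \<mu>" unfolding f0_def[abs_def] by (intro L2_diff assms L2_const)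
  have [measurable]: "f \<in> borel_measurable \<mu>" using assms by (simp add: L2_def)
  have cov: "(\<integral>\<omega>. f0 (\<omega> s) * f0 (\<omega> t) \<partial>path) = autocovariance f0 ((s - t) + (t - s))" for s t
  proof (cases "s \<le> t")
    case True
    then show ?thesis using integral_path_autocovariance[OF f0 f0, of s "t - s"] by (simp add: autocovariance_def)
  next
    case False
    then show ?thesis using integral_path_autocovariance[OF f0 f0, of t "s - t"]
      by (simp add: autocovariance_def mult.commute)
  qed
  have "real n * path.variance (\<lambda>\<omega>. (1 / real n) * (\<Sum>t<n. f (\<omega> t))) = autocov_avg (autocovariance f0) n" for n
  proof (cases "n = 0")
    case False
    have "path.expectation (\<lambda>\<omega>. (1 / real n) * (\<Sum>t<n. f (\<omega> t))) = (1 / real n) * (\<Sum>t<n. path.expectation (\<lambda>\<omega>. f (\<omega> t)))"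
      using path.L2_integrable[OF L2_path[OF assms]] by (subst integral_mult_right_zero) (simp add: Bochner_Integration.integral_sum)
    then have mean: "path.expectation (\<lambda>\<omega>. (1 / real n) * (\<Sum>t<n. f (\<omega> t))) = expectation f"
      using False by (simp add: integral_path_component)
    have "(1 / real n) * (\<Sum>t<n. f (\<omega> t)) - expectation f = (1 / real n) * (\<Sum>t<n. f0 (\<omega> t))" for \<omega>
      using False by (simp add: f0_def sum_subtractf diff_divide_distrib)
    then have "path.variance (\<lambda>\<omega>. (1 / real n) * (\<Sum>t<n. f (\<omega> t))) =
        path.expectation (\<lambda>\<omega>. (1 / real n)\<^sup>2 * (\<Sum>s<n. \<Sum>t<n. f0 (\<omega> s) * f0 (\<omega> t)))"
      unfolding mean by (simp add: power_mult_distrib power2_eq_square sum_product)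
    also have "\<dots> = (1 / real n)\<^sup>2 * (\<Sum>s<n. \<Sum>t<n. path.expectation (\<lambda>\<omega>. f0 (\<omega> s) * f0 (\<omega> t)))"
      using L2_integrable_mult[OF L2_path[OF f0] L2_path[OF f0]]
      by (simp add: Bochner_Integration.integral_sum)
    finally show ?thesis
      using False by (simp add: cov autocov_avg_def power2_eq_square)
  qed (simp add: autocov_avg_def)
  then show ?thesis unfolding asymptotic_variance_def f0_def[abs_def] by simp
qed

subsection \<open>Resolvents\<close>

lemma inner_prod_sum:
  assumes "g \<in> L2 \<mu>" "\<And>k. k \<in> I \<Longrightarrow> h k \<in> L2 \<mu>"
  shows "inner_prod g (\<lambda>x. \<Sum>k\<in>I. a k * h k x) = (\<Sum>k\<in>I. a k * inner_prod g (h k))"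
proof -
  have "inner_prod g (\<lambda>x. \<Sum>k\<in>I. a k * h k x) = (\<integral>x. (\<Sum>k\<in>I. a k * (g x * h k x)) \<partial>\<mu>)"
    unfolding inner_prod_def by (simp add: sum_distrib_left mult.left_commute)
  also have "\<dots> = (\<Sum>k\<in>I. \<integral>x. a k * (g x * h k x) \<partial>\<mu>)"
    using assms by (intro Bochner_Integration.integral_sum) (simp add: L2_integrable_mult)
  finally show ?thesis by (simp add: inner_prod_def)
qed

lemma inner_prod_step_sum:
  assumes "g \<in> L2 \<mu>" "\<And>k. k \<in> I \<Longrightarrow> h k \<in> L2 \<mu>"
  shows "inner_prod g (step (\<lambda>x. \<Sum>k\<in>I. a k * h k x)) = (\<Sum>k\<in>I. a k * inner_prod g (step (h k)))"
proof -
  have "(\<lambda>x. \<Sum>k\<in>I. a k * h k x) \<in> L2 \<mu>" using assms by (intro L2_sum L2_cmult)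
  then show ?thesis using assms by (simp add: step_self_adjoint inner_prod_sum step_L2)
qed

lemma inner_prod_diff:
  assumes "f \<in> L2 \<mu>" "g \<in> L2 \<mu>" "h \<in> L2 \<mu>"
  shows "inner_prod f (\<lambda>x. g x - a * h x) = inner_prod f g - a * inner_prod f h"
proof -
  have "inner_prod f (\<lambda>x. g x - a * h x) = (\<integral>x. f x * g x - a * (f x * h x) \<partial>\<mu>)"
    unfolding inner_prod_def by (simp add: algebra_simps)
  then show ?thesis using assms by (simp add: inner_prod_def L2_integrable_mult)
qed

text \<open>The bilinear form of \<open>1 - r P\<close>, where \<open>P\<close> is
  \<open>step\<close>.\<close>

definition resolvent_form :: "real \<Rightarrow> ('s \<Rightarrow> real) \<Rightarrow> ('s \<Rightarrow> real) \<Rightarrow> real" where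
  "resolvent_form r g h = inner_prod g h - r * inner_prod g (step h)"

definition resolvent_sum :: "real \<Rightarrow> ('s \<Rightarrow> real) \<Rightarrow> nat \<Rightarrow> 's \<Rightarrow> real" where
  "resolvent_sum r f n x = (\<Sum>k<n. r ^ k * (step ^^ k) f x)"

lemma resolvent_sum_L2: "f \<in> L2 \<mu> \<Longrightarrow> resolvent_sum r f n \<in> L2 \<mu>"
  unfolding resolvent_sum_def[abs_def] by (intro L2_sum L2_cmult iterate_L2)

lemma inner_prod_resolvent_sum:
  assumes "g \<in> L2 \<mu>" "f \<in> L2 \<mu>"
  shows "inner_prod g (resolvent_sum r f n) = (\<Sum>k<n. r ^ k * inner_prod g ((step ^^ k) f))"
  unfolding resolvent_sum_def[abs_def] using assms by (intro inner_prod_sum iterate_L2)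

text \<open>Telescoping of the Neumann series: \<open>1 - r P\<close> applied to the partial sum
  leaves \<open>f\<close> minus a remainder of order \<open>r ^ n\<close>.\<close>

lemma resolvent_form_resolvent_sum:
  assumes "g \<in> L2 \<mu>" "f \<in> L2 \<mu>"
  shows "resolvent_form r g (resolvent_sum r f n) = inner_prod g f - r ^ n * inner_prod g ((step ^^ n) f)"
proof -
  have "inner_prod g (step (resolvent_sum r f n)) = (\<Sum>k<n. r ^ k * inner_prod g (step ((step ^^ k) f)))"
    unfolding resolvent_sum_def[abs_def] using assms by (intro inner_prod_step_sum iterate_L2)
  then have "resolvent_form r g (resolvent_sum r f n) =
      (\<Sum>k<n. r ^ k * inner_prod g ((step ^^ k) f)) - r * (\<Sum>k<n. r ^ k * inner_prod g ((step ^^ Suc k) f))"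
    by (simp add: resolvent_form_def inner_prod_resolvent_sum assms)
  also have "\<dots> = inner_prod g f - r ^ n * inner_prod g ((step ^^ n) f)"
    by (induction n) (simp_all add: algebra_simps)
  finally show ?thesis .
qed

text \<open>From \<open>1 - r P = (1 - r) + r (1 - P)\<close>. The first part is a multiple of the
  squared norm, which the transfer of test functions preserves; the second is the Dirichlet form,
  which the transfer controls.\<close>

lemma resolvent_form_eq_dirichlet:
  assumes "g \<in> L2 \<mu>"
  shows "resolvent_form r g g =
    (1 - r) * inner_prod g g + r / 2 * (\<integral>z. (g (fst z) - g (snd z))\<^sup>2 \<partial>joint)"
  unfolding dirichlet_minus[OF assms] resolvent_form_def by (simp add: algebra_simps)

lemma resolvent_form_nonneg:
  assumes "g \<in> L2 \<mu>" "0 \<le> r" "r \<le> 1"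
  shows "0 \<le> resolvent_form r g g"
  unfolding resolvent_form_eq_dirichlet[OF assms(1)] using assms inner_self_nonneg[of g]
  by (intro add_nonneg_nonneg mult_nonneg_nonneg integral_nonneg) auto

lemma resolvent_form_diff:
  assumes "g \<in> L2 \<mu>" "h \<in> L2 \<mu>"
  shows "resolvent_form r (\<lambda>x. g x - a * h x) (\<lambda>x. g x - a * h x) =
    resolvent_form r g g - 2 * a * resolvent_form r g h + a\<^sup>2 * resolvent_form r h h"
proof -
  let ?d = "\<lambda>x. g x - a * h x"
  have d: "?d \<in> L2 \<mu>" using assms by (intro L2_diff L2_cmult)
  have l: "inner_prod ?d f = inner_prod g f - a * inner_prod h f" if "f \<in> L2 \<mu>" for f
    using inner_prod_diff[OF that assms, of a] by (simp add: inner_commute)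
  have s: "inner_prod f (step ?d) = inner_prod f (step g) - a * inner_prod f (step h)" if "f \<in> L2 \<mu>" for f
    using assms that d by (simp add: step_self_adjoint inner_prod_diff step_L2)
  have "inner_prod h (step g) = inner_prod g (step h)"
    unfolding step_self_adjoint[OF assms(2,1)] by (rule inner_commute)
  moreover have "inner_prod h g = inner_prod g h" by (rule inner_commute)
  ultimately show ?thesis
    unfolding resolvent_form_def
    by (simp add: s d inner_prod_diff assms l step_L2) (simp add: algebra_simps power2_eq_square)
qed

lemma abs_autocovariance_le: "f \<in> L2 \<mu> \<Longrightarrow> \<bar>autocovariance f k\<bar> \<le> inner_prod f f"
  using autocov.abs_le_0[OF autocov_autocovariance, of f k] by (simp add: autocovariance_def)

text \<open>The point is uniformity in \<open>n\<close>: the remainders of the truncated Neumann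
  series are \<open>r ^ n\<close> times such quantities and hence vanish.\<close>

lemma weighted_autocovariance_bound:
  assumes "f \<in> L2 \<mu>" "0 \<le> r" "r < 1"
  shows "\<bar>\<Sum>k<n. r ^ k * autocovariance f (k + m)\<bar> \<le> inner_prod f f / (1 - r)"
proof -
  have "\<bar>\<Sum>k<n. r ^ k * autocovariance f (k + m)\<bar> \<le> (\<Sum>k<n. \<bar>r ^ k * autocovariance f (k + m)\<bar>)" by (rule sum_abs)
  also have "\<dots> \<le> (\<Sum>k<n. r ^ k * inner_prod f f)"
    using assms by (intro sum_mono) (simp add: abs_mult mult_left_mono abs_autocovariance_le)
  also have "\<dots> = (\<Sum>k<n. r ^ k) * inner_prod f f" by (simp add: sum_distrib_right)
  also have "\<dots> \<le> (1 / (1 - r)) * inner_prod f f"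
    using assms by (intro mult_right_mono inner_self_nonneg) (simp add: sum_gp_strict divide_right_mono)
  finally show ?thesis by simp
qed

lemma inner_prod_resolvent_sum_iterate:
  assumes "f \<in> L2 \<mu>"
  shows "inner_prod (resolvent_sum r f n) ((step ^^ m) f) = (\<Sum>k<n. r ^ k * autocovariance f (k + m))"
  using inner_prod_resolvent_sum[OF iterate_L2 assms, OF assms, of m r n] inner_iterates[OF assms assms]
  by (simp add: inner_commute[of "resolvent_sum r f n"] autocovariance_def add.commute)

lemma inner_prod_resolvent_sum_self_le:
  assumes "f \<in> L2 \<mu>" "0 \<le> r" "r < 1"
  shows "inner_prod (resolvent_sum r f n) (resolvent_sum r f n) \<le> inner_prod f f / (1 - r) / (1 - r)"
proof -
  have "inner_prod (resolvent_sum r f n) (resolvent_sum r f n) =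
      (\<Sum>m<n. r ^ m * (\<Sum>k<n. r ^ k * autocovariance f (k + m)))"
    using assms by (simp add: inner_prod_resolvent_sum resolvent_sum_L2 inner_prod_resolvent_sum_iterate)
  also have "\<dots> \<le> (\<Sum>m<n. r ^ m * (inner_prod f f / (1 - r)))"
    using weighted_autocovariance_bound[OF assms] assms by (intro sum_mono mult_left_mono) (auto simp: abs_le_iff)
  also have "\<dots> = (\<Sum>m<n. r ^ m) * (inner_prod f f / (1 - r))" by (rule sum_distrib_right[symmetric])
  also have "\<dots> \<le> (1 / (1 - r)) * (inner_prod f f / (1 - r))"
    using assms inner_self_nonneg by (intro mult_right_mono) (simp_all add: sum_gp_strict divide_right_mono)
  finally show ?thesis by simp
qed

text \<open>Nonnegativity of the squared norm of \<open>g - a * h\<close> at \<open>a = 1\<close>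
  and \<open>a = -1\<close>, expanded through the resolvent form at \<open>r = 0\<close>.\<close>

lemma inner_prod_le_half:
  assumes "g \<in> L2 \<mu>" "h \<in> L2 \<mu>"
  shows "\<bar>inner_prod g h\<bar> \<le> (inner_prod g g + inner_prod h h) / 2"
proof -
  have "0 \<le> inner_prod g g - 2 * a * inner_prod g h + a\<^sup>2 * inner_prod h h" for a
    using resolvent_form_diff[OF assms, of 0 a] inner_self_nonneg[of "\<lambda>x. g x - a * h x"]
    by (simp add: resolvent_form_def)
  from this[of 1] this[of "-1"] show ?thesis by (simp add: abs_le_iff)
qed

end

subsection \<open>Comparison of asymptotic variances\<close>

text \<open>The resolvent \<open>(1 - r H)\<^sup>-\<^sup>1\<close> maximises \<open>2 \<langle>g, f\<rangle> - \<langle>g, (1 - r H) g\<rangle>\<close>, so it is monotone in the Dirichlet form.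
  Partial sums of the Neumann series replace the maximiser.\<close>

lemma abel_autocovariance_le:
  assumes "reversible_chain \<mu>1 H1" "reversible_chain \<mu>2 H2"
    and f1: "f1 \<in> L2 \<mu>1" and f2: "f2 \<in> L2 \<mu>2" and C: "1 \<le> C" and r: "0 < r" "r < 1"
    and transfer: "\<And>g. g \<in> L2 \<mu>1 \<Longrightarrow> \<exists>g'\<in>L2 \<mu>2.
      (\<integral>x. g' x * g' x \<partial>\<mu>2) = (\<integral>x. g x * g x \<partial>\<mu>1) \<and> (\<integral>x. g' x * f2 x \<partial>\<mu>2) = (\<integral>x. g x * f1 x \<partial>\<mu>1) \<and>
      (\<integral>z. (g' (fst z) - g' (snd z))\<^sup>2 \<partial>kernel_pair \<mu>2 H2 \<mu>2) \<le>
        C * (\<integral>z. (g (fst z) - g (snd z))\<^sup>2 \<partial>kernel_pair \<mu>1 H1 \<mu>1)"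
  shows "(\<Sum>k. r ^ k * reversible_chain.autocovariance \<mu>1 H1 f1 k) \<le>
    C * (\<Sum>k. r ^ k * reversible_chain.autocovariance \<mu>2 H2 f2 k)"
proof -
  interpret c1: reversible_chain \<mu>1 H1 by fact
  interpret c2: reversible_chain \<mu>2 H2 by fact
  \<comment> \<open>The remainders of three truncated Neumann identities, for \<open>u\<close> with
    itself, \<open>v\<close> with itself and \<open>g\<close> with \<open>v\<close>, in this order
    and with the coefficients that they get in the final inequality.\<close>
  define B where "B = C * (c1.inner_prod f1 f1 / (1 - r)) + C\<^sup>2 * (c2.inner_prod f2 f2 / (1 - r))
      + C * (c1.inner_prod f1 f1 / (1 - r) / (1 - r) + c2.inner_prod f2 f2)"
  have partial: "C * (\<Sum>k<n. r ^ k * c1.autocovariance f1 k) \<le> C\<^sup>2 * (\<Sum>k<n. r ^ k * c2.autocovariance f2 k) + r ^ n * B" for n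
  proof -
    define u where "u = c1.resolvent_sum r f1 n"
    define v where "v = c2.resolvent_sum r f2 n"
    have u: "u \<in> L2 \<mu>1" unfolding u_def by (rule c1.resolvent_sum_L2[OF f1])
    have v: "v \<in> L2 \<mu>2" unfolding v_def by (rule c2.resolvent_sum_L2[OF f2])
    obtain g where g: "g \<in> L2 \<mu>2" and gg: "c2.inner_prod g g = c1.inner_prod u u"
      and gf: "c2.inner_prod g f2 = c1.inner_prod u f1"
      and gd: "(\<integral>z. (g (fst z) - g (snd z))\<^sup>2 \<partial>c2.joint) \<le> C * (\<integral>z. (u (fst z) - u (snd z))\<^sup>2 \<partial>c1.joint)"
      using transfer[OF u] by (auto simp: c1.inner_prod_def c2.inner_prod_def)
    have uf: "c1.inner_prod u f1 = (\<Sum>k<n. r ^ k * c1.autocovariance f1 k)"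
      using c1.inner_prod_resolvent_sum_iterate[OF f1, of r n 0] by (simp add: u_def)
    have vf: "c2.inner_prod v f2 = (\<Sum>k<n. r ^ k * c2.autocovariance f2 k)"
      using c2.inner_prod_resolvent_sum_iterate[OF f2, of r n 0] by (simp add: v_def)
    have uu: "c1.resolvent_form r u u \<le> c1.inner_prod u f1 + r ^ n * (c1.inner_prod f1 f1 / (1 - r))"
    proof -
      have "\<bar>c1.inner_prod u ((c1.step ^^ n) f1)\<bar> \<le> c1.inner_prod f1 f1 / (1 - r)"
        unfolding u_def c1.inner_prod_resolvent_sum_iterate[OF f1] using r
        by (intro c1.weighted_autocovariance_bound f1) auto
      then have "- (c1.inner_prod f1 f1 / (1 - r)) \<le> c1.inner_prod u ((c1.step ^^ n) f1)" by (simp add: abs_le_iff)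
      from mult_left_mono[OF this, of "r ^ n"] show ?thesis
        using c1.resolvent_form_resolvent_sum[OF u f1, of r n] r by (simp add: u_def)
    qed
    have vv: "c2.resolvent_form r v v \<le> c2.inner_prod v f2 + r ^ n * (c2.inner_prod f2 f2 / (1 - r))"
    proof -
      have "\<bar>c2.inner_prod v ((c2.step ^^ n) f2)\<bar> \<le> c2.inner_prod f2 f2 / (1 - r)"
        unfolding v_def c2.inner_prod_resolvent_sum_iterate[OF f2] using r
        by (intro c2.weighted_autocovariance_bound f2) auto
      then have "- (c2.inner_prod f2 f2 / (1 - r)) \<le> c2.inner_prod v ((c2.step ^^ n) f2)" by (simp add: abs_le_iff)
      from mult_left_mono[OF this, of "r ^ n"] show ?thesis
        using c2.resolvent_form_resolvent_sum[OF v f2, of r n] r by (simp add: v_def)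
    qed
    have gv: "c1.inner_prod u f1 - r ^ n * ((c1.inner_prod f1 f1 / (1 - r) / (1 - r) + c2.inner_prod f2 f2) / 2)
        \<le> c2.resolvent_form r g v"
    proof -
      have "\<bar>c2.inner_prod g ((c2.step ^^ n) f2)\<bar> \<le>
          (c2.inner_prod g g + c2.inner_prod ((c2.step ^^ n) f2) ((c2.step ^^ n) f2)) / 2"
        by (rule c2.inner_prod_le_half[OF g c2.iterate_L2[OF f2]])
      also have "c2.inner_prod ((c2.step ^^ n) f2) ((c2.step ^^ n) f2) \<le> c2.inner_prod f2 f2"
        unfolding c2.inner_iterates[OF f2 f2] c2.autocovariance_def[symmetric]
        using c2.abs_autocovariance_le[OF f2, of "n + n"] by simp
      also have "c2.inner_prod g g \<le> c1.inner_prod f1 f1 / (1 - r) / (1 - r)"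
        unfolding gg u_def using r by (intro c1.inner_prod_resolvent_sum_self_le f1) auto
      finally have "c2.inner_prod g ((c2.step ^^ n) f2) \<le>
        (c1.inner_prod f1 f1 / (1 - r) / (1 - r) + c2.inner_prod f2 f2) / 2" by (simp add: abs_le_iff)
      from mult_left_mono[OF this, of "r ^ n"] show ?thesis
        using c2.resolvent_form_resolvent_sum[OF g f2, of r n] r gf by (simp add: v_def)
    qed
    have gu: "c2.resolvent_form r g g \<le> C * c1.resolvent_form r u u"
    proof -
      \<comment> \<open>Norms are preserved by the transfer and only the Dirichlet form gains the
        factor \<open>C\<close>, so \<open>1 \<le> C\<close> is what lets both parts share
        it.\<close>
      have "(1 - r) * c2.inner_prod g g \<le> C * ((1 - r) * c1.inner_prod u u)"
        using C r c1.inner_self_nonneg[of u] mult_right_mono[of 1 C "(1 - r) * c1.inner_prod u u"] by (simp add: gg)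
      moreover have "r / 2 * (\<integral>z. (g (fst z) - g (snd z))\<^sup>2 \<partial>c2.joint) \<le>
          C * (r / 2 * (\<integral>z. (u (fst z) - u (snd z))\<^sup>2 \<partial>c1.joint))"
        using mult_left_mono[OF gd, of "r / 2"] r by (simp add: mult.left_commute)
      ultimately show ?thesis
        unfolding c1.resolvent_form_eq_dirichlet[OF u] c2.resolvent_form_eq_dirichlet[OF g]
        by (simp add: distrib_left)
    qed
    \<comment> \<open>Up to remainders, expanding this square yields
      \<open>0 \<le> C * <u, f1> - 2 * C * <u, f1> + C^2 * <v, f2>\<close>. The multiple
      \<open>C\<close> of \<open>v\<close> is chosen so that this is
      \<open><u, f1> \<le> C * <v, f2>\<close> after division by \<open>C\<close>.\<close>
    have "0 \<le> c2.resolvent_form r (\<lambda>x. g x - C * v x) (\<lambda>x. g x - C * v x)"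
      using r by (intro c2.resolvent_form_nonneg L2_diff L2_cmult g v) auto
    also have "\<dots> = c2.resolvent_form r g g - 2 * C * c2.resolvent_form r g v + C\<^sup>2 * c2.resolvent_form r v v"
      by (rule c2.resolvent_form_diff[OF g v])
    finally have "2 * (C * c2.resolvent_form r g v) \<le> C * c1.resolvent_form r u u + C\<^sup>2 * c2.resolvent_form r v v"
      using gu by simp
    note key = this
    have arith: "C * c1.inner_prod u f1 \<le> C\<^sup>2 * c2.inner_prod v f2 + r ^ n * (C * y + C\<^sup>2 * z + C * x)"
      if "2 * (C * c2.resolvent_form r g v) \<le> C * c1.resolvent_form r u u + C\<^sup>2 * c2.resolvent_form r v v"
        "C * (c1.inner_prod u f1 - r ^ n * (x / 2)) \<le> C * c2.resolvent_form r g v"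
        "C * c1.resolvent_form r u u \<le> C * (c1.inner_prod u f1 + r ^ n * y)"
        "C\<^sup>2 * c2.resolvent_form r v v \<le> C\<^sup>2 * (c2.inner_prod v f2 + r ^ n * z)" for x y z
      using that by (simp add: algebra_simps)
    have C0: "0 \<le> C" using C by simp
    show ?thesis
      unfolding uf[symmetric] vf[symmetric] B_def
      by (rule arith[OF key mult_left_mono[OF gv C0] mult_left_mono[OF uu C0] mult_left_mono[OF vv zero_le_power2]])
  qed
  have a1: "autocov (c1.autocovariance f1)" by (rule c1.autocov_autocovariance[OF f1])
  have a2: "autocov (c2.autocovariance f2)" by (rule c2.autocov_autocovariance[OF f2])
  have "(\<lambda>n. C * (\<Sum>k<n. r ^ k * c1.autocovariance f1 k)) \<longlonglongrightarrow> C * (\<Sum>k. r ^ k * c1.autocovariance f1 k)"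
    using r by (intro tendsto_intros summable_LIMSEQ autocov.abel_summable[OF a1]) auto
  moreover have "(\<lambda>n. C\<^sup>2 * (\<Sum>k<n. r ^ k * c2.autocovariance f2 k) + r ^ n * B) \<longlonglongrightarrow>
      C\<^sup>2 * (\<Sum>k. r ^ k * c2.autocovariance f2 k) + 0 * B"
    using r by (intro tendsto_intros summable_LIMSEQ autocov.abel_summable[OF a2] LIMSEQ_realpow_zero) auto
  ultimately have "C * (\<Sum>k. r ^ k * c1.autocovariance f1 k) \<le> C\<^sup>2 * (\<Sum>k. r ^ k * c2.autocovariance f2 k) + 0 * B"
    by (rule LIMSEQ_le) (use partial in blast)
  then have "C * (\<Sum>k. r ^ k * c1.autocovariance f1 k) \<le> C * (C * (\<Sum>k. r ^ k * c2.autocovariance f2 k))"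
    by (simp add: power2_eq_square mult.assoc)
  then show ?thesis using C by simp
qed

text \<open>At odd lag the autocovariance is the quadratic form of \<open>step\<close> at the
  iterate halfway, which is where nonnegative definiteness enters; at even lag it is a squared
  norm.\<close>

lemma (in reversible_chain) autocovariance_nonneg:
  assumes "nonneg_definite H \<mu>" "f \<in> L2 \<mu>"
  shows "0 \<le> autocovariance f k"
proof (cases "even k")
  case True
  then show ?thesis
    using autocov.even_nonneg[OF autocov_autocovariance[OF assms(2)], of "k div 2"] by simp
next
  case False
  define g where "g = (step ^^ (k div 2)) f"
  have "autocovariance f k = inner_prod g (step g)"
  proof -
    have "k div 2 + Suc (k div 2) = k" using False by presburger
    then show ?thesis
      using inner_iterates[OF assms(2) assms(2), of "k div 2" "Suc (k div 2)"]
      by (simp only: g_def autocovariance_def funpow.simps comp_apply)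
  qed
  also have "\<dots> \<ge> 0"
    using assms(1) iterate_L2[OF assms(2), of "k div 2"]
    by (simp add: nonneg_definite_def inner_prod_def step_def g_def)
  finally show ?thesis .
qed

text \<open>Reduction to centred functions. Centring subtracts a multiple of the constant function,
  so a transfer that preserves means also preserves pairings with the centred functions. Equal means
  and equal squares make the two autocovariances at lag 0 agree.\<close>

lemma asymptotic_variance_le:
  assumes "reversible_chain \<mu>1 H1" "reversible_chain \<mu>2 H2"
    and f1: "f1 \<in> L2 \<mu>1" and f2: "f2 \<in> L2 \<mu>2" and C: "1 \<le> C"
    and mean: "(\<integral>x. f2 x \<partial>\<mu>2) = (\<integral>x. f1 x \<partial>\<mu>1)"
    and square: "(\<integral>x. f2 x * f2 x \<partial>\<mu>2) = (\<integral>x. f1 x * f1 x \<partial>\<mu>1)"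
    and nonneg: "nonneg_definite H2 \<mu>2"
    and transfer: "\<And>g. g \<in> L2 \<mu>1 \<Longrightarrow> \<exists>g'\<in>L2 \<mu>2. (\<integral>x. g' x \<partial>\<mu>2) = (\<integral>x. g x \<partial>\<mu>1) \<and>
      (\<integral>x. g' x * g' x \<partial>\<mu>2) = (\<integral>x. g x * g x \<partial>\<mu>1) \<and> (\<integral>x. g' x * f2 x \<partial>\<mu>2) = (\<integral>x. g x * f1 x \<partial>\<mu>1) \<and>
      (\<integral>z. (g' (fst z) - g' (snd z))\<^sup>2 \<partial>kernel_pair \<mu>2 H2 \<mu>2) \<le>
        C * (\<integral>z. (g (fst z) - g (snd z))\<^sup>2 \<partial>kernel_pair \<mu>1 H1 \<mu>1)"
  shows "asymptotic_variance f1 H1 \<mu>1 \<le> ereal (2 * C - 1) * asymptotic_variance f2 H2 \<mu>2"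
proof -
  interpret c1: reversible_chain \<mu>1 H1 by fact
  interpret c2: reversible_chain \<mu>2 H2 by fact
  define m where "m = c1.expectation f1"
  have m2: "c2.expectation f2 = m" using mean by (simp add: m_def)
  define h1 where "h1 x = f1 x - m" for x
  define h2 where "h2 x = f2 x - m" for x
  have h1: "h1 \<in> L2 \<mu>1" unfolding h1_def[abs_def] by (intro L2_diff f1 c1.L2_const)
  have h2: "h2 \<in> L2 \<mu>2" unfolding h2_def[abs_def] by (intro L2_diff f2 c2.L2_const)
  have p1: "(\<integral>x. g x * h1 x \<partial>\<mu>1) = (\<integral>x. g x * f1 x \<partial>\<mu>1) - m * (\<integral>x. g x \<partial>\<mu>1)" if "g \<in> L2 \<mu>1" for g
    using c1.inner_prod_diff[OF that f1 c1.L2_const[of 1], of m] by (simp add: c1.inner_prod_def h1_def)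
  have p2: "(\<integral>x. g x * h2 x \<partial>\<mu>2) = (\<integral>x. g x * f2 x \<partial>\<mu>2) - m * (\<integral>x. g x \<partial>\<mu>2)" if "g \<in> L2 \<mu>2" for g
    using c2.inner_prod_diff[OF that f2 c2.L2_const[of 1], of m] by (simp add: c2.inner_prod_def h2_def)
  have i1: "(\<integral>x. h1 x \<partial>\<mu>1) = 0" and i2: "(\<integral>x. h2 x \<partial>\<mu>2) = 0"
    using c1.L2_integrable[OF f1] c2.L2_integrable[OF f2]
    by (simp_all add: h1_def h2_def m2 c1.prob_space c2.prob_space) (simp add: m_def)
  have "(\<integral>x. h1 x * h1 x \<partial>\<mu>1) = (\<integral>x. f1 x * f1 x \<partial>\<mu>1) - m * m"
    unfolding p1[OF h1] i1 using p1[OF f1] by (simp add: mult.commute[of "h1 _"] m_def)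
  moreover have "(\<integral>x. h2 x * h2 x \<partial>\<mu>2) = (\<integral>x. f2 x * f2 x \<partial>\<mu>2) - m * m"
    unfolding p2[OF h2] i2 using p2[OF f2] by (simp add: mult.commute[of "h2 _"] m2)
  ultimately have start: "c1.autocovariance h1 0 = c2.autocovariance h2 0"
    using square by (simp add: c1.autocovariance_def c2.autocovariance_def c1.inner_prod_def c2.inner_prod_def)
  have tr: "\<exists>g'\<in>L2 \<mu>2.
      (\<integral>x. g' x * g' x \<partial>\<mu>2) = (\<integral>x. g x * g x \<partial>\<mu>1) \<and> (\<integral>x. g' x * h2 x \<partial>\<mu>2) = (\<integral>x. g x * h1 x \<partial>\<mu>1) \<and>
      (\<integral>z. (g' (fst z) - g' (snd z))\<^sup>2 \<partial>kernel_pair \<mu>2 H2 \<mu>2) \<le>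
        C * (\<integral>z. (g (fst z) - g (snd z))\<^sup>2 \<partial>kernel_pair \<mu>1 H1 \<mu>1)" if gL: "g \<in> L2 \<mu>1" for g
  proof -
    obtain g' where "g' \<in> L2 \<mu>2" "(\<integral>x. g' x \<partial>\<mu>2) = (\<integral>x. g x \<partial>\<mu>1)"
      "(\<integral>x. g' x * g' x \<partial>\<mu>2) = (\<integral>x. g x * g x \<partial>\<mu>1)" "(\<integral>x. g' x * f2 x \<partial>\<mu>2) = (\<integral>x. g x * f1 x \<partial>\<mu>1)"
      "(\<integral>z. (g' (fst z) - g' (snd z))\<^sup>2 \<partial>kernel_pair \<mu>2 H2 \<mu>2) \<le>
        C * (\<integral>z. (g (fst z) - g (snd z))\<^sup>2 \<partial>kernel_pair \<mu>1 H1 \<mu>1)"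
      using transfer[OF gL] by blast
    then show ?thesis
      by (intro bexI[of _ g'] conjI) (simp_all only: p1[OF gL] p2)
  qed
  show ?thesis
    unfolding c1.asymptotic_variance_eq[OF f1] c2.asymptotic_variance_eq[OF f2] m2 m_def[symmetric]
    unfolding h1_def[symmetric, abs_def] h2_def[symmetric, abs_def]
    by (rule lim_autocov_avg_le[OF c1.autocov_autocovariance[OF h1] c2.autocov_autocovariance[OF h2]
          c2.autocovariance_nonneg[OF nonneg h2] start C
          abel_autocovariance_le[OF assms(1,2) h1 h2 C _ _ tr]])
qed

section \<open>The ABC-MCMC kernel\<close>

lemma density_kernel_measurable:
  assumes "sigma_finite_measure S" and f[measurable]: "(\<lambda>(x, y). f x y) \<in> borel_measurable (N \<Otimes>\<^sub>M S)"
    and one: "\<And>x. x \<in> space N \<Longrightarrow> (\<integral>\<^sup>+y. f x y \<partial>S) = 1"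
  shows "(\<lambda>x. density S (f x)) \<in> N \<rightarrow>\<^sub>M prob_algebra S"
proof -
  interpret S: sigma_finite_measure S by fact
  have fx[measurable]: "f x \<in> borel_measurable S" if "x \<in> space N" for x
    using measurable_Pair2[OF f that] by simp
  have prob: "prob_space (density S (f x))" if "x \<in> space N" for x
    using one[OF that] fx[OF that] by (intro prob_spaceI) (simp add: emeasure_density cong: nn_integral_cong)
  show ?thesis
  proof (intro measurable_prob_algebraI prob measurable_subprob_algebra prob_space_imp_subprob_space)
    fix A assume [measurable]: "A \<in> sets S"
    have "(\<lambda>x. \<integral>\<^sup>+y. f x y * indicator A y \<partial>S) \<in> borel_measurable N"
      by (rule S.borel_measurable_nn_integral) measurable
    then show "(\<lambda>x. emeasure (density S (f x)) A) \<in> borel_measurable N"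
      by (rule measurable_cong[THEN iffD1, rotated]) (simp add: emeasure_density fx)
  qed simp_all
qed

text \<open>Rectangles generate the product sigma-algebra and are stable under intersection; on a
  rectangle the product measure is a finite product of measurable functions of
  \<open>x\<close>.\<close>

lemma PiM_kernel_measurable:
  assumes K[measurable]: "K \<in> N \<rightarrow>\<^sub>M prob_algebra S" and "finite I"
  shows "(\<lambda>x. PiM I (\<lambda>_. K x)) \<in> N \<rightarrow>\<^sub>M prob_algebra (PiM I (\<lambda>_. S))"
proof -
  have K': "prob_space (K x)" "sets (K x) = sets S" if "x \<in> space N" for x
    using measurable_space[OF K that] by (auto simp: space_prob_algebra)
  show ?thesis
  proof (rule measurable_prob_algebra_generated[where \<Omega> = "\<Pi>\<^sub>E i\<in>I. space S" and G = "prod_algebra I (\<lambda>_. S)"])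
    show "sets (PiM I (\<lambda>_. S)) = sigma_sets (\<Pi>\<^sub>E i\<in>I. space S) (prod_algebra I (\<lambda>_. S))"
      by (rule sets_PiM)
    show "Int_stable (prod_algebra I (\<lambda>_. S))"
      by (rule Int_stable_prod_algebra)
    show "prod_algebra I (\<lambda>_. S) \<subseteq> Pow (\<Pi>\<^sub>E i\<in>I. space S)"
      by (rule prod_algebra_sets_into_space)
    fix x assume x: "x \<in> space N"
    show "prob_space (PiM I (\<lambda>_. K x))" by (rule prob_space_PiM) (rule K'(1)[OF x])
    show "sets (PiM I (\<lambda>_. K x)) = sets (PiM I (\<lambda>_. S))"
      by (rule sets_PiM_cong) (simp_all add: K'(2)[OF x])
  next
    fix A assume "A \<in> prod_algebra I (\<lambda>_. S)"
    then obtain E where A: "A = Pi\<^sub>E I E" and E[measurable]: "\<And>i. i \<in> I \<Longrightarrow> E i \<in> sets S"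
      unfolding prod_algebra_eq_finite[OF assms(2)] by auto
    have eq: "emeasure (PiM I (\<lambda>_. K x)) A = (\<Prod>i\<in>I. emeasure (K x) (E i))" if x: "x \<in> space N" for x
    proof -
      interpret product_sigma_finite "\<lambda>_. K x"
        using K'(1)[OF x] by (intro product_sigma_finite.intro prob_space_imp_sigma_finite)
      show ?thesis unfolding A using E K'(2)[OF x] assms(2) by (intro emeasure_PiM) auto
    qed
    have "(\<lambda>x. \<Prod>i\<in>I. emeasure (K x) (E i)) \<in> borel_measurable N"
      by (intro borel_measurable_prod_ennreal measurable_emeasure_kernel[OF measurable_prob_algebraD[OF K]] E)
    then show "(\<lambda>x. emeasure (PiM I (\<lambda>_. K x)) A) \<in> borel_measurable N"
      by (rule measurable_cong[THEN iffD1, rotated]) (simp add: eq)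
  qed
qed

lemma bernoulli_kernel_measurable:
  assumes [measurable]: "a \<in> borel_measurable N" and a: "\<And>x. x \<in> space N \<Longrightarrow> 0 \<le> a x \<and> a x \<le> 1"
  shows "(\<lambda>x. measure_pmf (bernoulli_pmf (a x))) \<in> N \<rightarrow>\<^sub>M prob_algebra (count_space UNIV)"
proof (intro measurable_prob_algebraI measurable_subprob_algebra prob_space_imp_subprob_space prob_space_measure_pmf)
  fix A :: "bool set"
  have "emeasure (measure_pmf (bernoulli_pmf (a x))) A =
      indicator A True * ennreal (a x) + indicator A False * ennreal (1 - a x)" if "x \<in> space N" for x
    using nn_integral_bernoulli_pmf[of "a x" "indicator A"] a[OF that] by simp
  moreover have "(\<lambda>x. indicator A True * ennreal (a x) + indicator A False * ennreal (1 - a x)) \<in> borel_measurable N"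
    by measurable
  ultimately show "(\<lambda>x. emeasure (measure_pmf (bernoulli_pmf (a x))) A) \<in> borel_measurable N"
    by (subst measurable_cong) auto
qed simp

section \<open>Pseudo-samples, weights and unbiasedness\<close>

context abc_model
begin

sublocale par: sigma_finite_measure \<Theta> by (rule sigma_finite_\<Theta>)
sublocale dat: sigma_finite_measure Y by (rule sigma_finite_Y)

declare prior_measurable[measurable] \<eta>_measurable[measurable] K_measurable[measurable]

abbreviation weights :: "real measure" where "weights \<equiv> restrict_space borel {0..}"

definition data_law :: "'a \<Rightarrow> 'b measure" where
  "data_law \<theta> = density Y (\<lambda>y. ennreal (p y \<theta>))"

definition proposal :: "'a \<Rightarrow> 'a measure" where
  "proposal \<theta> = density \<Theta> (\<lambda>\<theta>'. ennreal (q \<theta>' \<theta>))"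

definition match :: "'b \<Rightarrow> real" where
  "match y = K (\<eta> y_obs - \<eta> y)"

definition mean_match :: "nat \<Rightarrow> (nat \<Rightarrow> 'b) \<Rightarrow> real" where
  "mean_match M y = (1 / real M) * (\<Sum>i<M. match (y i))"

text \<open>Valued in \<open>ennreal\<close>, as for a general kernel function it may be infinite at
  some parameters. For an indicator kernel it is the probability that one pseudo-sample is
  accepted.\<close>

definition match_prob :: "'a \<Rightarrow> ennreal" where
  "match_prob \<theta> = (\<integral>\<^sup>+y. ennreal (K (\<eta> y_obs - \<eta> y)) * ennreal (p y \<theta>) \<partial>Y)"

lemma measurable_p[measurable (raw)]:
  "f \<in> N \<rightarrow>\<^sub>M Y \<Longrightarrow> g \<in> N \<rightarrow>\<^sub>M \<Theta> \<Longrightarrow> (\<lambda>x. p (f x) (g x)) \<in> borel_measurable N"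
  using measurable_compose[OF measurable_Pair p_measurable, of g N f] by simp

lemma measurable_q[measurable (raw)]:
  "f \<in> N \<rightarrow>\<^sub>M \<Theta> \<Longrightarrow> g \<in> N \<rightarrow>\<^sub>M \<Theta> \<Longrightarrow> (\<lambda>x. q (f x) (g x)) \<in> borel_measurable N"
  using measurable_compose[OF measurable_Pair q_measurable, of g N f] by simp

lemma match_measurable[measurable]: "match \<in> borel_measurable Y"
proof -
  have "(\<lambda>z. \<eta> y_obs - z) \<in> borel_measurable borel"
    by (intro borel_measurable_continuous_onI continuous_intros)
  from measurable_compose[OF measurable_compose[OF \<eta>_measurable this] K_measurable]
  show ?thesis unfolding match_def[abs_def] .
qed

lemma match_nonneg: "0 \<le> match y"
  by (simp add: match_def K_nonneg)

lemma mean_match_nonneg: "0 \<le> mean_match M y"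
  by (simp add: mean_match_def sum_nonneg match_nonneg)

lemma mean_match_measurable[measurable]: "mean_match M \<in> borel_measurable (PiM {..<M} (\<lambda>_. Y))"
  unfolding mean_match_def[abs_def] by measurable

lemma match_prob_measurable[measurable]: "match_prob \<in> borel_measurable \<Theta>"
  unfolding match_prob_def[abs_def] match_def[symmetric] by measurable

lemma data_law_kernel[measurable]: "data_law \<in> \<Theta> \<rightarrow>\<^sub>M prob_algebra Y"
  unfolding data_law_def[abs_def] by (rule density_kernel_measurable[OF sigma_finite_Y _ p_density]) measurable

lemma proposal_kernel[measurable]: "proposal \<in> \<Theta> \<rightarrow>\<^sub>M prob_algebra \<Theta>"
  unfolding proposal_def[abs_def] by (rule density_kernel_measurable[OF sigma_finite_\<Theta> _ q_density]) measurable

lemma samples_kernel[measurable]: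
  "(\<lambda>\<theta>. PiM {..<M} (\<lambda>_. data_law \<theta>)) \<in> \<Theta> \<rightarrow>\<^sub>M prob_algebra (PiM {..<M} (\<lambda>_. Y))" for M :: nat
  by (rule PiM_kernel_measurable) simp_all

lemma sets_samples: "\<theta> \<in> space \<Theta> \<Longrightarrow> sets (PiM {..<M::nat} (\<lambda>_. data_law \<theta>)) = sets (PiM {..<M} (\<lambda>_. Y))"
  by (rule sets_PiM_cong) (simp_all add: data_law_def)

lemma T_law_eq: "T_law M \<theta> = distr (PiM {..<M} (\<lambda>_. data_law \<theta>)) weights (\<lambda>y. prior \<theta> * mean_match M y)"
  by (simp add: T_law_def data_law_def mean_match_def match_def)

lemma measurable_weightsI:
  "f \<in> borel_measurable N \<Longrightarrow> (\<And>x. x \<in> space N \<Longrightarrow> 0 \<le> f x) \<Longrightarrow> f \<in> N \<rightarrow>\<^sub>M weights"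
  by (intro measurable_restrict_space2) auto

lemma weights_measurableD[measurable (raw)]: "f \<in> N \<rightarrow>\<^sub>M weights \<Longrightarrow> f \<in> borel_measurable N"
  by (simp add: measurable_restrict_space2_iff)

lemma T_law_kernel[measurable]: "T_law M \<in> \<Theta> \<rightarrow>\<^sub>M prob_algebra weights"
  unfolding T_law_eq[abs_def]
proof (rule measurable_distr_prob_space2[OF samples_kernel])
  show "(\<lambda>(\<theta>, y). prior \<theta> * mean_match M y) \<in> \<Theta> \<Otimes>\<^sub>M PiM {..<M} (\<lambda>_. Y) \<rightarrow>\<^sub>M weights"
    by (rule measurable_weightsI) (auto simp: space_pair_measure prior_nonneg mean_match_nonneg)
qed

lemma nn_integral_T_law:
  assumes "\<theta> \<in> space \<Theta>" and [measurable]: "F \<in> borel_measurable weights"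
  shows "(\<integral>\<^sup>+t. F t \<partial>T_law M \<theta>) = (\<integral>\<^sup>+y. F (prior \<theta> * mean_match M y) \<partial>PiM {..<M} (\<lambda>_. data_law \<theta>))"
  unfolding T_law_eq
proof (rule nn_integral_distr)
  have "(\<lambda>y. prior \<theta> * mean_match M y) \<in> PiM {..<M} (\<lambda>_. Y) \<rightarrow>\<^sub>M weights"
    using assms(1) by (intro measurable_weightsI) (auto simp: prior_nonneg mean_match_nonneg)
  then show "(\<lambda>y. prior \<theta> * mean_match M y) \<in> PiM {..<M} (\<lambda>_. data_law \<theta>) \<rightarrow>\<^sub>M weights"
    using measurable_cong_sets[OF sets_samples[OF assms(1)] refl] by blast
qed simp

lemma space_parameters: "space \<Theta> \<noteq> {}"
proof
  assume "space \<Theta> = {}"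
  then show False using target_normalizable(1) by (simp add: nn_integral_empty)
qed

text \<open>Each sample has law \<open>data_law \<theta>\<close> and an average of identically
  distributed terms has the common mean. This unbiasedness is why neither the normalizing constant
  nor the parameter marginal depends on \<open>M\<close>.\<close>

lemma nn_integral_mean_match:
  assumes "\<theta> \<in> space \<Theta>" "1 \<le> M"
  shows "(\<integral>\<^sup>+y. ennreal (mean_match M y) \<partial>PiM {..<M} (\<lambda>_. data_law \<theta>)) = match_prob \<theta>"
proof -
  have pr: "prob_space (data_law \<theta>)" using measurable_space[OF data_law_kernel assms(1)] by (simp add: space_prob_algebra)
  interpret product_prob_space "\<lambda>_. data_law \<theta>" "{..<M}"
    by (rule product_prob_spaceI) (rule pr)
  have p_meas: "(\<lambda>y. ennreal (p y \<theta>)) \<in> borel_measurable Y"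
    using measurable_Pair2[OF p_measurable assms(1)] by simp
  have c: "(\<lambda>y. ennreal (match (y i))) \<in> borel_measurable (PiM {..<M} (\<lambda>_. data_law \<theta>))" if "i < M" for i
    using that by (intro measurable_compose[OF measurable_component_singleton]) (auto simp: data_law_def)
  have one: "(\<integral>\<^sup>+y. ennreal (match (y i)) \<partial>PiM {..<M} (\<lambda>_. data_law \<theta>)) = match_prob \<theta>" if "i < M" for i
  proof -
    have "(\<integral>\<^sup>+y. ennreal (match (y i)) \<partial>PiM {..<M} (\<lambda>_. data_law \<theta>)) =
        (\<integral>\<^sup>+y. ennreal (match y) \<partial>distr (PiM {..<M} (\<lambda>_. data_law \<theta>)) (data_law \<theta>) (\<lambda>y. y i))"
      by (rule nn_integral_distr[symmetric]) (use that in \<open>auto simp: data_law_def\<close>)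
    also have "\<dots> = (\<integral>\<^sup>+y. ennreal (match y) \<partial>data_law \<theta>)"
      using PiM_component[of i] that by simp
    also have "\<dots> = match_prob \<theta>"
      unfolding data_law_def match_prob_def match_def[symmetric]
      by (subst nn_integral_density[OF p_meas]) (simp_all add: mult.commute)
    finally show ?thesis .
  qed
  have "(\<integral>\<^sup>+y. ennreal (mean_match M y) \<partial>PiM {..<M} (\<lambda>_. data_law \<theta>)) =
      (\<integral>\<^sup>+y. ennreal (1 / real M) * (\<Sum>i<M. ennreal (match (y i))) \<partial>PiM {..<M} (\<lambda>_. data_law \<theta>))"
    by (intro nn_integral_cong) (simp add: mean_match_def ennreal_mult'[symmetric] sum_nonneg match_nonneg)
  also have "\<dots> = ennreal (1 / real M) * (\<Sum>i<M. match_prob \<theta>)"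
    using c one by (subst nn_integral_cmult, simp, subst nn_integral_sum) simp_all
  also have "\<dots> = ennreal (1 / real M) * (ennreal (real M) * match_prob \<theta>)" by (simp add: ennreal_of_nat_eq_real_of_nat)
  also have "\<dots> = match_prob \<theta>"
    using assms(2) by (simp add: mult.assoc[symmetric] ennreal_mult'[symmetric])
  finally show ?thesis .
qed

lemma nn_integral_T_law_id:
  assumes "\<theta> \<in> space \<Theta>" "1 \<le> M"
  shows "(\<integral>\<^sup>+t. ennreal t \<partial>T_law M \<theta>) = ennreal (prior \<theta>) * match_prob \<theta>"
  using assms nn_integral_mean_match[OF assms]
  by (simp add: nn_integral_T_law ennreal_mult' prior_nonneg nn_integral_cmult measurable_cong_sets[OF sets_samples refl])

sublocale weight_kernel: markov_kernel \<Theta> "T_law M" weights for M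
  by unfold_locales (simp_all add: space_parameters)

section \<open>Proposal, acceptance and the transition kernel\<close>

abbreviation base :: "nat \<Rightarrow> ('a \<times> real) measure" where
  "base M \<equiv> kernel_pair \<Theta> (T_law M) weights"

abbreviation states :: "('a \<times> real) measure" where "states \<equiv> \<Theta> \<Otimes>\<^sub>M weights"

lemma snd_states_measurable[measurable (raw)]:
  "f \<in> N \<rightarrow>\<^sub>M \<Theta> \<Otimes>\<^sub>M weights \<Longrightarrow> (\<lambda>x. snd (f x)) \<in> borel_measurable N"
  by (rule weights_measurableD) (rule measurable_compose[OF _ measurable_snd])

lemma weight_nonneg: "x \<in> space states \<Longrightarrow> 0 \<le> snd x"
  by (auto simp: space_pair_measure)

lemma fst_space: "x \<in> space states \<Longrightarrow> fst x \<in> space \<Theta>"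
  by (auto simp: space_pair_measure)

text \<open>The density, with respect to two copies of \<open>base M\<close>, of the accepted moves
  of the chain started from its unnormalised stationary measure.\<close>

definition flow :: "'a \<times> real \<Rightarrow> 'a \<times> real \<Rightarrow> real" where
  "flow x x' = min (snd x * q (fst x') (fst x)) (snd x' * q (fst x) (fst x'))"

lemma flow_commute: "flow x x' = flow x' x"
  by (simp add: flow_def min.commute)

lemma flow_measurable[measurable]: "(\<lambda>z. flow (fst z) (snd z)) \<in> borel_measurable (states \<Otimes>\<^sub>M states)"
  unfolding flow_def by measurable

lemma accept_prob_measurable[measurable]:
  "(\<lambda>z. accept_prob (fst z) (snd z)) \<in> borel_measurable (states \<Otimes>\<^sub>M states)"
  unfolding accept_prob_def case_prod_beta' by measurable

lemma accept_prob_bounds: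
  assumes "x \<in> space states" "x' \<in> space states"
  shows "0 \<le> accept_prob x x'" "accept_prob x x' \<le> 1"
  using assms weight_nonneg[of x] weight_nonneg[of x'] q_nonneg[OF fst_space fst_space] 
  by (auto simp: accept_prob_def case_prod_beta')

text \<open>The convention that a zero denominator means acceptance is consistent: both sides are
  then 0, the minimum being taken with a nonnegative number.\<close>

lemma accept_prob_flow:
  assumes "x \<in> space states" "x' \<in> space states"
  shows "snd x * (q (fst x') (fst x) * accept_prob x x') = flow x x'"
proof -
  have "0 \<le> snd x * q (fst x') (fst x)" "0 \<le> snd x' * q (fst x) (fst x')"
    using assms weight_nonneg[of x] weight_nonneg[of x'] q_nonneg[OF fst_space fst_space] by auto
  moreover have "a * (if a = 0 then 1 else min 1 (b / a)) = min a b" if "0 \<le> a" "0 \<le> b" for a b :: real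
    using that by (auto simp: min_def field_simps)
  ultimately show ?thesis
    unfolding flow_def accept_prob_def case_prod_beta' mult.assoc[symmetric] by metis
qed

lemma propose_kernel[measurable]: "propose M \<in> \<Theta> \<rightarrow>\<^sub>M prob_algebra states"
  unfolding propose_def[abs_def] state_space_def proposal_def[symmetric]
  by (rule measurable_bind_prob_space[OF proposal_kernel weight_kernel.measurable_pair_kernel])

lemma nn_integral_propose:
  assumes \<theta>: "\<theta> \<in> space \<Theta>" and F[measurable]: "F \<in> borel_measurable states"
  shows "(\<integral>\<^sup>+x'. F x' \<partial>propose M \<theta>) = (\<integral>\<^sup>+x'. ennreal (q (fst x') \<theta>) * F x' \<partial>base M)"
proof -
  have [measurable]: "(\<lambda>x'. ennreal (q (fst x') \<theta>)) \<in> borel_measurable states"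
    using \<theta> by measurable
  have [measurable]: "(\<lambda>\<theta>'. \<integral>\<^sup>+t. F (\<theta>', t) \<partial>T_law M \<theta>') \<in> borel_measurable \<Theta>"
    by (rule nn_integral_measurable_subprob_algebra2[OF _ weight_kernel.K_subprob]) simp
  have k: "(\<lambda>\<theta>'. distr (T_law M \<theta>') states (\<lambda>T'. (\<theta>', T'))) \<in> density \<Theta> (\<lambda>\<theta>'. ennreal (q \<theta>' \<theta>)) \<rightarrow>\<^sub>M subprob_algebra states"
    using measurable_prob_algebraD[OF weight_kernel.measurable_pair_kernel[of M]] by simp
  have "(\<integral>\<^sup>+x'. F x' \<partial>propose M \<theta>) =
      (\<integral>\<^sup>+\<theta>'. \<integral>\<^sup>+x'. F x' \<partial>distr (T_law M \<theta>') states (\<lambda>T'. (\<theta>', T')) \<partial>density \<Theta> (\<lambda>\<theta>'. ennreal (q \<theta>' \<theta>)))"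
    unfolding propose_def state_space_def by (rule nn_integral_bind[OF F k])
  also have "\<dots> = (\<integral>\<^sup>+\<theta>'. \<integral>\<^sup>+t. F (\<theta>', t) \<partial>T_law M \<theta>' \<partial>density \<Theta> (\<lambda>\<theta>'. ennreal (q \<theta>' \<theta>)))"
    by (intro nn_integral_cong nn_integral_distr weight_kernel.measurable_Pair_K) simp_all
  also have "\<dots> = (\<integral>\<^sup>+\<theta>'. ennreal (q \<theta>' \<theta>) * (\<integral>\<^sup>+t. F (\<theta>', t) \<partial>T_law M \<theta>') \<partial>\<Theta>)"
    using \<theta> by (intro nn_integral_density) measurable
  also have "\<dots> = (\<integral>\<^sup>+\<theta>'. \<integral>\<^sup>+t. ennreal (q \<theta>' \<theta>) * F (\<theta>', t) \<partial>T_law M \<theta>' \<partial>\<Theta>)"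
    by (intro nn_integral_cong nn_integral_cmult[symmetric])
       (simp add: measurable_cong_sets[OF weight_kernel.sets_K refl])
  also have "\<dots> = (\<integral>\<^sup>+x'. ennreal (q (fst x') \<theta>) * F x' \<partial>base M)"
    by (subst weight_kernel.nn_integral_kernel_pair) simp_all
  finally show ?thesis .
qed

text \<open>Named so that it can be treated as a kernel jointly in both states, as measurability of
  the bind in \<open>Q\<close> over a varying \<open>x\<close> requires.\<close>

definition acceptance_step :: "'a \<times> real \<Rightarrow> 'a \<times> real \<Rightarrow> ('a \<times> real) measure" where
  "acceptance_step x x' = distr (measure_pmf (bernoulli_pmf (accept_prob x x'))) states (\<lambda>accept. if accept then x' else x)"

lemma acceptance_step_kernel[measurable]:
  "(\<lambda>(x, x'). acceptance_step x x') \<in> states \<Otimes>\<^sub>M states \<rightarrow>\<^sub>M prob_algebra states"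
  unfolding acceptance_step_def case_prod_beta'
proof (rule measurable_distr_prob_space2[where M = "count_space UNIV"])
  show "(\<lambda>z. measure_pmf (bernoulli_pmf (accept_prob (fst z) (snd z)))) \<in> states \<Otimes>\<^sub>M states \<rightarrow>\<^sub>M prob_algebra (count_space UNIV)"
    by (rule bernoulli_kernel_measurable) (auto simp: space_pair_measure intro!: accept_prob_bounds)
  show "(\<lambda>(z, accept). if accept then snd z else fst z) \<in> (states \<Otimes>\<^sub>M states) \<Otimes>\<^sub>M count_space UNIV \<rightarrow>\<^sub>M states"
    unfolding case_prod_beta' by measurable
qed

lemma Q_eq: "Q M x = propose M (fst x) \<bind> acceptance_step x"
  by (simp add: Q_def acceptance_step_def[abs_def] state_space_def)

lemma Q_kernel[measurable]: "Q M \<in> states \<rightarrow>\<^sub>M prob_algebra states"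
  unfolding Q_eq[abs_def]
  by (rule measurable_bind_prob_space2[where N = states]) measurable

lemma nn_integral_Q:
  assumes x: "x \<in> space states" and F[measurable]: "F \<in> borel_measurable states"
  shows "(\<integral>\<^sup>+y. F y \<partial>Q M x) =
    (\<integral>\<^sup>+x'. ennreal (accept_prob x x') * F x' + ennreal (1 - accept_prob x x') * F x \<partial>propose M (fst x))"
proof -
  have pr: "sets (propose M (fst x)) = sets states"
    using measurable_space[OF propose_kernel fst_space[OF x]] by (simp add: space_prob_algebra)
  have "acceptance_step x \<in> states \<rightarrow>\<^sub>M subprob_algebra states"
    using measurable_compose[OF measurable_Pair1'[OF x] measurable_prob_algebraD[OF acceptance_step_kernel]] by simp
  then have k: "acceptance_step x \<in> propose M (fst x) \<rightarrow>\<^sub>M subprob_algebra states"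
    using measurable_cong_sets[OF pr refl] by blast
  have "(\<integral>\<^sup>+y. F y \<partial>Q M x) = (\<integral>\<^sup>+x'. \<integral>\<^sup>+y. F y \<partial>acceptance_step x x' \<partial>propose M (fst x))"
    unfolding Q_eq by (rule nn_integral_bind[OF F k])
  also have "\<dots> = (\<integral>\<^sup>+x'. ennreal (accept_prob x x') * F x' + ennreal (1 - accept_prob x x') * F x \<partial>propose M (fst x))"
  proof (intro nn_integral_cong)
    fix x' assume "x' \<in> space (propose M (fst x))"
    then have x': "x' \<in> space states" using sets_eq_imp_space_eq[OF pr] by simp
    show "(\<integral>\<^sup>+y. F y \<partial>acceptance_step x x') = ennreal (accept_prob x x') * F x' + ennreal (1 - accept_prob x x') * F x"
      unfolding acceptance_step_def using x x' accept_prob_bounds[OF x x']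
      by (subst nn_integral_distr) (auto simp: nn_integral_bernoulli_pmf mult.commute)
  qed
  finally show ?thesis .
qed

text \<open>The fibres carry probability measures, so a cover of \<open>\<Theta>\<close> by sets of
  finite measure lifts to cylinders of the same measure. Exchanging the integrals over two copies of
  \<open>base M\<close> rests on this.\<close>

lemma sigma_finite_base: "sigma_finite_measure (base M)"
proof -
  obtain A :: "nat \<Rightarrow> 'a set" where A: "range A \<subseteq> sets \<Theta>" "(\<Union>i. A i) = space \<Theta>" "\<And>i. emeasure \<Theta> (A i) \<noteq> \<infinity>"
    using par.sigma_finite by metis
  have sets: "A i \<times> space weights \<in> sets states" for i
    using A(1) by (intro pair_measureI sets.top) auto
  have fin: "emeasure (base M) (A i \<times> space weights) \<noteq> \<infinity>" for i
  proof -
    have "emeasure (base M) (A i \<times> space weights) = (\<integral>\<^sup>+z. indicator (A i \<times> space weights) z \<partial>base M)"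
      using sets by simp
    also have "\<dots> = (\<integral>\<^sup>+\<theta>. \<integral>\<^sup>+t. indicator (A i \<times> space weights) (\<theta>, t) \<partial>T_law M \<theta> \<partial>\<Theta>)"
      using sets by (intro weight_kernel.nn_integral_kernel_pair) simp
    also have "\<dots> \<le> (\<integral>\<^sup>+\<theta>. \<integral>\<^sup>+t. indicator (A i) \<theta> \<partial>T_law M \<theta> \<partial>\<Theta>)"
      by (intro nn_integral_mono) (auto split: split_indicator)
    also have "\<dots> = (\<integral>\<^sup>+\<theta>. indicator (A i) \<theta> \<partial>\<Theta>)"
      by (intro nn_integral_cong) (simp add: prob_space.emeasure_space_1[OF weight_kernel.prob_space_K])
    also have "\<dots> = emeasure \<Theta> (A i)" using A(1) by (intro nn_integral_indicator) auto
    finally show ?thesis using A(3)[of i] by (auto simp: top_unique)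
  qed
  have "(\<Union>i. A i \<times> space weights) = space states"
    using A(2) by (auto simp: space_pair_measure)
  then show ?thesis
    using sets fin
    by (intro sigma_finite_measure.intro exI[of _ "range (\<lambda>i. A i \<times> space weights)"])
       (auto simp: weight_kernel.space_kernel_pair)
qed

sublocale base: sigma_finite_measure "base M" for M by (rule sigma_finite_base)

section \<open>Normalization and reversibility\<close>

definition total :: ennreal where
  "total = (\<integral>\<^sup>+\<theta>. ennreal (prior \<theta>) * match_prob \<theta> \<partial>\<Theta>)"

lemma total_pos: "0 < total" and total_finite: "total < \<infinity>"
  using target_normalizable by (simp_all add: total_def match_prob_def)

lemma nn_integral_base_weight:
  assumes "1 \<le> M" and [measurable]: "F \<in> borel_measurable \<Theta>"
  shows "(\<integral>\<^sup>+x. ennreal (snd x) * F (fst x) \<partial>base M) = (\<integral>\<^sup>+\<theta>. ennreal (prior \<theta>) * match_prob \<theta> * F \<theta> \<partial>\<Theta>)"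
proof -
  have "(\<integral>\<^sup>+x. ennreal (snd x) * F (fst x) \<partial>base M) = (\<integral>\<^sup>+\<theta>. \<integral>\<^sup>+t. ennreal t * F \<theta> \<partial>T_law M \<theta> \<partial>\<Theta>)"
    by (subst weight_kernel.nn_integral_kernel_pair; (measurable | simp))
  also have "\<dots> = (\<integral>\<^sup>+\<theta>. ennreal (prior \<theta>) * match_prob \<theta> * F \<theta> \<partial>\<Theta>)"
    using assms(1)
    by (intro nn_integral_cong, subst nn_integral_multc)
       (auto simp: nn_integral_T_law_id measurable_cong_sets[OF weight_kernel.sets_K refl] intro!: weights_measurableD)
  finally show ?thesis .
qed

lemma extended_target_eq: "extended_target M = normalize_measure (density (base M) (\<lambda>x. ennreal (snd x)))"
  by (simp add: extended_target_def kernel_pair_def state_space_def case_prod_beta')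

lemma sets_extended_target[simp, measurable_cong]: "sets (extended_target M) = sets states"
  by (simp add: extended_target_eq normalize_measure_def)

lemma space_extended_target: "space (extended_target M) = space states"
  by (rule sets_eq_imp_space_eq) simp

lemma nn_integral_extended_target:
  assumes M: "1 \<le> M" and [measurable]: "F \<in> borel_measurable states"
  shows "(\<integral>\<^sup>+x. F x \<partial>extended_target M) = (1 / total) * (\<integral>\<^sup>+x. ennreal (snd x) * F x \<partial>base M)"
proof -
  have Z: "emeasure (density (base M) (\<lambda>x. ennreal (snd x))) (space (density (base M) (\<lambda>x. ennreal (snd x)))) = total"
    using nn_integral_base_weight[OF M, of "\<lambda>_. 1"] sets.top[of "base M"]
    by (subst emeasure_density) (simp_all add: total_def cong: nn_integral_cong)
  show ?thesis
    unfolding extended_target_eq normalize_measure_def Z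
    by (subst nn_integral_scale_measure) (simp_all add: nn_integral_density)
qed

lemma inverse_total: "(1 / total) * total = 1"
  using total_pos total_finite by (simp add: ennreal_divide_times ennreal_divide_self)

lemma prob_space_extended_target: "1 \<le> M \<Longrightarrow> prob_space (extended_target M)"
  using nn_integral_extended_target[of M "\<lambda>_. 1"] nn_integral_base_weight[of M "\<lambda>_. 1"] inverse_total
  by (intro prob_spaceI) (simp add: total_def)

text \<open>The unnormalised stationary mass of rejections from \<open>x\<close>. An accepted
  proposal that happens to equal the current state is counted in \<open>flow\<close>
  instead.\<close>

definition stay :: "nat \<Rightarrow> 'a \<times> real \<Rightarrow> ennreal" where
  "stay M x = ennreal (snd x) * (\<integral>\<^sup>+x'. ennreal (1 - accept_prob x x') \<partial>propose M (fst x))"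

lemma stay_measurable[measurable]: "stay M \<in> borel_measurable states"
proof -
  have [measurable]: "(\<lambda>x. \<integral>\<^sup>+x'. ennreal (1 - accept_prob x x') \<partial>propose M (fst x)) \<in> borel_measurable states"
    by (rule nn_integral_measurable_subprob_algebra2[where N = states])
       (auto intro: measurable_prob_algebraD simp: case_prod_beta')
  show ?thesis unfolding stay_def[abs_def] by measurable
qed

text \<open>The stationary weight times proposal density times acceptance probability is the
  symmetric \<open>flow\<close>, and rejections sit on the diagonal. Reversibility and the Dirichlet
  form are both read off from this splitting.\<close>

lemma nn_integral_chain:
  assumes M: "1 \<le> M" and G[measurable]: "G \<in> borel_measurable (states \<Otimes>\<^sub>M states)"
  shows "(\<integral>\<^sup>+x. \<integral>\<^sup>+y. G (x, y) \<partial>Q M x \<partial>extended_target M) =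
    (1 / total) * ((\<integral>\<^sup>+x. \<integral>\<^sup>+x'. ennreal (flow x x') * G (x, x') \<partial>base M \<partial>base M) + (\<integral>\<^sup>+x. stay M x * G (x, x) \<partial>base M))"
proof -
  have Qm: "(\<lambda>x. \<integral>\<^sup>+y. G (x, y) \<partial>Q M x) \<in> borel_measurable states"
    by (rule nn_integral_measurable_subprob_algebra2[where N = states])
       (auto intro: measurable_prob_algebraD Q_kernel)
  have eq: "ennreal (snd x) * (\<integral>\<^sup>+y. G (x, y) \<partial>Q M x) =
      (\<integral>\<^sup>+x'. ennreal (flow x x') * G (x, x') \<partial>base M) + stay M x * G (x, x)" if x: "x \<in> space states" for x
  proof -
    have ps: "sets (propose M (fst x)) = sets states"
      using measurable_space[OF propose_kernel fst_space[OF x]] by (simp add: space_prob_algebra)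
    have [measurable]: "(\<lambda>y. G (x, y)) \<in> borel_measurable states" "(\<lambda>y. accept_prob x y) \<in> borel_measurable states"
      using measurable_compose[OF measurable_Pair1'[OF x] G] measurable_compose[OF measurable_Pair1'[OF x] accept_prob_measurable] by simp_all
    have [measurable]: "(\<lambda>x'. q (fst x') (fst x)) \<in> borel_measurable states"
      using fst_space[OF x] by measurable
    have "(\<integral>\<^sup>+y. G (x, y) \<partial>Q M x) =
        (\<integral>\<^sup>+x'. ennreal (accept_prob x x') * G (x, x') \<partial>propose M (fst x)) +
        (\<integral>\<^sup>+x'. ennreal (1 - accept_prob x x') * G (x, x) \<partial>propose M (fst x))"
      using ps by (subst nn_integral_Q[OF x], simp, subst nn_integral_add) (simp_all cong: measurable_cong_sets)
    also have "(\<integral>\<^sup>+x'. ennreal (1 - accept_prob x x') * G (x, x) \<partial>propose M (fst x)) =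
        (\<integral>\<^sup>+x'. ennreal (1 - accept_prob x x') \<partial>propose M (fst x)) * G (x, x)"
      using ps by (intro nn_integral_multc) (simp cong: measurable_cong_sets)
    also have "(\<integral>\<^sup>+x'. ennreal (accept_prob x x') * G (x, x') \<partial>propose M (fst x)) =
        (\<integral>\<^sup>+x'. ennreal (q (fst x') (fst x)) * (ennreal (accept_prob x x') * G (x, x')) \<partial>base M)"
      by (rule nn_integral_propose[OF fst_space[OF x]]) measurable
    finally have "ennreal (snd x) * (\<integral>\<^sup>+y. G (x, y) \<partial>Q M x) =
        ennreal (snd x) * (\<integral>\<^sup>+x'. ennreal (q (fst x') (fst x)) * (ennreal (accept_prob x x') * G (x, x')) \<partial>base M) + stay M x * G (x, x)"
      by (simp add: stay_def distrib_left mult.assoc)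
    also have "ennreal (snd x) * (\<integral>\<^sup>+x'. ennreal (q (fst x') (fst x)) * (ennreal (accept_prob x x') * G (x, x')) \<partial>base M) =
        (\<integral>\<^sup>+x'. ennreal (snd x) * (ennreal (q (fst x') (fst x)) * (ennreal (accept_prob x x') * G (x, x'))) \<partial>base M)"
      by (rule nn_integral_cmult[symmetric]) measurable
    also have "\<dots> = (\<integral>\<^sup>+x'. ennreal (flow x x') * G (x, x') \<partial>base M)"
    proof (intro nn_integral_cong)
      fix x' assume "x' \<in> space (base M)"
      then have x': "x' \<in> space states" by (simp add: weight_kernel.space_kernel_pair)
      have "ennreal (snd x) * (ennreal (q (fst x') (fst x)) * ennreal (accept_prob x x')) = ennreal (flow x x')"
        unfolding accept_prob_flow[OF x x', symmetric]
        using weight_nonneg[OF x] q_nonneg[OF fst_space[OF x] fst_space[OF x']] accept_prob_bounds[OF x x']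
        by (simp add: ennreal_mult)
      then show "ennreal (snd x) * (ennreal (q (fst x') (fst x)) * (ennreal (accept_prob x x') * G (x, x'))) = ennreal (flow x x') * G (x, x')"
        by (simp add: mult.assoc[symmetric])
    qed
    finally show ?thesis .
  qed
  have fm: "(\<lambda>x. \<integral>\<^sup>+x'. ennreal (flow x x') * G (x, x') \<partial>base M) \<in> borel_measurable (base M)"
    by (rule base.borel_measurable_nn_integral) (simp add: case_prod_beta')
  have "(\<integral>\<^sup>+x. \<integral>\<^sup>+y. G (x, y) \<partial>Q M x \<partial>extended_target M) =
      (1 / total) * (\<integral>\<^sup>+x. (\<integral>\<^sup>+x'. ennreal (flow x x') * G (x, x') \<partial>base M) + stay M x * G (x, x) \<partial>base M)"
    unfolding nn_integral_extended_target[OF M Qm]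
    by (intro arg_cong[where f = "\<lambda>a. _ * a"] nn_integral_cong) (simp add: eq weight_kernel.space_kernel_pair)
  also have "(\<integral>\<^sup>+x. (\<integral>\<^sup>+x'. ennreal (flow x x') * G (x, x') \<partial>base M) + stay M x * G (x, x) \<partial>base M) =
      (\<integral>\<^sup>+x. \<integral>\<^sup>+x'. ennreal (flow x x') * G (x, x') \<partial>base M \<partial>base M) + (\<integral>\<^sup>+x. stay M x * G (x, x) \<partial>base M)"
    by (rule nn_integral_add[OF fm]) measurable
  finally show ?thesis .
qed

text \<open>Swapping the two states exchanges the order of integration in the flow part, where
  \<open>flow\<close> is symmetric, and does nothing to the diagonal part.\<close>

lemma reversible_chain_Q:
  assumes M: "1 \<le> M"
  shows "reversible_chain (extended_target M) (Q M)"
proof (rule reversible_chain.intro[OF prob_space_extended_target[OF M] reversible_chain_axioms.intro])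
  have pa: "prob_algebra (extended_target M) = prob_algebra states"
    by (simp add: prob_algebra_def cong: subprob_algebra_cong)
  show "Q M \<in> extended_target M \<rightarrow>\<^sub>M prob_algebra (extended_target M)"
    unfolding pa using Q_kernel[of M] by simp
  fix F :: "_ \<Rightarrow> ennreal" assume "F \<in> borel_measurable (extended_target M \<Otimes>\<^sub>M extended_target M)"
  then have F[measurable]: "F \<in> borel_measurable (states \<Otimes>\<^sub>M states)"
    using measurable_cong_sets[OF sets_pair_measure_cong[OF sets_extended_target sets_extended_target] refl] by blast
  interpret pair_sigma_finite "base M" "base M" ..
  have "(\<integral>\<^sup>+x. \<integral>\<^sup>+x'. ennreal (flow x x') * F (x, x') \<partial>base M \<partial>base M) =
      (\<integral>\<^sup>+x'. \<integral>\<^sup>+x. ennreal (flow x x') * F (x, x') \<partial>base M \<partial>base M)"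
    by (rule Fubini'[symmetric]) (simp add: case_prod_beta')
  also have "\<dots> = (\<integral>\<^sup>+x. \<integral>\<^sup>+x'. ennreal (flow x x') * F (x', x) \<partial>base M \<partial>base M)"
    by (simp add: flow_commute)
  finally have sw: "(\<integral>\<^sup>+x. \<integral>\<^sup>+x'. ennreal (flow x x') * F (x, x') \<partial>base M \<partial>base M) =
      (\<integral>\<^sup>+x. \<integral>\<^sup>+x'. ennreal (flow x x') * F (x', x) \<partial>base M \<partial>base M)" .
  have F': "(\<lambda>z. F (snd z, fst z)) \<in> borel_measurable (states \<Otimes>\<^sub>M states)" by measurable
  show "(\<integral>\<^sup>+x. \<integral>\<^sup>+y. F (x, y) \<partial>Q M x \<partial>extended_target M) = (\<integral>\<^sup>+x. \<integral>\<^sup>+y. F (y, x) \<partial>Q M x \<partial>extended_target M)"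
    using nn_integral_chain[OF M F] nn_integral_chain[OF M F'] sw by simp
qed

section \<open>The marginal on the parameter\<close>

lemma target_eq: "target = normalize_measure (density \<Theta> (\<lambda>\<theta>. ennreal (prior \<theta>) * match_prob \<theta>))"
  by (simp add: target_def match_prob_def)

lemma sets_target[simp, measurable_cong]: "sets target = sets \<Theta>"
  by (simp add: target_eq normalize_measure_def)

lemma nn_integral_target:
  assumes [measurable]: "F \<in> borel_measurable \<Theta>"
  shows "(\<integral>\<^sup>+\<theta>. F \<theta> \<partial>target) = (1 / total) * (\<integral>\<^sup>+\<theta>. ennreal (prior \<theta>) * match_prob \<theta> * F \<theta> \<partial>\<Theta>)"
proof -
  have Z: "emeasure (density \<Theta> (\<lambda>\<theta>. ennreal (prior \<theta>) * match_prob \<theta>))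
      (space (density \<Theta> (\<lambda>\<theta>. ennreal (prior \<theta>) * match_prob \<theta>))) = total"
    by (subst emeasure_density) (simp_all add: total_def cong: nn_integral_cong)
  show ?thesis
    unfolding target_eq normalize_measure_def Z
    by (subst nn_integral_scale_measure) (simp_all add: nn_integral_density)
qed

text \<open>Integrating out the weight leaves its mean, which is the same for every
  \<open>M\<close>. Integrals and square integrability of functions of the parameter therefore carry
  over from one \<open>M\<close> to another.\<close>

lemma distr_extended_target_fst:
  assumes M: "1 \<le> M"
  shows "distr (extended_target M) target fst = target"
proof (rule measure_eqI)
  fix A assume "A \<in> sets (distr (extended_target M) target fst)"
  then have A[measurable]: "A \<in> sets \<Theta>" by simp
  have "emeasure (distr (extended_target M) target fst) A = (\<integral>\<^sup>+\<theta>. indicator A \<theta> \<partial>distr (extended_target M) target fst)"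
    using A by simp
  also have "\<dots> = (\<integral>\<^sup>+x. indicator A (fst x) \<partial>extended_target M)"
    by (rule nn_integral_distr) measurable
  also have "\<dots> = (\<integral>\<^sup>+\<theta>. indicator A \<theta> \<partial>target)"
    by (simp add: nn_integral_extended_target[OF M] nn_integral_base_weight[OF M] nn_integral_target del: nn_integral_indicator)
  also have "\<dots> = emeasure target A" using A by simp
  finally show "emeasure (distr (extended_target M) target fst) A = emeasure target A" .
qed simp

lemma integral_extended_target_fst:
  fixes v :: "'a \<Rightarrow> real"
  assumes M: "1 \<le> M" and [measurable]: "v \<in> borel_measurable \<Theta>"
  shows "(\<integral>x. v (fst x) \<partial>extended_target M) = (\<integral>\<theta>. v \<theta> \<partial>target)"
proof -
  have "(\<integral>\<theta>. v \<theta> \<partial>distr (extended_target M) target fst) = (\<integral>x. v (fst x) \<partial>extended_target M)"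
    by (rule integral_distr) measurable
  then show ?thesis by (simp only: distr_extended_target_fst[OF M])
qed

lemma L2_extended_target_fst:
  assumes M: "1 \<le> M" and [measurable]: "v \<in> borel_measurable \<Theta>"
  shows "(\<lambda>x. v (fst x)) \<in> L2 (extended_target M) \<longleftrightarrow> v \<in> L2 target"
proof -
  have "integrable (distr (extended_target M) target fst) (\<lambda>\<theta>. (v \<theta>)\<^sup>2) \<longleftrightarrow> integrable (extended_target M) (\<lambda>x. (v (fst x))\<^sup>2)"
    by (rule integrable_distr_eq) measurable
  then show ?thesis
    unfolding distr_extended_target_fst[OF M] L2_def by auto
qed

section \<open>Dirichlet energies of functions of the parameter\<close>

lemma nn_integral_base:
  assumes F[measurable]: "F \<in> borel_measurable states"
  shows "(\<integral>\<^sup>+x. F x \<partial>base M) =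
    (\<integral>\<^sup>+\<theta>. \<integral>\<^sup>+y. F (\<theta>, prior \<theta> * mean_match M y) \<partial>PiM {..<M} (\<lambda>_. data_law \<theta>) \<partial>\<Theta>)"
  unfolding weight_kernel.nn_integral_kernel_pair[OF F]
proof (intro nn_integral_cong)
  fix \<theta> assume \<theta>: "\<theta> \<in> space \<Theta>"
  have "(\<lambda>t. F (\<theta>, t)) \<in> borel_measurable weights"
    using measurable_compose[OF measurable_Pair1'[OF \<theta>] F] by simp
  then show "(\<integral>\<^sup>+t. F (\<theta>, t) \<partial>T_law M \<theta>) = (\<integral>\<^sup>+y. F (\<theta>, prior \<theta> * mean_match M y) \<partial>PiM {..<M} (\<lambda>_. data_law \<theta>))"
    by (rule nn_integral_T_law[OF \<theta>])
qed

text \<open>The value of \<open>flow\<close> between two states whose fractions of matches are both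
  1.\<close>

definition rate :: "'a \<Rightarrow> 'a \<Rightarrow> real" where
  "rate \<theta> \<theta>' = min (prior \<theta> * q \<theta>' \<theta>) (prior \<theta>' * q \<theta> \<theta>')"

lemma rate_measurable[measurable]: "(\<lambda>z. rate (fst z) (snd z)) \<in> borel_measurable (\<Theta> \<Otimes>\<^sub>M \<Theta>)"
  unfolding rate_def by measurable

lemma flow_eq:
  "flow (\<theta>, prior \<theta> * w) (\<theta>', prior \<theta>' * w') = min (prior \<theta> * q \<theta>' \<theta> * w) (prior \<theta>' * q \<theta> \<theta>' * w')"
  by (simp add: flow_def mult.commute mult.left_commute)

text \<open>For \<open>G (\<theta>, \<theta>') = (u \<theta> - u \<theta>')^2\<close> this is the
  Dirichlet integral of \<open>u\<close> before division by \<open>total\<close>. Working in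
  \<open>ennreal\<close> lets energies be compared before integrability is settled.\<close>

definition energy :: "nat \<Rightarrow> ('a \<times> 'a \<Rightarrow> ennreal) \<Rightarrow> ennreal" where
  "energy M G = (\<integral>\<^sup>+x. \<integral>\<^sup>+x'. ennreal (flow x x') * G (fst x, fst x') \<partial>base M \<partial>base M)"

lemma energy_eq:
  assumes [measurable]: "G \<in> borel_measurable (\<Theta> \<Otimes>\<^sub>M \<Theta>)"
  shows "energy M G = (\<integral>\<^sup>+\<theta>. \<integral>\<^sup>+y. \<integral>\<^sup>+\<theta>'. \<integral>\<^sup>+y'.
      ennreal (flow (\<theta>, prior \<theta> * mean_match M y) (\<theta>', prior \<theta>' * mean_match M y')) * G (\<theta>, \<theta>')
      \<partial>PiM {..<M} (\<lambda>_. data_law \<theta>') \<partial>\<Theta> \<partial>PiM {..<M} (\<lambda>_. data_law \<theta>) \<partial>\<Theta>)"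
proof -
  have m: "(\<lambda>z. ennreal (flow (fst z) (snd z)) * G (fst (fst z), fst (snd z))) \<in> borel_measurable (states \<Otimes>\<^sub>M states)"
    by measurable
  have "(\<lambda>x. \<integral>\<^sup>+x'. ennreal (flow x x') * G (fst x, fst x') \<partial>base M) \<in> borel_measurable states"
    by (rule base.borel_measurable_nn_integral) (use m in \<open>simp add: case_prod_beta'\<close>)
  then have "energy M G = (\<integral>\<^sup>+\<theta>. \<integral>\<^sup>+y. (\<integral>\<^sup>+x'. ennreal (flow (\<theta>, prior \<theta> * mean_match M y) x') * G (\<theta>, fst x') \<partial>base M)
      \<partial>PiM {..<M} (\<lambda>_. data_law \<theta>) \<partial>\<Theta>)"
    unfolding energy_def by (subst nn_integral_base) simp_all
  also have "\<dots> = (\<integral>\<^sup>+\<theta>. \<integral>\<^sup>+y. \<integral>\<^sup>+\<theta>'. \<integral>\<^sup>+y'.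
      ennreal (flow (\<theta>, prior \<theta> * mean_match M y) (\<theta>', prior \<theta>' * mean_match M y')) * G (\<theta>, \<theta>')
      \<partial>PiM {..<M} (\<lambda>_. data_law \<theta>') \<partial>\<Theta> \<partial>PiM {..<M} (\<lambda>_. data_law \<theta>) \<partial>\<Theta>)"
  proof (intro nn_integral_cong)
    fix \<theta> y assume \<theta>: "\<theta> \<in> space \<Theta>"
    have "(\<theta>, prior \<theta> * mean_match M y) \<in> space states"
      using \<theta> by (simp add: space_pair_measure prior_nonneg mean_match_nonneg)
    from measurable_compose[OF measurable_Pair1'[OF this] m]
    have "(\<lambda>x'. ennreal (flow (\<theta>, prior \<theta> * mean_match M y) x') * G (\<theta>, fst x')) \<in> borel_measurable states" by simp
    from nn_integral_base[OF this, of M]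
    show "(\<integral>\<^sup>+x'. ennreal (flow (\<theta>, prior \<theta> * mean_match M y) x') * G (\<theta>, fst x') \<partial>base M) =
      (\<integral>\<^sup>+\<theta>'. \<integral>\<^sup>+y'. ennreal (flow (\<theta>, prior \<theta> * mean_match M y) (\<theta>', prior \<theta>' * mean_match M y')) * G (\<theta>, \<theta>')
      \<partial>PiM {..<M} (\<lambda>_. data_law \<theta>') \<partial>\<Theta>)" by simp
  qed
  finally show ?thesis .
qed

text \<open>Given the parameters the two sets of samples are independent, so unbiasedness applies to
  each in turn. The result no longer contains \<open>M\<close>, which is what makes energies for
  different \<open>M\<close> comparable.\<close>

lemma nn_integral_mean_match_product:
  assumes M: "1 \<le> M" and c[measurable]: "c \<in> borel_measurable (\<Theta> \<Otimes>\<^sub>M \<Theta>)"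
  shows "(\<integral>\<^sup>+\<theta>. \<integral>\<^sup>+y. \<integral>\<^sup>+\<theta>'. \<integral>\<^sup>+y'. ennreal (mean_match M y * mean_match M y') * c (\<theta>, \<theta>')
      \<partial>PiM {..<M} (\<lambda>_. data_law \<theta>') \<partial>\<Theta> \<partial>PiM {..<M} (\<lambda>_. data_law \<theta>) \<partial>\<Theta>) =
    (\<integral>\<^sup>+\<theta>. match_prob \<theta> * (\<integral>\<^sup>+\<theta>'. match_prob \<theta>' * c (\<theta>, \<theta>') \<partial>\<Theta>) \<partial>\<Theta>)"
proof (intro nn_integral_cong)
  fix \<theta> assume \<theta>: "\<theta> \<in> space \<Theta>"
  have wm: "(\<lambda>y. ennreal (mean_match M y)) \<in> borel_measurable (PiM {..<M} (\<lambda>_. data_law \<theta>))" if "\<theta> \<in> space \<Theta>" for \<theta>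
    by (simp add: measurable_cong_sets[OF sets_samples[OF that] refl])
  have [measurable]: "(\<lambda>\<theta>'. c (\<theta>, \<theta>')) \<in> borel_measurable \<Theta>"
    using measurable_compose[OF measurable_Pair1'[OF \<theta>] c] by simp
  have inner: "(\<integral>\<^sup>+\<theta>'. \<integral>\<^sup>+y'. ennreal (mean_match M y * mean_match M y') * c (\<theta>, \<theta>')
      \<partial>PiM {..<M} (\<lambda>_. data_law \<theta>') \<partial>\<Theta>) = ennreal (mean_match M y) * (\<integral>\<^sup>+\<theta>'. match_prob \<theta>' * c (\<theta>, \<theta>') \<partial>\<Theta>)" for y
  proof -
    have "(\<integral>\<^sup>+\<theta>'. \<integral>\<^sup>+y'. ennreal (mean_match M y * mean_match M y') * c (\<theta>, \<theta>')
      \<partial>PiM {..<M} (\<lambda>_. data_law \<theta>') \<partial>\<Theta>) =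
      (\<integral>\<^sup>+\<theta>'. \<integral>\<^sup>+y'. (ennreal (mean_match M y) * c (\<theta>, \<theta>')) * ennreal (mean_match M y')
      \<partial>PiM {..<M} (\<lambda>_. data_law \<theta>') \<partial>\<Theta>)"
      by (simp add: ennreal_mult mean_match_nonneg mult.commute mult.left_commute)
    also have "\<dots> = (\<integral>\<^sup>+\<theta>'. ennreal (mean_match M y) * (match_prob \<theta>' * c (\<theta>, \<theta>')) \<partial>\<Theta>)"
      by (intro nn_integral_cong, subst nn_integral_cmult)
         (simp_all add: wm nn_integral_mean_match[OF _ M] mult.commute mult.left_commute)
    also have "\<dots> = ennreal (mean_match M y) * (\<integral>\<^sup>+\<theta>'. match_prob \<theta>' * c (\<theta>, \<theta>') \<partial>\<Theta>)"
      by (rule nn_integral_cmult) measurable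
    finally show ?thesis .
  qed
  show "(\<integral>\<^sup>+y. \<integral>\<^sup>+\<theta>'. \<integral>\<^sup>+y'. ennreal (mean_match M y * mean_match M y') * c (\<theta>, \<theta>')
      \<partial>PiM {..<M} (\<lambda>_. data_law \<theta>') \<partial>\<Theta> \<partial>PiM {..<M} (\<lambda>_. data_law \<theta>)) =
    match_prob \<theta> * (\<integral>\<^sup>+\<theta>'. match_prob \<theta>' * c (\<theta>, \<theta>') \<partial>\<Theta>)"
    unfolding inner by (subst nn_integral_multc) (simp_all add: wm \<theta> nn_integral_mean_match[OF _ M])
qed

text \<open>A function that vanishes on the diagonal does not see the rejection part of the chain,
  so only the flow remains.\<close>

lemma nn_integral_joint_fst_energy:
  assumes M: "1 \<le> M" and [measurable]: "G \<in> borel_measurable (\<Theta> \<Otimes>\<^sub>M \<Theta>)" and diag: "\<And>\<theta>. G (\<theta>, \<theta>) = 0"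
  shows "(\<integral>\<^sup>+z. G (fst (fst z), fst (snd z)) \<partial>kernel_pair (extended_target M) (Q M) (extended_target M)) = (1 / total) * energy M G"
proof -
  interpret reversible_chain "extended_target M" "Q M" by (rule reversible_chain_Q[OF M])
  have "(\<integral>\<^sup>+z. G (fst (fst z), fst (snd z)) \<partial>joint) = (\<integral>\<^sup>+x. \<integral>\<^sup>+y. G (fst x, fst y) \<partial>Q M x \<partial>extended_target M)"
    by (subst nn_integral_kernel_pair) simp_all
  also have "\<dots> = (1 / total) * energy M G"
    using nn_integral_chain[OF M, of "\<lambda>z. G (fst (fst z), fst (snd z))"] by (simp add: energy_def diag)
  finally show ?thesis .
qed

end

section \<open>The uniform kernel\<close>

text \<open>With two kernel values every fraction of matches is a multiple of \<open>1 / M\<close>,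
  which leaves a gap between 0 and the smallest positive one.\<close>

locale abc_indicator = abc_model +
  assumes K_values: "K z = 0 \<or> K z = 1"
begin

lemma mean_match_values: "mean_match M y = 0 \<or> 1 \<le> real M * mean_match M y"
proof (cases "\<forall>i<M. match (y i) = 0")
  case False
  then obtain i where i: "i < M" "match (y i) = 1" using K_values by (auto simp: match_def)
  have "match (y i) \<le> (\<Sum>i<M. match (y i))"
    using i(1) by (intro member_le_sum) (simp_all add: match_nonneg)
  then show ?thesis using i by (simp add: mean_match_def)
qed (simp add: mean_match_def)

text \<open>A positive weight is at least \<open>1 / M\<close>, so multiplying by \<open>M w\<close> only increases.\<close>

lemma flow_le:
  assumes "\<theta> \<in> space \<Theta>" "\<theta>' \<in> space \<Theta>"
  shows "flow (\<theta>, prior \<theta> * mean_match M y) (\<theta>', prior \<theta>' * mean_match M y') \<le>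
    mean_match M y * mean_match M y' * (real M * rate \<theta> \<theta>')"
proof -
  define a where "a = prior \<theta> * q \<theta>' \<theta>"
  define b where "b = prior \<theta>' * q \<theta> \<theta>'"
  have ab: "0 \<le> a" "0 \<le> b" using assms by (simp_all add: a_def b_def prior_nonneg q_nonneg)
  have le: "min (a * w) (b * w') \<le> w * w' * (real M * min a b)"
    if "0 \<le> w" "0 \<le> w'" "w = 0 \<or> 1 \<le> real M * w" "w' = 0 \<or> 1 \<le> real M * w'" for w w'
  proof (cases "w = 0 \<or> w' = 0")
    case True
    then show ?thesis using that ab by auto
  next
    case False
    have "a * w * 1 \<le> a * w * (real M * w')" "b * w' * 1 \<le> b * w' * (real M * w)"
      using False that ab by (intro mult_left_mono; simp)+
    then have "min (a * w) (b * w') \<le> w * w' * (real M * a)" "min (a * w) (b * w') \<le> w * w' * (real M * b)"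
      by (simp_all add: mult_ac min.coboundedI1 min.coboundedI2)
    then show ?thesis by (simp add: min_def[of a b])
  qed
  show ?thesis
    unfolding flow_eq rate_def a_def[symmetric] b_def[symmetric]
    by (intro le mean_match_nonneg mean_match_values)
qed

text \<open>Factors that are 0 or 1 can be pulled out of a minimum of nonnegative numbers as their
  product.\<close>

lemma flow_single:
  assumes "\<theta> \<in> space \<Theta>" "\<theta>' \<in> space \<Theta>"
  shows "flow (\<theta>, prior \<theta> * mean_match 1 y) (\<theta>', prior \<theta>' * mean_match 1 y') =
    mean_match 1 y * mean_match 1 y' * rate \<theta> \<theta>'"
proof -
  have "0 \<le> prior \<theta> * q \<theta>' \<theta>" "0 \<le> prior \<theta>' * q \<theta> \<theta>'"
    using assms by (simp_all add: prior_nonneg q_nonneg)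
  then show ?thesis
    using K_values[of "\<eta> y_obs - \<eta> (y 0)"] K_values[of "\<eta> y_obs - \<eta> (y' 0)"]
    unfolding flow_eq rate_def by (auto simp: mean_match_def match_def)
qed

lemma rate_nonneg: "\<theta> \<in> space \<Theta> \<Longrightarrow> \<theta>' \<in> space \<Theta> \<Longrightarrow> 0 \<le> rate \<theta> \<theta>'"
  by (simp add: rate_def prior_nonneg q_nonneg)

lemma energy_single:
  assumes [measurable]: "G \<in> borel_measurable (\<Theta> \<Otimes>\<^sub>M \<Theta>)"
  shows "energy 1 G = (\<integral>\<^sup>+\<theta>. match_prob \<theta> * (\<integral>\<^sup>+\<theta>'. match_prob \<theta>' * (ennreal (rate \<theta> \<theta>') * G (\<theta>, \<theta>')) \<partial>\<Theta>) \<partial>\<Theta>)"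
proof -
  have "energy 1 G = (\<integral>\<^sup>+\<theta>. \<integral>\<^sup>+y. \<integral>\<^sup>+\<theta>'. \<integral>\<^sup>+y'.
      ennreal (mean_match 1 y * mean_match 1 y') * (ennreal (rate \<theta> \<theta>') * G (\<theta>, \<theta>'))
      \<partial>PiM {..<1} (\<lambda>_. data_law \<theta>') \<partial>\<Theta> \<partial>PiM {..<1} (\<lambda>_. data_law \<theta>) \<partial>\<Theta>)"
    unfolding energy_eq[OF assms]
    by (intro nn_integral_cong) (simp add: flow_single ennreal_mult mean_match_nonneg rate_nonneg mult.assoc del: One_nat_def)
  then show ?thesis
    using nn_integral_mean_match_product[of 1 "\<lambda>z. ennreal (rate (fst z) (snd z)) * G z"] by simp
qed

text \<open>After the pointwise bound the weights enter only through their product and integrate to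
  \<open>match_prob\<close> at each parameter, exactly as they do for a single sample.\<close>

lemma energy_le:
  assumes M: "1 \<le> M" and [measurable]: "G \<in> borel_measurable (\<Theta> \<Otimes>\<^sub>M \<Theta>)"
  shows "energy M G \<le> ennreal (real M) * energy 1 G"
proof -
  let ?c = "\<lambda>z. ennreal (rate (fst z) (snd z)) * G z"
  have cm: "(\<lambda>\<theta>'. match_prob \<theta>' * ?c (\<theta>, \<theta>')) \<in> borel_measurable \<Theta>" if "\<theta> \<in> space \<Theta>" for \<theta>
    using measurable_compose[OF measurable_Pair1'[OF that], of "\<lambda>z. match_prob (snd z) * ?c z"] by simp
  have om: "(\<lambda>\<theta>. match_prob \<theta> * (\<integral>\<^sup>+\<theta>'. match_prob \<theta>' * ?c (\<theta>, \<theta>') \<partial>\<Theta>)) \<in> borel_measurable \<Theta>"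
    by measurable
  have "energy M G \<le> (\<integral>\<^sup>+\<theta>. \<integral>\<^sup>+y. \<integral>\<^sup>+\<theta>'. \<integral>\<^sup>+y'.
      ennreal (mean_match M y * mean_match M y') * (ennreal (real M) * ?c (\<theta>, \<theta>'))
      \<partial>PiM {..<M} (\<lambda>_. data_law \<theta>') \<partial>\<Theta> \<partial>PiM {..<M} (\<lambda>_. data_law \<theta>) \<partial>\<Theta>)"
    unfolding energy_eq[OF assms(2)]
  proof (intro nn_integral_mono)
    fix \<theta> y \<theta>' y' assume \<theta>: "\<theta> \<in> space \<Theta>" "\<theta>' \<in> space \<Theta>"
    have "ennreal (flow (\<theta>, prior \<theta> * mean_match M y) (\<theta>', prior \<theta>' * mean_match M y')) * G (\<theta>, \<theta>') \<le>
        ennreal (mean_match M y * mean_match M y' * (real M * rate \<theta> \<theta>')) * G (\<theta>, \<theta>')"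
      using flow_le[OF \<theta>] by (intro mult_right_mono ennreal_leI) auto
    also have "\<dots> = ennreal (mean_match M y * mean_match M y') * (ennreal (real M) * ?c (\<theta>, \<theta>'))"
      using \<theta> by (simp add: ennreal_mult mean_match_nonneg rate_nonneg mult.assoc)
    finally show "ennreal (flow (\<theta>, prior \<theta> * mean_match M y) (\<theta>', prior \<theta>' * mean_match M y')) * G (\<theta>, \<theta>') \<le>
      ennreal (mean_match M y * mean_match M y') * (ennreal (real M) * ?c (\<theta>, \<theta>'))" .
  qed
  also have "\<dots> = (\<integral>\<^sup>+\<theta>. match_prob \<theta> * (\<integral>\<^sup>+\<theta>'. match_prob \<theta>' * (ennreal (real M) * ?c (\<theta>, \<theta>')) \<partial>\<Theta>) \<partial>\<Theta>)"
    by (rule nn_integral_mean_match_product[OF M]) measurable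
  also have "\<dots> = (\<integral>\<^sup>+\<theta>. ennreal (real M) * (match_prob \<theta> * (\<integral>\<^sup>+\<theta>'. match_prob \<theta>' * ?c (\<theta>, \<theta>') \<partial>\<Theta>)) \<partial>\<Theta>)"
  proof (intro nn_integral_cong)
    fix \<theta> assume "\<theta> \<in> space \<Theta>"
    from nn_integral_cmult[OF cm[OF this], of "ennreal (real M)"]
    show "match_prob \<theta> * (\<integral>\<^sup>+\<theta>'. match_prob \<theta>' * (ennreal (real M) * ?c (\<theta>, \<theta>')) \<partial>\<Theta>) =
      ennreal (real M) * (match_prob \<theta> * (\<integral>\<^sup>+\<theta>'. match_prob \<theta>' * ?c (\<theta>, \<theta>') \<partial>\<Theta>))"
      by (simp add: mult.left_commute)
  qed
  also have "\<dots> = ennreal (real M) * (\<integral>\<^sup>+\<theta>. match_prob \<theta> * (\<integral>\<^sup>+\<theta>'. match_prob \<theta>' * ?c (\<theta>, \<theta>') \<partial>\<Theta>) \<partial>\<Theta>)"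
    by (rule nn_integral_cmult[OF om])
  also have "\<dots> = ennreal (real M) * energy 1 G"
    using energy_single[OF assms(2)] by simp
  finally show ?thesis .
qed

section \<open>Transfer from a single pseudo-sample to several\<close>

lemma AE_single_weight: "AE x in extended_target 1. snd x = prior (fst x)"
proof -
  define N where "N = {x \<in> space states. snd x \<noteq> prior (fst x)}"
  have [measurable]: "N \<in> sets states" unfolding N_def by measurable
  have "(\<integral>\<^sup>+x. ennreal (snd x) * indicator N x \<partial>base 1) = (\<integral>\<^sup>+\<theta>. \<integral>\<^sup>+y.
      ennreal (prior \<theta> * mean_match 1 y) * indicator N (\<theta>, prior \<theta> * mean_match 1 y)
      \<partial>PiM {..<1} (\<lambda>_. data_law \<theta>) \<partial>\<Theta>)"
    by (subst nn_integral_base; (measurable | simp))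
  also have "\<dots> = 0"
  proof -
    \<comment> \<open>Without a match the weight is 0 and the density \<open>t\<close> of the
      extended target kills the state; with a match the weight equals the prior density, so the
      state lies outside \<open>N\<close>.\<close>
    have "ennreal (prior \<theta> * mean_match 1 y) * indicator N (\<theta>, prior \<theta> * mean_match 1 y) = 0" for \<theta> y
      using K_values[of "\<eta> y_obs - \<eta> (y 0)"] by (auto simp: mean_match_def match_def N_def)
    then show ?thesis by (simp only: nn_integral_const mult_zero_left)
  qed
  finally have "(\<integral>\<^sup>+x. indicator N x \<partial>extended_target 1) = 0"
    by (subst nn_integral_extended_target) simp_all
  then have "emeasure (extended_target 1) N = 0" by simp
  then show ?thesis
    by (intro AE_I[of _ _ N]) (auto simp: space_extended_target N_def)
qed

lemma asymptotic_variance_single_le: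
  assumes M: "1 \<le> M" and nonneg: "nonneg_definite (Q M) (extended_target M)" and f: "f \<in> L2 target"
  shows "asymptotic_variance (\<lambda>(\<theta>, t). f \<theta>) (Q 1) (extended_target 1)
    \<le> ereal (2 * real M - 1) * asymptotic_variance (\<lambda>(\<theta>, t). f \<theta>) (Q M) (extended_target M)"
proof -
  interpret c1: reversible_chain "extended_target 1" "Q 1" by (rule reversible_chain_Q) simp
  interpret cM: reversible_chain "extended_target M" "Q M" by (rule reversible_chain_Q[OF M])
  have fm[measurable]: "f \<in> borel_measurable \<Theta>"
    using L2_measurable[OF f] by simp
  have f': "(\<lambda>(\<theta>, t). f \<theta>) = (\<lambda>x::'a \<times> real. f (fst x))" by auto
  have eq: "(\<integral>x. v (fst x) \<partial>extended_target M) = (\<integral>x. v (fst x) \<partial>extended_target 1)"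
    if "v \<in> borel_measurable \<Theta>" for v :: "'a \<Rightarrow> real"
    using integral_extended_target_fst[OF M that] integral_extended_target_fst[OF order_refl that] by simp
  show ?thesis
    unfolding f'
  proof (rule asymptotic_variance_le[OF reversible_chain_Q reversible_chain_Q[OF M]])
    show "(\<lambda>x. f (fst x)) \<in> L2 (extended_target 1)" "(\<lambda>x. f (fst x)) \<in> L2 (extended_target M)"
      using f L2_extended_target_fst[OF M fm] L2_extended_target_fst[OF order_refl fm] by simp_all
    show "1 \<le> real M" using M by simp
    show "(\<integral>x. f (fst x) \<partial>extended_target M) = (\<integral>x. f (fst x) \<partial>extended_target 1)" by (rule eq[OF fm])
    show "(\<integral>x. f (fst x) * f (fst x) \<partial>extended_target M) = (\<integral>x. f (fst x) * f (fst x) \<partial>extended_target 1)"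
      by (rule eq[of "\<lambda>\<theta>. f \<theta> * f \<theta>"]) measurable
    show "nonneg_definite (Q M) (extended_target M)" by (rule nonneg)
    fix g assume g: "g \<in> L2 (extended_target 1)"
    have gm[measurable]: "g \<in> borel_measurable states"
      using L2_measurable[OF g] by simp
    \<comment> \<open>The weight is replaced by its almost sure value. The result depends on the
      parameter alone and so can be read as a function on the extended target for
      \<open>M\<close>.\<close>
    define u where "u \<theta> = g (\<theta>, prior \<theta>)" for \<theta>
    have prior_weights: "prior \<in> \<Theta> \<rightarrow>\<^sub>M weights"
      by (rule measurable_weightsI[OF prior_measurable prior_nonneg])
    have um[measurable]: "u \<in> borel_measurable \<Theta>"
      using measurable_compose[OF measurable_Pair[OF measurable_ident prior_weights] gm]
      by (simp add: u_def[abs_def])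
    have ae: "AE x in extended_target 1. g x = u (fst x)"
      using AE_single_weight by eventually_elim (simp add: u_def, metis prod.collapse)
    have uL2: "(\<lambda>x. u (fst x)) \<in> L2 (extended_target 1)"
    proof -
      have "integrable (extended_target 1) (\<lambda>x. (u (fst x))\<^sup>2)"
        by (rule integrable_cong_AE_imp[OF L2_integrable_square[OF g]])
           (use ae in \<open>auto elim!: eventually_mono\<close>)
      then show ?thesis by (auto simp: L2_def)
    qed
    have uM: "(\<lambda>x. u (fst x)) \<in> L2 (extended_target M)"
      using uL2 L2_extended_target_fst[OF M um] L2_extended_target_fst[OF order_refl um] by simp
    define G where "G z = ennreal ((u (fst z) - u (snd z))\<^sup>2)" for z
    have [measurable]: "G \<in> borel_measurable (\<Theta> \<Otimes>\<^sub>M \<Theta>)" unfolding G_def[abs_def] by measurable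
    have diri: "(\<integral>z. (u (fst (fst z)) - u (fst (snd z)))\<^sup>2 \<partial>kernel_pair (extended_target N) (Q N) (extended_target N)) =
        enn2real ((1 / total) * energy N G)" if "1 \<le> N" for N
    proof -
      interpret cN: reversible_chain "extended_target N" "Q N" by (rule reversible_chain_Q[OF that])
      show ?thesis
        using nn_integral_joint_fst_energy[OF that, of G]
        by (subst integral_eq_nn_integral) (simp_all add: G_def)
    qed
    \<comment> \<open>\<open>enn2real\<close> sends infinity to 0 and is monotone only below a
      finite bound. Square integrability of \<open>u\<close> provides this bound for a single
      sample.\<close>
    have fin: "(1 / total) * energy 1 G < \<infinity>"
    proof -
      have "integrable c1.joint (\<lambda>z. (u (fst (fst z)) - u (fst (snd z)))\<^sup>2)"
        using L2_integrable_square[OF L2_diff[OF c1.L2_joint[OF uL2]]] .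
      then show ?thesis
        using nn_integral_joint_fst_energy[of 1 G] by (simp add: integrable_iff_bounded G_def)
    qed
    \<comment> \<open>Both marginals of the joint law are the extended target, so an almost sure
      identity for one state holds at each of two successive states.\<close>
    have aej: "AE z in c1.joint. g (fst z) = u (fst (fst z)) \<and> g (snd z) = u (fst (snd z))"
    proof -
      have a: "AE x in distr c1.joint (extended_target 1) fst. g x = u (fst x)"
           "AE x in distr c1.joint (extended_target 1) snd. g x = u (fst x)"
        unfolding c1.distr_joint by (rule ae)+
      have m: "fst \<in> c1.joint \<rightarrow>\<^sub>M extended_target 1" "snd \<in> c1.joint \<rightarrow>\<^sub>M extended_target 1"
        by measurable
      show ?thesis
        using AE_distrD[OF m(1) a(1)] AE_distrD[OF m(2) a(2)] by eventually_elim simp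
    qed
    show "\<exists>g'\<in>L2 (extended_target M). (\<integral>x. g' x \<partial>extended_target M) = (\<integral>x. g x \<partial>extended_target 1) \<and>
      (\<integral>x. g' x * g' x \<partial>extended_target M) = (\<integral>x. g x * g x \<partial>extended_target 1) \<and>
      (\<integral>x. g' x * f (fst x) \<partial>extended_target M) = (\<integral>x. g x * f (fst x) \<partial>extended_target 1) \<and>
      (\<integral>z. (g' (fst z) - g' (snd z))\<^sup>2 \<partial>kernel_pair (extended_target M) (Q M) (extended_target M)) \<le>
        real M * (\<integral>z. (g (fst z) - g (snd z))\<^sup>2 \<partial>kernel_pair (extended_target 1) (Q 1) (extended_target 1))"
    proof (intro bexI[OF _ uM] conjI)
      have "(\<integral>x. g x \<partial>extended_target 1) = (\<integral>x. u (fst x) \<partial>extended_target 1)"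
        by (rule integral_cong_AE) (use ae in simp_all)
      then show "(\<integral>x. u (fst x) \<partial>extended_target M) = (\<integral>x. g x \<partial>extended_target 1)"
        using eq[OF um] by simp
      have "(\<integral>x. g x * g x \<partial>extended_target 1) = (\<integral>x. u (fst x) * u (fst x) \<partial>extended_target 1)"
        by (rule integral_cong_AE) (use ae in \<open>simp_all, auto elim!: eventually_mono\<close>)
      then show "(\<integral>x. u (fst x) * u (fst x) \<partial>extended_target M) = (\<integral>x. g x * g x \<partial>extended_target 1)"
        using eq[of "\<lambda>\<theta>. u \<theta> * u \<theta>"] by simp
      have "(\<integral>x. g x * f (fst x) \<partial>extended_target 1) = (\<integral>x. u (fst x) * f (fst x) \<partial>extended_target 1)"
        by (rule integral_cong_AE) (use ae in \<open>simp_all, auto elim!: eventually_mono\<close>)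
      then show "(\<integral>x. u (fst x) * f (fst x) \<partial>extended_target M) = (\<integral>x. g x * f (fst x) \<partial>extended_target 1)"
        using eq[of "\<lambda>\<theta>. u \<theta> * f \<theta>"] by simp
      have "(\<integral>z. (g (fst z) - g (snd z))\<^sup>2 \<partial>c1.joint) = (\<integral>z. (u (fst (fst z)) - u (fst (snd z)))\<^sup>2 \<partial>c1.joint)"
      proof (rule integral_cong_AE)
        show "AE z in c1.joint. (g (fst z) - g (snd z))\<^sup>2 = (u (fst (fst z)) - u (fst (snd z)))\<^sup>2"
          using aej by eventually_elim simp
      qed measurable
      also have "\<dots> = enn2real ((1 / total) * energy 1 G)" by (rule diri) simp
      finally have d1: "(\<integral>z. (g (fst z) - g (snd z))\<^sup>2 \<partial>c1.joint) = enn2real ((1 / total) * energy 1 G)" .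
      have "(1 / total) * energy M G \<le> (1 / total) * (ennreal (real M) * energy 1 G)"
        by (intro mult_left_mono energy_le[OF M]) simp_all
      also have "\<dots> = ennreal (real M) * ((1 / total) * energy 1 G)" by (rule mult.left_commute)
      finally have "enn2real ((1 / total) * energy M G) \<le> enn2real (ennreal (real M) * ((1 / total) * energy 1 G))"
        using fin by (intro enn2real_mono) (simp_all add: ennreal_mult_less_top)
      then show "(\<integral>z. (u (fst (fst z)) - u (fst (snd z)))\<^sup>2 \<partial>cM.joint) \<le> real M * (\<integral>z. (g (fst z) - g (snd z))\<^sup>2 \<partial>c1.joint)"
        unfolding d1 diri[OF M] by (simp add: enn2real_mult)
    qed
  qed simp
qed

end

theorem proposition4:
  fixes \<Theta> :: "'a measure" and prior :: "'a \<Rightarrow> real"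
    and Y :: "'b measure" and p :: "'b \<Rightarrow> 'a \<Rightarrow> real" and y_obs :: 'b
    and \<eta> :: "'b \<Rightarrow> 'v::real_normed_vector" and K :: "'v \<Rightarrow> real"
    and q :: "'a \<Rightarrow> 'a \<Rightarrow> real"
    and \<epsilon> :: real and M :: nat and f :: "'a \<Rightarrow> real"
  assumes "abc_model \<Theta> prior Y p y_obs \<eta> K q"
    and "0 < \<epsilon>"
    and "K = indicator {z. norm z < \<epsilon>}"
    and "1 \<le> M"
    and "nonneg_definite (abc_model.Q \<Theta> prior Y p y_obs \<eta> K q M)
           (abc_model.extended_target \<Theta> prior Y p y_obs \<eta> K M)"
    and "f \<in> L2 (abc_model.target \<Theta> prior Y p y_obs \<eta> K)"
  shows "asymptotic_variance (\<lambda>(\<theta>, t). f \<theta>)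
             (abc_model.Q \<Theta> prior Y p y_obs \<eta> K q 1)
             (abc_model.extended_target \<Theta> prior Y p y_obs \<eta> K 1)
           \<le> ereal (2 * real M - 1) *
             asymptotic_variance (\<lambda>(\<theta>, t). f \<theta>)
               (abc_model.Q \<Theta> prior Y p y_obs \<eta> K q M)
               (abc_model.extended_target \<Theta> prior Y p y_obs \<eta> K M)"
proof -
  interpret abc_indicator \<Theta> prior Y p y_obs \<eta> K q
    by (intro abc_indicator.intro abc_indicator_axioms.intro assms(1)) (simp add: assms(3) indicator_def)
  show ?thesis
    by (rule asymptotic_variance_single_le[OF assms(4-6)])
qed

end
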